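(* Let $S_{\mathfrak X}$ be the Clemens polytope of a strictly semi-stable formal scheme $\mathfrak X$, equipped with a simple density $\omega$. Fix two non-negative integers $g,n$ and a positive real number $A$. Let $M_{g,n}(S_{\mathfrak X},A)$ denote the set of simple $n$-pointed genus $g$ parametrized tropical curves in $S_{\mathfrak X}$ whose tropical degree with respect to $\omega$ is bounded by $A$. Then $M_{g,n}(S_{\mathfrak X},A)$, with its natural topology (described in the context), is a compact topological space with a stratification whose open strata are open convex polyhedrons (subsets of a real affine space given by the conjunction of finitely many strict linear inequalities). The strata are in one-to-one correspondence with the good simple $n$-pointed genus $g$ combinatorial types in $S_{\mathfrak X}$ whose tropical degree is bounded by $A$, the stratum corresponding to $\alpha$ being the set $M_\alpha$ of curves with combinatorial type $\alpha$.
   Context: **Clemens polytope.** Let $k$ be a complete discrete valuation field with valuation $\mathrm{val}$, ring of integers $k^\circ$, residue field $\tilde k$ and uniformizer $\varpi$. A formal scheme $\mathfrak X$ finitely presented over $k^\circ$ is strictly semi-stable if (i) every point has an open affine neighborhood whose structure morphism to $\mathrm{Spf}\,k^\circ$ factors through an étale morphism to $\mathrm{Spf}\big(k^\circ\{T_0,\dots,T_m,T_{d+1}^{-1},\dots,T_m^{-1}\}/(T_0\cdots T_d-\varpi)\big)$ for some $0\le d\le m$; (ii) all intersections of irreducible components of the special fiber $\mathfrak X_s$ are empty or geometrically irreducible. Let $\{D_i\mid i\in I_{\mathfrak X}\}$ be the (finite) set of irreducible components of $\mathfrak X_s$; for non-empty $I\subset I_{\mathfrak X}$ put $D_I=\bigcap_{i\in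 I}D_i$ and $J_I=\{j\in I_{\mathfrak X}\mid D_{I\cup\{j\}}\ne\emptyset\}$. The Clemens polytope $S_{\mathfrak X}\subset\mathbb R^{I_{\mathfrak X}}$ is the union of the simplices (faces) $\Delta^I=\{x\in\mathbb R_{\ge0}^{I_{\mathfrak X}}\mid \sum x_i=\mathrm{val}(\varpi),\ x_i=0\text{ for } i\notin I\}$ over all non-empty $I$ with $D_I\neq\emptyset$. **Parametrized tropical curves.** A flag $(v,e)$ of a graph is a vertex $v$ with an edge $e$ connected to $v$. An $n$-pointed parametrized tropical curve $(\Gamma,(\gamma_i),h)$ in $S_{\mathfrak X}$ consists of: a connected finite graph $\Gamma$ without self-loops; a continuous map $h$ from its topological realization to $S_{\mathfrak X}$ such that every edge embeds as an affine segment with rational slope in a face of $S_{\mathfrak X}$; for each flag $(v,e)$ a tropical weight vector $w_{(v,e)}\in\mathbb Z^{I_{\mathfrak X}}\setminus 0$, parallel to the direction of $h(e)$ pointing away from $h(v)$, with $w_{(u,e)}+w_{(v,e)}=0$ if $u,v$ are the two endpoints of $e$; for each vertex $v$ a genus $g(v)\in\mathbb Z_{\ge0}$; a sequence of vertices $\gamma_1,\dots,\gamma_n$ (marked points, not necessarily distinct). Let $n(v)$ be the number of marked points at $v$. The genus of the curve is $b_1(\Gamma)+\sum_v g(v)$. Put $\sigma_v=\sum_{e\ni v}w_{(v,e)}$; $v$ is of type A if $\sigma_v\ne0$ and of type B otherwise. The curve is simple if every vertex $v$ with $\deg(v)=2$ and $g(v)=n(v)=0$ is of type A. Simplification: remove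 every type B vertex $v$ with $\deg(v)=2$, $g(v)=n(v)=0$, replacing its two edges by a single edge with the corresponding weight vectors. **Combinatorial types.** An $n$-pointed combinatorial type $(\Gamma,(\gamma_i))$ in $S_{\mathfrak X}$ consists of a connected finite graph $\Gamma$ without self-loops; a non-empty subset $I_v\subset I_{\mathfrak X}$ for each vertex $v$; weight vectors $w_{(v,e)}\in\mathbb Z^{I_{\mathfrak X}}\setminus0$ for each flag, with $w_{(u,e)}+w_{(v,e)}=0$ for the two endpoints of each edge; genera $g(v)\in\mathbb Z_{\ge 0}$; and marked vertices $\gamma_1,\dots,\gamma_n$. A parametrized tropical curve has an associated combinatorial type, where $I_v$ is determined by $h(v)$ lying in the relative interior of $\Delta^{I_v}$. A combinatorial type is good if it comes from a parametrized tropical curve. Genus, types A/B, simplicity, simplification and tropical degree (below) are defined for combinatorial types by the same formulas. **Simple density and degree.** A simple density $\omega$ on $S_{\mathfrak X}$ is a collection of $\omega_{I,j}\in(0,+\infty]$ for every face $\Delta^I$ and $j\in J_I$ such that $\omega_{I,j}\ge\omega_{I',j}$ whenever $I\supset I'$ and $j\in J_I$. The local degree at a vertex $v$ with $h(v)$ in the relative interior of $\Delta^{I_v}$ is $\max_{j\in J_{I_v}}\omega_{I_v,j}\cdot|\sigma_v^j|$ (convention $(+\infty)\cdot0=0$); the tropical degree is the sum of the local degrees over all vertices. **Natural topology.** For a combinatorial type $\alpha=(\Gamma,(\gamma_i))$ occurring in $M_{g,n}(S_{\mathfrak X},A)$, let $M_\alpha$ be the subset of curves with combinatorial type $\alpha$.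 Fixing a root vertex $v_0$ of $\Gamma$, a curve in $M_\alpha$ is determined by the position $h(v_0)\in\mathbb R^{I_{\mathfrak X}}$ and the lengths of the segments $h(e)$, $e\in E(\Gamma)$; so $M_\alpha$ is a subset of $\mathbb R^{I_{\mathfrak X}}\times\mathbb R^{E(\Gamma)}$, cut out by: $h(v)$ lies in the relative interior of $\Delta^{I_v}$ for all $v$; the lengths are positive; the image of every cycle of $\Gamma$ closes up. The real affine space is the one cut out by the linear equations among these. Let $\overline M_\alpha$ be the closure. The map $\iota_\alpha\colon\overline M_\alpha\to M_{g,n}(S_{\mathfrak X},A)$ sends a point to the curve obtained by contracting each connected component of the subgraph of edges of length $0$ to a single vertex (of genus equal to the first Betti number of the contracted subgraph plus the sum of the genera of its vertices, carrying the marked points of its vertices) and then simplifying. The topology on $M_{g,n}(S_{\mathfrak X},A)$ is obtained by attaching the closed polyhedra $\overline M_\alpha$ along the maps $\iota_\alpha$, i.e. it is the quotient topology from $\bigsqcup_\alpha\overline M_\alpha$.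
   Formalization: Curves and combinatorial types are taken up to isomorphism; the stratum of α is the quotient of the open convex polyhedron M_α by Aut(α), homeomorphic to M_α when Aut(α) is trivial, since two interchangeable edges at a vertex make the literal identification false. *)

theory Defs
  imports "HOL-Analysis.Analysis"
begin

section \<open>Topological preliminaries\<close>

definition irreducible_in :: "'p topology \<Rightarrow> 'p set \<Rightarrow> bool" where
  "irreducible_in X S \<longleftrightarrow> S \<subseteq> topspace X \<and> S \<noteq> {} \<and>
     (\<forall>A B. closedin X A \<and> closedin X B \<and> S \<subseteq> A \<union> B \<longrightarrow> S \<subseteq> A \<or> S \<subseteq> B)"

definition irreducible_components :: "'p topology \<Rightarrow> 'p set set" where
  "irreducible_components X =
     {S. irreducible_in X S \<and> (\<forall>T. irreducible_in X T \<and> S \<subseteq> T \<longrightarrow> T = S)}"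

definition quotient_topology :: "'a topology \<Rightarrow> ('a \<Rightarrow> 'b) \<Rightarrow> 'b topology" where
  "quotient_topology X f =
     topology (\<lambda>U. U \<subseteq> f ` topspace X \<and> openin X {x \<in> topspace X. f x \<in> U})"

lemma openin_quotient_topology:
  "openin (quotient_topology X f) U \<longleftrightarrow>
     U \<subseteq> f ` topspace X \<and> openin X {x \<in> topspace X. f x \<in> U}"
proof -
  let ?P = "\<lambda>U. U \<subseteq> f ` topspace X \<and> openin X {x \<in> topspace X. f x \<in> U}"
  have "?P (S \<inter> T)" if "?P S" "?P T" for S T
  proof -
    have "{x \<in> topspace X. f x \<in> S \<inter> T} =
        {x \<in> topspace X. f x \<in> S} \<inter> {x \<in> topspace X. f x \<in> T}"
      by auto
    with that show ?thesis
      by (metis (no_types, lifting) le_infI1 openin_Int)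
  qed
  moreover have "?P (\<Union>K)" if "\<forall>S\<in>K. ?P S" for K
  proof -
    have "{x \<in> topspace X. f x \<in> \<Union>K} = \<Union>((\<lambda>S. {x \<in> topspace X. f x \<in> S}) ` K)"
      by auto
    moreover have "openin X (\<Union>((\<lambda>S. {x \<in> topspace X. f x \<in> S}) ` K))"
      using that by (intro openin_Union) blast
    ultimately show ?thesis
      using that by (simp add: Sup_le_iff)
  qed
  ultimately have "istopology ?P"
    unfolding istopology_def by blast
  then show ?thesis
    by (simp add: quotient_topology_def)
qed

lemma topspace_quotient_topology [simp]:
  "topspace (quotient_topology X f) = f ` topspace X"
proof (rule antisym)
  show "topspace (quotient_topology X f) \<subseteq> f ` topspace X"
    using openin_quotient_topology[of X f "topspace (quotient_topology X f)"] by simp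
  have "{x \<in> topspace X. f x \<in> f ` topspace X} = topspace X"
    by auto
  then have "openin (quotient_topology X f) (f ` topspace X)"
    by (simp add: openin_quotient_topology)
  then show "f ` topspace X \<subseteq> topspace (quotient_topology X f)"
    by (rule openin_subset)
qed

lemma quotient_map_quotient_topology: "quotient_map X (quotient_topology X f) f"
  unfolding quotient_map_def openin_quotient_topology topspace_quotient_topology by blast

text \<open>A finite partition into non-empty locally closed strata satisfying the frontier condition
  (the closure of each stratum is a union of strata).\<close>

definition stratification :: "'a topology \<Rightarrow> 'a set set \<Rightarrow> bool" where
  "stratification X P \<longleftrightarrow> finite P \<and> partition_on (topspace X) P \<and>
     (\<forall>S\<in>P. \<exists>U C. openin X U \<and> closedin X C \<and> S = U \<inter> C) \<and>
     (\<forall>S\<in>P. \<forall>T\<in>P. T \<inter> X closure_of S \<noteq> {} \<longrightarrow> T \<subseteq> X closure_of S)"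

section \<open>The Clemens polytope\<close>

text \<open>The Clemens polytope of a strictly semi-stable formal scheme only depends on \<open>val(\<varpi>) > 0\<close>
  (called \<open>c\<close> below) and on the finite family \<open>D\<close> of irreducible components of the special
  fiber, of which only the underlying topological space \<open>Xs\<close> is recorded. The index
  set of the components is the finite type \<open>'i\<close>.\<close>

definition strata_inter :: "('i \<Rightarrow> 'p set) \<Rightarrow> 'i set \<Rightarrow> 'p set" where
  "strata_inter D I = (\<Inter>i\<in>I. D i)"

definition special_fiber_components :: "'p topology \<Rightarrow> ('i::finite \<Rightarrow> 'p set) \<Rightarrow> bool" where
  "special_fiber_components Xs D \<longleftrightarrow>
     bij_betw D UNIV (irreducible_components Xs) \<and>
     (\<forall>I. I \<noteq> {} \<longrightarrow> strata_inter D I = {} \<or> irreducible_in Xs (strata_inter D I))"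

definition face_sets :: "('i \<Rightarrow> 'p set) \<Rightarrow> 'i set set" where
  "face_sets D = {I. I \<noteq> {} \<and> strata_inter D I \<noteq> {}}"

definition adjacent :: "('i \<Rightarrow> 'p set) \<Rightarrow> 'i set \<Rightarrow> 'i set" where
  "adjacent D I = {j. strata_inter D (insert j I) \<noteq> {}}"

definition face_simplex :: "real \<Rightarrow> 'i set \<Rightarrow> (real^'i::finite) set" where
  "face_simplex c I =
     {x. (\<forall>i. 0 \<le> x $ i) \<and> (\<Sum>i\<in>UNIV. x $ i) = c \<and> (\<forall>i. i \<notin> I \<longrightarrow> x $ i = 0)}"

definition clemens_polytope :: "('i \<Rightarrow> 'p set) \<Rightarrow> real \<Rightarrow> (real^'i::finite) set" where
  "clemens_polytope D c = (\<Union>I\<in>face_sets D. face_simplex c I)"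

definition carrier_face :: "('i \<Rightarrow> 'p set) \<Rightarrow> real \<Rightarrow> real^'i::finite \<Rightarrow> 'i set" where
  "carrier_face D c x = (THE I. I \<in> face_sets D \<and> x \<in> rel_interior (face_simplex c I))"

definition simple_density :: "('i \<Rightarrow> 'p set) \<Rightarrow> ('i set \<Rightarrow> 'i \<Rightarrow> ennreal) \<Rightarrow> bool" where
  "simple_density D \<omega> \<longleftrightarrow>
     (\<forall>I\<in>face_sets D. \<forall>j\<in>adjacent D I. 0 < \<omega> I j) \<and>
     (\<forall>I\<in>face_sets D. \<forall>I'\<in>face_sets D. \<forall>j\<in>adjacent D I. I' \<subseteq> I \<longrightarrow> \<omega> I' j \<le> \<omega> I j)"

section \<open>Weighted pointed graphs\<close>

text \<open>The data shared by parametrized tropical curves and combinatorial types. Graphs may have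
  parallel edges. Vertices and edges are labelled by natural numbers; everything below is only
  considered up to isomorphism. \<open>wt v e\<close> is the weight vector of the flag \<open>(v, e)\<close>; it is
  irrelevant if \<open>v\<close> is not an endpoint of \<open>e\<close>.\<close>

record ('i::finite) wgraph =
  verts :: "nat set"
  edges :: "nat set"
  ends :: "nat \<Rightarrow> nat set"
  wt :: "nat \<Rightarrow> nat \<Rightarrow> int^'i"
  gen :: "nat \<Rightarrow> nat"
  marks :: "nat list"

definition joined :: "('e \<Rightarrow> 'v set) \<Rightarrow> 'e set \<Rightarrow> ('v \<times> 'v) set" where
  "joined en E = {(u, v). \<exists>e\<in>E. en e = {u, v}}\<^sup>*"

text \<open>Number of edges minus number of vertices plus number of connected components.\<close>

definition betti1 :: "'v set \<Rightarrow> 'e set \<Rightarrow> ('e \<Rightarrow> 'v set) \<Rightarrow> nat" where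
  "betti1 V E en = card E + card (V // joined en E) - card V"

definition wgraph_wf :: "('i::finite) wgraph \<Rightarrow> bool" where
  "wgraph_wf G \<longleftrightarrow>
     finite (verts G) \<and> finite (edges G) \<and>
     (\<forall>e\<in>edges G. ends G e \<subseteq> verts G \<and> card (ends G e) = 2) \<and>
     verts G \<noteq> {} \<and> (\<forall>u\<in>verts G. \<forall>v\<in>verts G. (u, v) \<in> joined (ends G) (edges G)) \<and>
     (\<forall>e\<in>edges G. \<forall>v\<in>ends G e. wt G v e \<noteq> 0) \<and>
     (\<forall>e\<in>edges G. (\<Sum>v\<in>ends G e. wt G v e) = 0) \<and>
     set (marks G) \<subseteq> verts G"

definition incident :: "('i::finite) wgraph \<Rightarrow> nat \<Rightarrow> nat set" where
  "incident G v = {e \<in> edges G. v \<in> ends G e}"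

definition vsum :: "('i::finite) wgraph \<Rightarrow> nat \<Rightarrow> int^'i" where
  "vsum G v = (\<Sum>e\<in>incident G v. wt G v e)"

definition genus :: "('i::finite) wgraph \<Rightarrow> nat" where
  "genus G = betti1 (verts G) (edges G) (ends G) + (\<Sum>v\<in>verts G. gen G v)"

definition removable :: "('i::finite) wgraph \<Rightarrow> nat \<Rightarrow> bool" where
  "removable G v \<longleftrightarrow> v \<in> verts G \<and> card (incident G v) = 2 \<and> gen G v = 0 \<and>
     v \<notin> set (marks G) \<and> vsum G v = 0"

definition simple_wgraph :: "('i::finite) wgraph \<Rightarrow> bool" where
  "simple_wgraph G \<longleftrightarrow> (\<forall>v. \<not> removable G v)"

definition wgraph_iso ::
    "(nat \<Rightarrow> nat) \<Rightarrow> (nat \<Rightarrow> nat) \<Rightarrow> ('i::finite) wgraph \<Rightarrow> 'i wgraph \<Rightarrow> bool" where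
  "wgraph_iso \<phi> \<psi> G H \<longleftrightarrow>
     bij_betw \<phi> (verts G) (verts H) \<and> bij_betw \<psi> (edges G) (edges H) \<and>
     (\<forall>e\<in>edges G. ends H (\<psi> e) = \<phi> ` ends G e) \<and>
     (\<forall>e\<in>edges G. \<forall>v\<in>ends G e. wt H (\<phi> v) (\<psi> e) = wt G v e) \<and>
     (\<forall>v\<in>verts G. gen H (\<phi> v) = gen G v) \<and>
     marks H = map \<phi> (marks G)"

text \<open>Removal of one vertex of degree two, gluing its edges \<open>e1\<close> and \<open>e2\<close> to a single edge (which
  keeps the label \<open>e1\<close>).\<close>

inductive smooth_step :: "('i::finite) wgraph \<Rightarrow> 'i wgraph \<Rightarrow> bool" where
  "\<lbrakk>removable G v; incident G v = {e1, e2}; e1 \<noteq> e2; ends G e1 = {v, u1}; ends G e2 = {v, u2};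
    H = G\<lparr>verts := verts G - {v}, edges := edges G - {e2}, ends := (ends G)(e1 := {u1, u2}),
          wt := (wt G)(u2 := (wt G u2)(e1 := wt G u2 e2))\<rparr>\<rbrakk>
   \<Longrightarrow> smooth_step G H"

definition simplification :: "('i::finite) wgraph \<Rightarrow> 'i wgraph \<Rightarrow> bool" where
  "simplification G H \<longleftrightarrow> smooth_step\<^sup>*\<^sup>* G H \<and> simple_wgraph H"

definition component :: "('i::finite) wgraph \<Rightarrow> nat set \<Rightarrow> nat \<Rightarrow> nat set" where
  "component G Z v = joined (ends G) Z `` {v}"

text \<open>Contraction of the edges in \<open>Z\<close>. A contracted component is represented by its least vertex.
  For an edge outside \<open>Z\<close> with endpoints in different components, the sum in the weight field has
  exactly one term.\<close>

definition contract :: "('i::finite) wgraph \<Rightarrow> nat set \<Rightarrow> 'i wgraph" where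
  "contract G Z = (let r = (\<lambda>v. Min (component G Z v)) in
     \<lparr>verts = r ` verts G,
      edges = edges G - Z,
      ends = (\<lambda>e. r ` ends G e),
      wt = (\<lambda>v e. \<Sum>u\<in>{u \<in> ends G e. r u = v}. wt G u e),
      gen = (\<lambda>v. betti1 (component G Z v) {e \<in> Z. ends G e \<subseteq> component G Z v} (ends G)
                 + (\<Sum>u\<in>component G Z v. gen G u)),
      marks = map r (marks G)\<rparr>)"

section \<open>Parametrized tropical curves and combinatorial types\<close>

text \<open>The map \<open>h\<close> of a curve is determined, up to reparametrization of the edges, by the positions
  of the vertices. Positions of numbers that are not vertices are irrelevant.\<close>

type_synonym 'i curve = "'i wgraph \<times> (nat \<Rightarrow> real^'i)"
type_synonym 'i ctype = "'i wgraph \<times> (nat \<Rightarrow> 'i set)"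

definition real_vec :: "int^'i::finite \<Rightarrow> real^'i" where
  "real_vec w = (\<chi> i. real_of_int (w $ i))"

text \<open>The slope of an edge is automatically rational, being parallel to an integral vector; the
  strict positivity of \<open>t\<close> makes the edge embed.\<close>

definition param_curve :: "('i \<Rightarrow> 'p set) \<Rightarrow> real \<Rightarrow> ('i::finite) curve \<Rightarrow> bool" where
  "param_curve D c C \<longleftrightarrow> (case C of (G, h) \<Rightarrow> wgraph_wf G \<and>
     (\<forall>v\<in>verts G. h v \<in> clemens_polytope D c) \<and>
     (\<forall>e\<in>edges G. \<forall>u v. ends G e = {u, v} \<longrightarrow>
        (\<exists>I\<in>face_sets D. closed_segment (h u) (h v) \<subseteq> face_simplex c I) \<and>
        (\<exists>t>0. h v - h u = t *\<^sub>R real_vec (wt G u e))))"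

definition curve_iso :: "('i::finite) curve \<Rightarrow> 'i curve \<Rightarrow> bool" where
  "curve_iso C C' \<longleftrightarrow> (\<exists>\<phi> \<psi>. wgraph_iso \<phi> \<psi> (fst C) (fst C') \<and>
     (\<forall>v\<in>verts (fst C). snd C' (\<phi> v) = snd C v))"

definition curve_iso_rel :: "('i \<Rightarrow> 'p set) \<Rightarrow> real \<Rightarrow> (('i::finite) curve \<times> 'i curve) set" where
  "curve_iso_rel D c = {(C, C'). param_curve D c C \<and> param_curve D c C' \<and> curve_iso C C'}"

definition comb_type :: "('i::finite) ctype \<Rightarrow> bool" where
  "comb_type \<alpha> \<longleftrightarrow> wgraph_wf (fst \<alpha>) \<and> (\<forall>v\<in>verts (fst \<alpha>). snd \<alpha> v \<noteq> {})"

definition ctype_iso_via ::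
    "(nat \<Rightarrow> nat) \<Rightarrow> (nat \<Rightarrow> nat) \<Rightarrow> ('i::finite) ctype \<Rightarrow> 'i ctype \<Rightarrow> bool" where
  "ctype_iso_via \<phi> \<psi> \<alpha> \<beta> \<longleftrightarrow> wgraph_iso \<phi> \<psi> (fst \<alpha>) (fst \<beta>) \<and>
     (\<forall>v\<in>verts (fst \<alpha>). snd \<beta> (\<phi> v) = snd \<alpha> v)"

definition ctype_iso :: "('i::finite) ctype \<Rightarrow> 'i ctype \<Rightarrow> bool" where
  "ctype_iso \<alpha> \<beta> \<longleftrightarrow> (\<exists>\<phi> \<psi>. ctype_iso_via \<phi> \<psi> \<alpha> \<beta>)"

definition ctype_iso_rel :: "(('i::finite) ctype \<times> 'i ctype) set" where
  "ctype_iso_rel = {(\<alpha>, \<beta>). comb_type \<alpha> \<and> comb_type \<beta> \<and> ctype_iso \<alpha> \<beta>}"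

definition type_of_curve :: "('i \<Rightarrow> 'p set) \<Rightarrow> real \<Rightarrow> ('i::finite) curve \<Rightarrow> 'i ctype" where
  "type_of_curve D c C = (fst C, \<lambda>v. carrier_face D c (snd C v))"

definition good_ctype :: "('i \<Rightarrow> 'p set) \<Rightarrow> real \<Rightarrow> ('i::finite) ctype \<Rightarrow> bool" where
  "good_ctype D c \<alpha> \<longleftrightarrow> (\<exists>C. param_curve D c C \<and> ctype_iso (type_of_curve D c C) \<alpha>)"

definition local_degree ::
    "('i \<Rightarrow> 'p set) \<Rightarrow> ('i set \<Rightarrow> 'i \<Rightarrow> ennreal) \<Rightarrow> ('i::finite) ctype \<Rightarrow> nat \<Rightarrow> ennreal" where
  "local_degree D \<omega> \<alpha> v =
     Max ((\<lambda>j. \<omega> (snd \<alpha> v) j * ennreal \<bar>real_of_int (vsum (fst \<alpha>) v $ j)\<bar>) ` adjacent D (snd \<alpha> v))"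

definition tropical_degree ::
    "('i \<Rightarrow> 'p set) \<Rightarrow> ('i set \<Rightarrow> 'i \<Rightarrow> ennreal) \<Rightarrow> ('i::finite) ctype \<Rightarrow> ennreal" where
  "tropical_degree D \<omega> \<alpha> = (\<Sum>v\<in>verts (fst \<alpha>). local_degree D \<omega> \<alpha> v)"

section \<open>The moduli set and the set of combinatorial types\<close>

definition simple_curves :: "('i \<Rightarrow> 'p set) \<Rightarrow> real \<Rightarrow> ('i set \<Rightarrow> 'i \<Rightarrow> ennreal) \<Rightarrow>
    nat \<Rightarrow> nat \<Rightarrow> real \<Rightarrow> ('i::finite) curve set" where
  "simple_curves D c \<omega> g n A =
     {C. param_curve D c C \<and> simple_wgraph (fst C) \<and> genus (fst C) = g \<and>
         length (marks (fst C)) = n \<and> tropical_degree D \<omega> (type_of_curve D c C) \<le> ennreal A}"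

definition moduli :: "('i \<Rightarrow> 'p set) \<Rightarrow> real \<Rightarrow> ('i set \<Rightarrow> 'i \<Rightarrow> ennreal) \<Rightarrow>
    nat \<Rightarrow> nat \<Rightarrow> real \<Rightarrow> ('i::finite) curve set set" where
  "moduli D c \<omega> g n A = simple_curves D c \<omega> g n A // curve_iso_rel D c"

definition good_types :: "('i \<Rightarrow> 'p set) \<Rightarrow> real \<Rightarrow> ('i set \<Rightarrow> 'i \<Rightarrow> ennreal) \<Rightarrow>
    nat \<Rightarrow> nat \<Rightarrow> real \<Rightarrow> ('i::finite) ctype set" where
  "good_types D c \<omega> g n A =
     {\<alpha>. comb_type \<alpha> \<and> good_ctype D c \<alpha> \<and> simple_wgraph (fst \<alpha>) \<and> genus (fst \<alpha>) = g \<and>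
         length (marks (fst \<alpha>)) = n \<and> tropical_degree D \<omega> \<alpha> \<le> ennreal A}"

text \<open>The stratum attached to an isomorphism class \<open>a\<close> of combinatorial types.\<close>

definition stratum :: "('i \<Rightarrow> 'p set) \<Rightarrow> real \<Rightarrow> ('i set \<Rightarrow> 'i \<Rightarrow> ennreal) \<Rightarrow>
    nat \<Rightarrow> nat \<Rightarrow> real \<Rightarrow> ('i::finite) ctype set \<Rightarrow> 'i curve set set" where
  "stratum D c \<omega> g n A a = {X \<in> moduli D c \<omega> g n A. \<exists>C\<in>X. type_of_curve D c C \<in> a}"

section \<open>The polyhedra and the natural topology\<close>

text \<open>A point of \<open>\<real>\<^sup>I \<times> \<real>\<^sup>E\<close> is a pair of a vector and a function on all natural numbers vanishing
  outside the set \<open>E\<close> of edges.\<close>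

type_synonym 'i param = "(real^'i) \<times> (nat \<Rightarrow> real)"

definition linear_form ::
    "nat set \<Rightarrow> real^'i::finite \<Rightarrow> (nat \<Rightarrow> real) \<Rightarrow> 'i param \<Rightarrow> real" where
  "linear_form E a b p = a \<bullet> fst p + (\<Sum>e\<in>E. b e * snd p e)"

text \<open>\<open>L\<close> is an affine subspace of \<open>\<real>\<^sup>I \<times> \<real>\<^sup>E\<close>, and \<open>P\<close> is the subset of \<open>L\<close> given by finitely many
  strict linear inequalities.\<close>

definition open_convex_polyhedron_in ::
    "nat set \<Rightarrow> ('i::finite) param set \<Rightarrow> 'i param set \<Rightarrow> bool" where
  "open_convex_polyhedron_in E L P \<longleftrightarrow>
     (\<exists>Q. finite Q \<and>
        L = {p. (\<forall>e. e \<notin> E \<longrightarrow> snd p e = 0) \<and> (\<forall>(a, b, d)\<in>Q. linear_form E a b p = d)}) \<and>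
     (\<exists>N. finite N \<and> P = {p \<in> L. \<forall>(a, b, d)\<in>N. linear_form E a b p < d})"

definition root :: "('i::finite) wgraph \<Rightarrow> nat" where
  "root G = (SOME v. v \<in> verts G)"

text \<open>Position of the root and lengths of the segments; the diameter of the two-point set of
  endpoints is the Euclidean length of the edge.\<close>

definition params :: "('i::finite) curve \<Rightarrow> 'i param" where
  "params C = (case C of (G, h) \<Rightarrow>
     (h (root G), \<lambda>e. if e \<in> edges G then diameter (h ` ends G e) else 0))"

definition polyhedron_of :: "('i \<Rightarrow> 'p set) \<Rightarrow> real \<Rightarrow> ('i::finite) ctype \<Rightarrow> 'i param set" where
  "polyhedron_of D c \<alpha> =
     {params (fst \<alpha>, h) | h. param_curve D c (fst \<alpha>, h) \<and>
        (\<forall>v\<in>verts (fst \<alpha>). carrier_face D c (h v) = snd \<alpha> v)}"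

text \<open>\<open>h\<close> places the vertices as prescribed by the root position and the (possibly zero) edge
  lengths; such an \<open>h\<close> exists iff all cycles close up.\<close>

definition realizes :: "('i::finite) wgraph \<Rightarrow> 'i param \<Rightarrow> (nat \<Rightarrow> real^'i) \<Rightarrow> bool" where
  "realizes G p h \<longleftrightarrow> h (root G) = fst p \<and>
     (\<forall>e\<in>edges G. \<forall>u v. ends G e = {u, v} \<longrightarrow>
        h v - h u = (snd p e / norm (real_vec (wt G u e))) *\<^sub>R real_vec (wt G u e))"

text \<open>The affine space cut out by the linear equations among the conditions defining
  \<open>polyhedron_of\<close>.\<close>

definition affine_space_of :: "real \<Rightarrow> ('i::finite) ctype \<Rightarrow> 'i param set" where
  "affine_space_of c \<alpha> =
     {p. (\<forall>e. e \<notin> edges (fst \<alpha>) \<longrightarrow> snd p e = 0) \<and>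
         (\<exists>h. realizes (fst \<alpha>) p h \<and>
              (\<forall>v\<in>verts (fst \<alpha>). h v \<in> affine hull face_simplex c (snd \<alpha> v)))}"

text \<open>The map \<open>\<iota>\<^sub>\<alpha>\<close>: contract the edges of length zero, then simplify, then pass to the isomorphism
  class. Vertices keep their positions, since contracted vertices have the same position.\<close>

definition attaching_map ::
    "('i \<Rightarrow> 'p set) \<Rightarrow> real \<Rightarrow> ('i::finite) ctype \<Rightarrow> 'i param \<Rightarrow> 'i curve set" where
  "attaching_map D c \<alpha> p =
     {C. \<exists>h H. realizes (fst \<alpha>) p h \<and>
        simplification (contract (fst \<alpha>) {e \<in> edges (fst \<alpha>). snd p e = 0}) H \<and>
        ((H, h), C) \<in> curve_iso_rel D c}"

text \<open>The disjoint union runs over all labelled types rather than over representatives of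
  the isomorphism classes; this yields the same quotient, as isomorphic types have
  linearly isomorphic polyhedra with the same attaching maps.\<close>

definition natural_topology :: "('i \<Rightarrow> 'p set) \<Rightarrow> real \<Rightarrow> ('i set \<Rightarrow> 'i \<Rightarrow> ennreal) \<Rightarrow>
    nat \<Rightarrow> nat \<Rightarrow> real \<Rightarrow> ('i::finite) curve set topology" where
  "natural_topology D c \<omega> g n A =
     quotient_topology
       (sum_topology (\<lambda>\<alpha>. top_of_set (closure (polyhedron_of D c \<alpha>))) (good_types D c \<omega> g n A))
       (\<lambda>(\<alpha>, p). attaching_map D c \<alpha> p)"

text \<open>Automorphisms of a combinatorial type and their (relational) action on parameters: the
  curve \<open>h\<close> is sent to \<open>h \<circ> \<phi>\<close>.\<close>

definition automorphisms :: "('i::finite) ctype \<Rightarrow> ((nat \<Rightarrow> nat) \<times> (nat \<Rightarrow> nat)) set" where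
  "automorphisms \<alpha> = {(\<phi>, \<psi>). ctype_iso_via \<phi> \<psi> \<alpha> \<alpha>}"

definition same_orbit :: "('i::finite) ctype \<Rightarrow> 'i param \<Rightarrow> 'i param \<Rightarrow> bool" where
  "same_orbit \<alpha> p q \<longleftrightarrow> (\<exists>(\<phi>, \<psi>)\<in>automorphisms \<alpha>. \<exists>h. realizes (fst \<alpha>) p h \<and>
     q = (h (\<phi> (root (fst \<alpha>))), \<lambda>e. if e \<in> edges (fst \<alpha>) then snd p (\<psi> e) else 0))"

end

theory Submission
  imports Defs
begin

text \<open>The moduli set is covered by the images of the closed polyhedra of the types. Each closed
  polyhedron is compact, and there are finitely many types up to isomorphism. So compactness is
  immediate once the types are known to be finite in number, and the topological assertions on the
  strata rest on the closedness of the gluing relation between the closed polyhedra.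

  \<^emph>\<open>Finiteness.\<close> The density is bounded below by a positive constant, so the bound on the degree
  bounds the sum of the absolute values of the vectors \<open>\<sigma>\<close> in every coordinate. In a simple graph
  with more than one vertex, the vertices of degree at most two are of type A, marked, or of
  positive genus, and the genus controls the number of the others (\<open>card_verts_bound\<close>). In each coordinate the weights form a flow along which the
  position increases. Cutting the graph at a level of the position bounds every weight by the
  total source of the flow (\<open>weight_bound\<close>). The result is \<open>finite_good_types\<close>.

  \<^emph>\<open>Gluing.\<close> The attaching map contracts edges and then erases superfluous vertices of degree two.
  Erasing such a vertex is, combinatorially, the contraction of one of its two edges
  (\<open>smooth_step_contractions\<close>). Thus everything reduces to contractions of sets of edges, which
  compose (\<open>contraction_compose\<close>) and are unique up to isomorphism (\<open>contraction_unique\<close>); the freedom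
  to choose either of the two edges makes the operations commute. This yields the uniqueness of
  simplifications (\<open>simplification_unique\<close>), so that the attaching maps have isomorphism
  classes as values, and it shows that simplifying before or after a further degeneration
  gives the same curve (\<open>normal_form_smooths\<close>). Consequently, if two points of closed polyhedra
  define the same curve, then so do all degenerations along which the isomorphism of the two
  simplified curves keeps matching the positions. Only finitely many pairs of contracted sets and
  isomorphisms occur, so the gluing relation is a finite union of closed sets
  (\<open>closed_preimage_of_compact\<close>), and images of compact sets are closed.

  \<^emph>\<open>Strata.\<close> The closed polyhedron of a type consists of the placements of its vertices in the closed
  faces of the carriers, with edges of non-negative length (\<open>closure_polyhedron\<close>). On its boundary an
  edge disappears or a carrier shrinks, so boundary points never return to the stratum
  (\<open>boundary_not_in_stratum\<close>). Which stratum is hit depends only on the contracted edges and on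
  the carriers. Conversely, every curve of a stratum that is hit comes from a boundary point, because an
  erased vertex can be put back at any interior point of its edge (\<open>stratum_subset_image\<close>). This
  gives the frontier condition.\<close>

section \<open>Connectivity and contractions of weighted graphs\<close>

lemma joined_refl [simp]: "(u, u) \<in> joined en E"
  by (simp add: joined_def)

lemma joined_trans: "(u, v) \<in> joined en E \<Longrightarrow> (v, w) \<in> joined en E \<Longrightarrow> (u, w) \<in> joined en E"
  unfolding joined_def by (rule rtrancl_trans)

lemma joined_sym: "(u, v) \<in> joined en E \<Longrightarrow> (v, u) \<in> joined en E"
proof -
  have "sym {(u, v). \<exists>e\<in>E. en e = {u, v}}"
    by (auto simp: sym_def insert_commute)
  then show "(u, v) \<in> joined en E \<Longrightarrow> (v, u) \<in> joined en E"
    unfolding joined_def by (rule symD[OF sym_rtrancl])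
qed

lemma joined_edge: "e \<in> E \<Longrightarrow> en e = {u, v} \<Longrightarrow> (u, v) \<in> joined en E"
  unfolding joined_def by blast

lemma joined_mono: "Z \<subseteq> W \<Longrightarrow> joined en Z \<subseteq> joined en W"
  unfolding joined_def by (rule rtrancl_mono) auto

lemma joined_induct [consumes 1, case_names base step]:
  assumes "(u, v) \<in> joined en E" "P u"
    "\<And>x y e. (u, x) \<in> joined en E \<Longrightarrow> P x \<Longrightarrow> e \<in> E \<Longrightarrow> en e = {x, y} \<Longrightarrow> P y"
  shows "P v"
  using assms(1) unfolding joined_def
  by (induction rule: rtrancl_induct) (use assms(2,3) in \<open>auto simp: joined_def\<close>)

lemma joined_empty [simp]: "(u, v) \<in> joined en {} \<longleftrightarrow> u = v"
  by (auto simp: joined_def)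

lemma equiv_joined: "equiv UNIV (joined en E)"
  by (auto intro!: equivI refl_onI symI transI intro: joined_sym joined_trans)

text \<open>A connected graph has a spanning tree: a maximal set of vertices that some equally large set
  of edges (up to one) keeps together is everything.\<close>

lemma card_vertices_le_card_edges:
  assumes fin: "finite V" "finite E" and r: "r \<in> V"
    and sub: "\<And>e. e \<in> E \<Longrightarrow> en e \<subseteq> V"
    and conn: "\<And>v. v \<in> V \<Longrightarrow> (r, v) \<in> joined en E"
  shows "card V \<le> card E + 1"
proof -
  let ?\<S> = "{S. S \<subseteq> V \<and> r \<in> S \<and> (\<exists>F\<subseteq>E. (\<forall>e\<in>F. en e \<subseteq> S) \<and> card S \<le> card F + 1)}"
  have "finite ?\<S>"
    using fin by (auto intro: finite_subset[of _ "Pow V"])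
  moreover have "{r} \<in> ?\<S>"
    using r by (auto intro!: exI[of _ "{}"])
  ultimately have fne: "finite (card ` ?\<S>)" "card ` ?\<S> \<noteq> {}" by blast+
  obtain S where S: "S \<in> ?\<S>" and Sm: "card S = Max (card ` ?\<S>)"
    using Max_in[OF fne] by (metis (no_types, lifting) imageE)
  \<comment> \<open>An edge leaving \<open>S\<close> would allow adding a vertex and an edge at the same time.\<close>
  have mx: "card T \<le> card S" if "T \<in> ?\<S>" for T
    unfolding Sm using that by (intro Max_ge[OF fne(1)] imageI)
  from S obtain F where F: "F \<subseteq> E" "\<And>e. e \<in> F \<Longrightarrow> en e \<subseteq> S" "card S \<le> card F + 1"
    by blast
  have "v \<in> S" if "v \<in> V" for v
    using conn[OF that]
  proof (induction rule: joined_induct)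
    case base
    then show ?case using S by simp
  next
    case (step x y e)
    show ?case
    proof (rule ccontr)
      assume "y \<notin> S"
      have "insert y S \<in> ?\<S>"
      proof -
        have "e \<notin> F" using F(2) step \<open>y \<notin> S\<close> by auto
        moreover have "finite F" "finite S" using F(1) S fin by (auto intro: finite_subset)
        ultimately have "card (insert y S) \<le> card (insert e F) + 1"
          using F(3) \<open>y \<notin> S\<close> by simp
        moreover have "insert y S \<subseteq> V" using S sub[of e] step by auto
        ultimately show ?thesis
          using S F step by (auto intro!: exI[of _ "insert e F"])
      qed
      then have "card (insert y S) \<le> card S" by (rule mx)
      moreover have "finite S" using S fin by (auto intro: finite_subset)
      ultimately show False using \<open>y \<notin> S\<close> by simp
    qed
  qed
  then have "V = S" using S by auto
  then show ?thesis
    using F card_mono[OF fin(2) F(1)] by simp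
qed

lemma betti1_connected:
  assumes "finite V" "finite E" "r \<in> V"
    and "\<And>e. e \<in> E \<Longrightarrow> en e \<subseteq> V"
    and conn: "\<And>v. v \<in> V \<Longrightarrow> (r, v) \<in> joined en E"
  shows "int (betti1 V E en) = int (card E) + 1 - int (card V)"
proof -
  have "V // joined en E = {joined en E `` {r}}"
  proof -
    have "joined en E `` {v} = joined en E `` {r}" if "v \<in> V" for v
      using equiv_class_eq[OF equiv_joined conn[OF that]] by simp
    then show ?thesis using \<open>r \<in> V\<close> unfolding quotient_def by blast
  qed
  then show ?thesis
    using card_vertices_le_card_edges[OF assms] by (simp add: betti1_def)
qed

context
  fixes G :: "('i::finite) wgraph"
  assumes wf: "wgraph_wf G"
begin

lemma wf_finite: "finite (verts G)" "finite (edges G)"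
  and wf_nonempty: "verts G \<noteq> {}"
  and wf_connected: "u \<in> verts G \<Longrightarrow> v \<in> verts G \<Longrightarrow> (u, v) \<in> joined (ends G) (edges G)"
  and wf_ends: "e \<in> edges G \<Longrightarrow> ends G e \<subseteq> verts G" "e \<in> edges G \<Longrightarrow> card (ends G e) = 2"
  and wf_wt: "e \<in> edges G \<Longrightarrow> v \<in> ends G e \<Longrightarrow> wt G v e \<noteq> 0"
  and wf_marks: "set (marks G) \<subseteq> verts G"
  using wf unfolding wgraph_wf_def by blast+

lemma wf_edgeE:
  assumes "e \<in> edges G"
  obtains u v where "ends G e = {u, v}" "u \<noteq> v" "u \<in> verts G" "v \<in> verts G"
    "wt G v e = - wt G u e" "wt G u e \<noteq> 0"
proof -
  obtain u v where uv: "ends G e = {u, v}" "u \<noteq> v"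
    using wf_ends(2)[OF assms] by (auto simp: card_2_iff)
  have "(\<Sum>v\<in>ends G e. wt G v e) = 0"
    using wf assms unfolding wgraph_wf_def by blast
  then have "wt G v e = - wt G u e"
    using uv by (simp add: add_eq_0_iff)
  then show ?thesis
    using uv wf_ends(1)[OF assms] wf_wt[OF assms, of u] by (intro that) auto
qed

lemma wf_opp: "e \<in> edges G \<Longrightarrow> ends G e = {u, v} \<Longrightarrow> wt G v e = - wt G u e"
  by (erule wf_edgeE) (auto simp: doubleton_eq_iff)

lemma wf_ends_neq: "e \<in> edges G \<Longrightarrow> ends G e = {u, v} \<Longrightarrow> u \<noteq> v"
  using wf_ends(2)[of e] by (auto simp: card_2_iff)

lemma wf_ends_verts: "e \<in> edges G \<Longrightarrow> ends G e = {u, v} \<Longrightarrow> u \<in> verts G \<and> v \<in> verts G"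
  using wf_ends(1)[of e] by auto

lemma wf_ends_eq: "e \<in> edges G \<Longrightarrow> a \<in> ends G e \<Longrightarrow> b \<in> ends G e \<Longrightarrow> a \<noteq> b \<Longrightarrow> ends G e = {a, b}"
  using wf_ends(2)[of e] by (auto simp: card_2_iff)

lemma finite_incident: "finite (incident G v)"
  using wf_finite by (simp add: incident_def)

lemma joined_verts:
  assumes "(u, v) \<in> joined (ends G) Z" "Z \<subseteq> edges G" "u \<in> verts G"
  shows "v \<in> verts G"
  using assms(1)
proof (induction rule: joined_induct)
  case (step x y e)
  then show ?case using wf_ends(1)[of e] assms(2) by auto
qed (fact assms)

lemma int_genus:
  "int (genus G) = int (card (edges G)) + 1 - int (card (verts G)) + (\<Sum>v\<in>verts G. int (gen G v))"
proof -
  obtain r where "r \<in> verts G" using wf_nonempty by blast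
  then show ?thesis
    using betti1_connected[OF wf_finite, of r "ends G"] wf_ends(1) wf_connected
    by (simp add: genus_def)
qed

end

definition fiber :: "(nat \<Rightarrow> nat) \<Rightarrow> ('i::finite) wgraph \<Rightarrow> nat \<Rightarrow> nat set" where
  "fiber \<phi> G x = {v \<in> verts G. \<phi> v = x}"

lemma fiber_finite: "wgraph_wf G \<Longrightarrow> finite (fiber \<phi> G x)"
  by (simp add: fiber_def wf_finite)

text \<open>\<open>H\<close> arises from \<open>G\<close> by contraction of the edges in \<open>Z\<close>, up to the choice of labels: \<open>\<phi>\<close> and \<open>\<psi>\<close>
  record what becomes of the vertices and of the remaining edges. Keeping the labels free makes
  contractions closed under composition and covers isomorphisms, which are contractions of
  no edges. The first three terms of the genus formula are the first Betti number of the
  contracted component.\<close>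

definition contraction ::
    "(nat \<Rightarrow> nat) \<Rightarrow> (nat \<Rightarrow> nat) \<Rightarrow> ('i::finite) wgraph \<Rightarrow> nat set \<Rightarrow> 'i wgraph \<Rightarrow> bool" where
  "contraction \<phi> \<psi> G Z H \<longleftrightarrow> Z \<subseteq> edges G \<and> \<phi> ` verts G = verts H \<and>
     (\<forall>u\<in>verts G. \<forall>v\<in>verts G. \<phi> u = \<phi> v \<longleftrightarrow> (u, v) \<in> joined (ends G) Z) \<and>
     bij_betw \<psi> (edges G - Z) (edges H) \<and>
     (\<forall>e\<in>edges G - Z. ends H (\<psi> e) = \<phi> ` ends G e) \<and>
     (\<forall>e\<in>edges G - Z. \<forall>v\<in>ends G e. wt H (\<phi> v) (\<psi> e) = wt G v e) \<and>
     (\<forall>x\<in>verts H. int (gen H x) = int (card {e \<in> Z. \<phi> ` ends G e = {x}}) + 1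
        - int (card (fiber \<phi> G x)) + (\<Sum>v\<in>fiber \<phi> G x. int (gen G v))) \<and>
     marks H = map \<phi> (marks G)"

context
  fixes G H :: "('i::finite) wgraph" and \<phi> \<psi> Z
  assumes wf: "wgraph_wf G" and con: "contraction \<phi> \<psi> G Z H"
begin

lemma contraction_subset: "Z \<subseteq> edges G"
  and contraction_verts': "\<phi> ` verts G = verts H"
  and contraction_joined:
    "u \<in> verts G \<Longrightarrow> v \<in> verts G \<Longrightarrow> \<phi> u = \<phi> v \<longleftrightarrow> (u, v) \<in> joined (ends G) Z"
  and contraction_bij: "bij_betw \<psi> (edges G - Z) (edges H)"
  and contraction_ends: "e \<in> edges G - Z \<Longrightarrow> ends H (\<psi> e) = \<phi> ` ends G e"
  and contraction_wt: "e \<in> edges G - Z \<Longrightarrow> v \<in> ends G e \<Longrightarrow> wt H (\<phi> v) (\<psi> e) = wt G v e"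
  and contraction_gen: "x \<in> verts H \<Longrightarrow> int (gen H x) = int (card {e \<in> Z. \<phi> ` ends G e = {x}}) + 1
        - int (card (fiber \<phi> G x)) + (\<Sum>v\<in>fiber \<phi> G x. int (gen G v))"
  and contraction_marks: "marks H = map \<phi> (marks G)"
  using con unfolding contraction_def by blast+

lemma contraction_verts: "verts H = \<phi> ` verts G"
  using contraction_verts' by simp

lemma contraction_edge_in: "e \<in> edges G - Z \<Longrightarrow> \<psi> e \<in> edges H"
  using contraction_bij by (auto dest: bij_betwE)

lemma contraction_edgeE:
  assumes "f \<in> edges H" obtains e where "e \<in> edges G" "e \<notin> Z" "f = \<psi> e"
  using assms contraction_bij by (auto simp: bij_betw_def)

text \<open>A loop would carry the same weight vector at both ends, but these are opposite and non-zero.\<close>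

lemma contraction_inj_ends:
  assumes "e \<in> edges G - Z" shows "inj_on \<phi> (ends G e)"
proof -
  have e: "e \<in> edges G" using assms by simp
  obtain u v where uv: "ends G e = {u, v}" "u \<noteq> v" "wt G v e = - wt G u e" "wt G u e \<noteq> 0"
    using wf_edgeE[OF wf e] by metis
  have "\<phi> u \<noteq> \<phi> v"
  proof
    assume "\<phi> u = \<phi> v"
    then have "wt G u e = wt G v e"
      using contraction_wt[OF assms, of u] contraction_wt[OF assms, of v] uv by simp
    then show False
      using uv by (simp add: vec_eq_iff)
  qed
  then show ?thesis using uv by (auto simp: inj_on_def)
qed

lemma contraction_zero_edge:
  assumes "e \<in> Z" "u \<in> ends G e" shows "\<phi> ` ends G e = {\<phi> u}"
proof -
  have e: "e \<in> edges G" using assms contraction_subset by blast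
  obtain a b where ab: "ends G e = {a, b}" "a \<in> verts G" "b \<in> verts G"
    using wf_edgeE[OF wf e] by metis
  have "\<phi> a = \<phi> b"
    using contraction_joined[OF ab(2,3)] joined_edge[OF assms(1), of "ends G" a b] ab(1) by blast
  then show ?thesis using ab assms by auto
qed

lemma contraction_wf: "wgraph_wf H"
proof -
  have joined: "(\<phi> u, \<phi> v) \<in> joined (ends H) (edges H)"
    if u: "u \<in> verts G" and "(u, v) \<in> joined (ends G) (edges G)" for u v
    using that(2)
  proof (induction rule: joined_induct)
    case (step x y e)
    show ?case
    proof (cases "e \<in> Z")
      case True
      then have "\<phi> x = \<phi> y"
        using contraction_zero_edge[OF True, of x] step by auto
      then show ?thesis using step by simp
    next
      case False
      then have "ends H (\<psi> e) = {\<phi> x, \<phi> y}" "\<psi> e \<in> edges H"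
        using contraction_ends[of e] step contraction_edge_in[of e] by auto
      then show ?thesis
        using joined_edge[of "\<psi> e" "edges H" "ends H" "\<phi> x" "\<phi> y"] step joined_trans by metis
    qed
  qed simp
  show ?thesis
    unfolding wgraph_wf_def
  proof (intro conjI ballI)
    show "finite (verts H)" "verts H \<noteq> {}"
      using wf_finite[OF wf] wf_nonempty[OF wf] by (auto simp: contraction_verts)
    show "finite (edges H)"
      using wf_finite[OF wf] contraction_bij by (metis bij_betw_finite finite_Diff)
    show "(u, v) \<in> joined (ends H) (edges H)" if "u \<in> verts H" "v \<in> verts H" for u v
      using that joined wf_connected[OF wf] by (auto simp: contraction_verts)
    show "set (marks H) \<subseteq> verts H"
      using wf_marks[OF wf] by (auto simp: contraction_verts contraction_marks)
  next
    fix f assume "f \<in> edges H"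
    then obtain e where e: "e \<in> edges G" "e \<notin> Z" "f = \<psi> e" by (rule contraction_edgeE)
    obtain u v where uv: "ends G e = {u, v}" "u \<noteq> v" "u \<in> verts G" "v \<in> verts G"
      "wt G v e = - wt G u e" "wt G u e \<noteq> 0"
      using wf_edgeE[OF wf e(1)] by metis
    have eH: "ends H f = {\<phi> u, \<phi> v}"
      using contraction_ends[of e] e uv by auto
    have neq: "\<phi> u \<noteq> \<phi> v"
      using contraction_inj_ends[of e] e uv by (auto simp: inj_on_def)
    have w: "wt H (\<phi> u) f = wt G u e" "wt H (\<phi> v) f = wt G v e"
      using contraction_wt[of e] e uv by auto
    show "ends H f \<subseteq> verts H" using eH uv by (auto simp: contraction_verts)
    show "card (ends H f) = 2" using eH neq by simp
    show "wt H x f \<noteq> 0" if "x \<in> ends H f" for x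
      using that eH w uv by auto
    show "(\<Sum>v\<in>ends H f. wt H v f) = 0"
      using eH w neq uv by simp
  qed
qed

lemma fiber_sum: "(\<Sum>x\<in>verts H. \<Sum>v\<in>fiber \<phi> G x. f v) = (\<Sum>v\<in>verts G. f v)"
  using sum.image_gen[OF wf_finite(1)[OF wf], of f \<phi>]
  by (simp add: contraction_verts fiber_def)

lemma contraction_genus: "genus H = genus G"
proof -
  have finH: "finite (verts H)" using wf_finite[OF wf] by (simp add: contraction_verts)
  have finZ: "finite Z" using contraction_subset wf_finite[OF wf] finite_subset by blast
  have 1: "(\<Sum>x\<in>verts H. int (card {e \<in> Z. \<phi> ` ends G e = {x}})) = int (card Z)"
  proof -
    have "Z = (\<Union>x\<in>verts H. {e \<in> Z. \<phi> ` ends G e = {x}})"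
    proof -
      have "\<exists>x\<in>verts H. \<phi> ` ends G e = {x}" if "e \<in> Z" for e
      proof -
        have e: "e \<in> edges G" using contraction_subset that by blast
        obtain u where "u \<in> ends G e" "u \<in> verts G"
          using wf_edgeE[OF wf e] by (metis insertI1)
        then show ?thesis
          using contraction_zero_edge[OF that] by (auto simp: contraction_verts)
      qed
      then show ?thesis by auto
    qed
    then have "card Z = card (\<Union>x\<in>verts H. {e \<in> Z. \<phi> ` ends G e = {x}})" by simp
    also have "\<dots> = (\<Sum>x\<in>verts H. card {e \<in> Z. \<phi> ` ends G e = {x}})"
      using finH finZ by (intro card_UN_disjoint) auto
    finally show ?thesis by simp
  qed
  have 2: "(\<Sum>x\<in>verts H. int (card (fiber \<phi> G x))) = int (card (verts G))"
    using fiber_sum[of "\<lambda>_. 1::int"] by simp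
  have 3: "card (edges H) + card Z = card (edges G)"
    using bij_betw_same_card[OF contraction_bij] card_Diff_subset[OF finZ contraction_subset]
      card_mono[OF wf_finite(2)[OF wf] contraction_subset] by simp
  have "(\<Sum>x\<in>verts H. int (gen H x)) = (\<Sum>x\<in>verts H. int (card {e \<in> Z. \<phi> ` ends G e = {x}}) + 1
        - int (card (fiber \<phi> G x)) + (\<Sum>v\<in>fiber \<phi> G x. int (gen G v)))"
    by (rule sum.cong[OF refl contraction_gen])
  also have "\<dots> = int (card Z) + int (card (verts H)) - int (card (verts G))
      + (\<Sum>v\<in>verts G. int (gen G v))"
    using 1 2 fiber_sum[of "\<lambda>v. int (gen G v)"] by (simp add: sum.distrib sum_subtractf)
  finally have "int (genus H) = int (genus G)"
    using int_genus[OF wf] int_genus[OF contraction_wf] 3 by simp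
  then show ?thesis by simp
qed

lemma contraction_incident:
  "incident H x = \<psi> ` {e \<in> edges G - Z. x \<in> \<phi> ` ends G e}"
proof (intro set_eqI iffI)
  fix f assume "f \<in> incident H x"
  then have f: "f \<in> edges H" "x \<in> ends H f" by (auto simp: incident_def)
  obtain e where "e \<in> edges G" "e \<notin> Z" "f = \<psi> e" by (rule contraction_edgeE[OF f(1)])
  then show "f \<in> \<psi> ` {e \<in> edges G - Z. x \<in> \<phi> ` ends G e}"
    using f contraction_ends by auto
next
  fix f assume "f \<in> \<psi> ` {e \<in> edges G - Z. x \<in> \<phi> ` ends G e}"
  then show "f \<in> incident H x"
    using contraction_ends contraction_edge_in by (auto simp: incident_def)
qed

text \<open>Inside a contracted component the weights cancel in pairs.\<close>

lemma contraction_vsum: "vsum H x = (\<Sum>v\<in>fiber \<phi> G x. vsum G v)"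
proof -
  let ?fl = "\<lambda>e. {v \<in> ends G e. \<phi> v = x}"
  have fin: "finite (edges G)" "finite (verts G)" using wf_finite[OF wf] by auto
  have "(\<Sum>v\<in>fiber \<phi> G x. vsum G v)
      = (\<Sum>v\<in>fiber \<phi> G x. \<Sum>e\<in>edges G. if v \<in> ends G e then wt G v e else 0)"
    unfolding vsum_def incident_def using fin by (simp add: sum.inter_filter)
  also have "\<dots> = (\<Sum>e\<in>edges G. \<Sum>v\<in>fiber \<phi> G x. if v \<in> ends G e then wt G v e else 0)"
    by (rule sum.swap)
  also have "\<dots> = (\<Sum>e\<in>edges G. \<Sum>v\<in>?fl e. wt G v e)"
  proof (rule sum.cong[OF refl])
    fix e assume "e \<in> edges G"
    then have "?fl e = {v \<in> fiber \<phi> G x. v \<in> ends G e}"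
      using wf_ends[OF wf] by (auto simp: fiber_def)
    then show "(\<Sum>v\<in>fiber \<phi> G x. if v \<in> ends G e then wt G v e else 0) = (\<Sum>v\<in>?fl e. wt G v e)"
      using fiber_finite[OF wf] by (simp add: sum.inter_filter)
  qed
  also have "\<dots> = (\<Sum>e\<in>{e \<in> edges G - Z. x \<in> \<phi> ` ends G e}. \<Sum>v\<in>?fl e. wt G v e)"
  proof (rule sum.mono_neutral_right[OF fin(1)], safe)
    fix e assume e: "e \<in> edges G" and n: "(\<Sum>v\<in>?fl e. wt G v e) \<noteq> 0"
    show "x \<in> \<phi> ` ends G e"
    proof (rule ccontr)
      assume "x \<notin> \<phi> ` ends G e"
      then have "?fl e = {}" by auto
      then show False using n by (metis (no_types, lifting) sum.empty)
    qed
    assume "e \<in> Z"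
    have "?fl e = ends G e \<or> ?fl e = {}"
      using contraction_zero_edge[OF \<open>e \<in> Z\<close>] by force
    moreover have "(\<Sum>v\<in>ends G e. wt G v e) = 0"
      using wf e unfolding wgraph_wf_def by blast
    ultimately show False using n by (metis (no_types, lifting) sum.empty)
  qed
  also have "\<dots> = (\<Sum>e\<in>{e \<in> edges G - Z. x \<in> \<phi> ` ends G e}. wt H x (\<psi> e))"
  proof (rule sum.cong[OF refl])
    fix e assume e: "e \<in> {e \<in> edges G - Z. x \<in> \<phi> ` ends G e}"
    then obtain v where v: "v \<in> ends G e" "\<phi> v = x" by auto
    then have "?fl e = {v}"
      using contraction_inj_ends[of e] e by (auto simp: inj_on_def)
    then show "(\<Sum>v\<in>?fl e. wt G v e) = wt H x (\<psi> e)"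
      using v e contraction_wt[of e v] by simp
  qed
  also have "\<dots> = (\<Sum>f\<in>incident H x. wt H x f)"
    unfolding contraction_incident
    by (rule sum.reindex[symmetric, unfolded o_def])
       (use contraction_bij in \<open>auto simp: bij_betw_def inj_on_def\<close>)
  finally show ?thesis by (simp add: vsum_def)
qed

end

text \<open>The genus formula is compatible with composition because Euler characteristics are additive.\<close>

lemma contraction_compose:
  assumes wf: "wgraph_wf G" and c1: "contraction \<phi> \<psi> G Z H" and c2: "contraction \<phi>' \<psi>' H Y K"
  shows "contraction (\<phi>' \<circ> \<phi>) (\<psi>' \<circ> \<psi>) G (Z \<union> {e \<in> edges G - Z. \<psi> e \<in> Y}) K"
proof -
  let ?P = "{e \<in> edges G - Z. \<psi> e \<in> Y}"
  let ?W = "Z \<union> ?P"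
  have wfH: "wgraph_wf H" by (rule contraction_wf[OF wf c1])
  note 1 = contraction_subset[OF wf c1] contraction_verts[OF wf c1]
    contraction_joined[OF wf c1] contraction_bij[OF wf c1] contraction_ends[OF wf c1]
    contraction_wt[OF wf c1] contraction_gen[OF wf c1] contraction_marks[OF wf c1]
  note 2 = contraction_subset[OF wfH c2] contraction_verts[OF wfH c2]
    contraction_joined[OF wfH c2] contraction_bij[OF wfH c2] contraction_ends[OF wfH c2]
    contraction_wt[OF wfH c2] contraction_gen[OF wfH c2] contraction_marks[OF wfH c2]
  \<comment> \<open>A path in \<open>H\<close> lifts to \<open>G\<close>: consecutive edges are linked inside the fibers by edges of \<open>Z\<close>.\<close>
  have up: "(u, v) \<in> joined (ends G) ?W"
    if u: "u \<in> verts G" and v: "v \<in> verts G" and j: "(\<phi> u, \<phi> v) \<in> joined (ends H) Y" for u v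
  proof -
    have Zm: "(a, b) \<in> joined (ends G) ?W" if "a \<in> verts G" "b \<in> verts G" "\<phi> a = \<phi> b" for a b
      using that 1(3)[of a b] joined_mono[of Z ?W, THEN subsetD] by simp
      have "\<forall>w\<in>verts G. \<phi> w = \<phi> v \<longrightarrow> (u, w) \<in> joined (ends G) ?W"
        using j
      proof (induction rule: joined_induct)
        case base
        show ?case by (intro ballI impI Zm[OF u]) simp_all
      next
        case (step x y f)
        have f: "f \<in> edges H" using step 2(1) by auto
        obtain e where e: "e \<in> edges G" "e \<notin> Z" "f = \<psi> e" by (rule contraction_edgeE[OF wf c1 f])
        have "\<phi> ` ends G e = {x, y}" using 1(5)[of e] e step by auto
        then have "x \<in> \<phi> ` ends G e" "y \<in> \<phi> ` ends G e" by auto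
        then obtain a b where ab: "a \<in> ends G e" "b \<in> ends G e" "\<phi> a = x" "\<phi> b = y"
          by blast
        have xy: "x \<noteq> y" using wf_ends_neq[OF wfH f] step by blast
        have "ends G e = {a, b}"
          using wf_ends_eq[OF wf e(1) ab(1,2)] ab xy by blast
        moreover have "e \<in> ?W" using e step by auto
        ultimately have "(a, b) \<in> joined (ends G) ?W" by (metis joined_edge)
        moreover have av: "a \<in> verts G" and bv: "b \<in> verts G"
          using ab wf_ends(1)[OF wf e(1)] by auto
        moreover have "(u, a) \<in> joined (ends G) ?W" using step.IH av ab by simp
        moreover have "(b, w) \<in> joined (ends G) ?W" if "w \<in> verts G" "\<phi> w = y" for w
          using Zm[OF bv that(1)] that(2) ab by simp
        ultimately show ?case by (blast intro: joined_trans)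
      qed
    then show ?thesis using v by blast
  qed
  have down: "(\<phi> u, \<phi> v) \<in> joined (ends H) Y" if u: "u \<in> verts G" and j: "(u, v) \<in> joined (ends G) ?W" for u v
    using j
  proof (induction rule: joined_induct)
    case (step x y e)
    show ?case
    proof (cases "e \<in> Z")
      case True
      then have "\<phi> x = \<phi> y"
        using contraction_zero_edge[OF wf c1 True, of x] step by auto
      then show ?thesis using step by simp
    next
      case False
      then have "ends H (\<psi> e) = {\<phi> x, \<phi> y}" "\<psi> e \<in> Y"
        using 1(5)[of e] step by auto
      then have "(\<phi> x, \<phi> y) \<in> joined (ends H) Y" by (intro joined_edge[of "\<psi> e"]) auto
      then show ?thesis by (rule joined_trans[OF step.IH])
    qed
  qed simp
  have EW: "edges G - ?W = {e \<in> edges G - Z. \<psi> e \<in> edges H - Y}"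
    using contraction_edge_in[OF wf c1] by auto
  have bij: "bij_betw (\<psi>' \<circ> \<psi>) (edges G - ?W) (edges K)"
  proof -
    have "bij_betw \<psi> (edges G - ?W) (edges H - Y)"
      unfolding EW using 1(4) by (auto simp: bij_betw_def inj_on_def)
    then show ?thesis using 2(4) by (rule bij_betw_trans)
  qed
  have gen: "int (gen K x) = int (card {e \<in> ?W. (\<phi>' \<circ> \<phi>) ` ends G e = {x}}) + 1
        - int (card (fiber (\<phi>' \<circ> \<phi>) G x)) + (\<Sum>v\<in>fiber (\<phi>' \<circ> \<phi>) G x. int (gen G v))"
    if x: "x \<in> verts K" for x
  proof -
    let ?F = "fiber \<phi>' H x"
    have finF: "finite ?F" by (rule fiber_finite[OF wfH])
    have finE: "finite (edges G)" and finZ: "finite Z"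
      using wf_finite[OF wf] 1(1) finite_subset by blast+
    have fib: "fiber (\<phi>' \<circ> \<phi>) G x = (\<Union>y\<in>?F. fiber \<phi> G y)"
      using 1(2) by (auto simp: fiber_def)
    have sum_fib: "(\<Sum>y\<in>?F. \<Sum>v\<in>fiber \<phi> G y. f v) = (\<Sum>v\<in>fiber (\<phi>' \<circ> \<phi>) G x. f v)" for f :: "nat \<Rightarrow> int"
      unfolding fib using finF fiber_finite[OF wf]
      by (intro sum.UNION_disjoint[symmetric]) (auto simp: fiber_def)
    have Zc: "(\<Sum>y\<in>?F. int (card {e \<in> Z. \<phi> ` ends G e = {y}})) = int (card {e \<in> Z. (\<phi>' \<circ> \<phi>) ` ends G e = {x}})"
    proof -
      have "{e \<in> Z. (\<phi>' \<circ> \<phi>) ` ends G e = {x}} = (\<Union>y\<in>?F. {e \<in> Z. \<phi> ` ends G e = {y}})"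
      proof (intro set_eqI iffI)
        fix e assume e: "e \<in> {e \<in> Z. (\<phi>' \<circ> \<phi>) ` ends G e = {x}}"
        then have "e \<in> edges G" using 1(1) by auto
        then obtain u where u: "u \<in> ends G e" "u \<in> verts G"
          using wf_edgeE[OF wf] by (metis insertI1)
        then have "\<phi> ` ends G e = {\<phi> u}" using contraction_zero_edge[OF wf c1] e by auto
        moreover have "\<phi> u \<in> ?F" using e u 1(2) by (auto simp: fiber_def)
        ultimately show "e \<in> (\<Union>y\<in>?F. {e \<in> Z. \<phi> ` ends G e = {y}})" using e by auto
      next
        fix e assume "e \<in> (\<Union>y\<in>?F. {e \<in> Z. \<phi> ` ends G e = {y}})"
        then obtain y where "\<phi> ` ends G e = {y}" "\<phi>' y = x" "e \<in> Z" by (auto simp: fiber_def)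
        then show "e \<in> {e \<in> Z. (\<phi>' \<circ> \<phi>) ` ends G e = {x}}" by (simp only: image_comp[symmetric]) simp
      qed
      then have "card {e \<in> Z. (\<phi>' \<circ> \<phi>) ` ends G e = {x}} = card (\<Union>y\<in>?F. {e \<in> Z. \<phi> ` ends G e = {y}})"
        by simp
      also have "\<dots> = (\<Sum>y\<in>?F. card {e \<in> Z. \<phi> ` ends G e = {y}})"
        using finF finZ by (intro card_UN_disjoint) auto
      finally show ?thesis by simp
    qed
    have Yc: "card {f \<in> Y. \<phi>' ` ends H f = {x}} = card {e \<in> ?P. (\<phi>' \<circ> \<phi>) ` ends G e = {x}}"
    proof -
      have "{f \<in> Y. \<phi>' ` ends H f = {x}} = \<psi> ` {e \<in> ?P. (\<phi>' \<circ> \<phi>) ` ends G e = {x}}"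
      proof (intro set_eqI iffI)
        fix f assume f: "f \<in> {f \<in> Y. \<phi>' ` ends H f = {x}}"
        then have "f \<in> edges H" using 2(1) by auto
        then obtain e where "e \<in> edges G" "e \<notin> Z" "f = \<psi> e" by (rule contraction_edgeE[OF wf c1])
        then show "f \<in> \<psi> ` {e \<in> ?P. (\<phi>' \<circ> \<phi>) ` ends G e = {x}}"
          using f 1(5)[of e] by (auto simp: image_comp)
      next
        fix f assume "f \<in> \<psi> ` {e \<in> ?P. (\<phi>' \<circ> \<phi>) ` ends G e = {x}}"
        then obtain e where "e \<in> edges G - Z" "f = \<psi> e" "f \<in> Y" "(\<phi>' \<circ> \<phi>) ` ends G e = {x}"
          by blast
        then show "f \<in> {f \<in> Y. \<phi>' ` ends H f = {x}}"
          using 1(5)[of e] by (simp only: image_comp mem_Collect_eq)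
      qed
      moreover have "inj_on \<psi> {e \<in> ?P. (\<phi>' \<circ> \<phi>) ` ends G e = {x}}"
        using 1(4) by (auto simp: bij_betw_def inj_on_def)
      ultimately show ?thesis by (simp add: card_image)
    qed
    have "{e \<in> ?W. (\<phi>' \<circ> \<phi>) ` ends G e = {x}}
        = {e \<in> Z. (\<phi>' \<circ> \<phi>) ` ends G e = {x}} \<union> {e \<in> ?P. (\<phi>' \<circ> \<phi>) ` ends G e = {x}}" by auto
    then have Wc: "card {e \<in> ?W. (\<phi>' \<circ> \<phi>) ` ends G e = {x}}
        = card {e \<in> Z. (\<phi>' \<circ> \<phi>) ` ends G e = {x}} + card {e \<in> ?P. (\<phi>' \<circ> \<phi>) ` ends G e = {x}}"
      using finE finZ by (simp add: card_Un_disjoint disjoint_iff)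
    have "(\<Sum>y\<in>?F. int (gen H y)) = (\<Sum>y\<in>?F. int (card {e \<in> Z. \<phi> ` ends G e = {y}}) + 1
        - int (card (fiber \<phi> G y)) + (\<Sum>v\<in>fiber \<phi> G y. int (gen G v)))"
      by (rule sum.cong[OF refl 1(7)]) (simp add: fiber_def)
    also have "\<dots> = int (card {e \<in> Z. (\<phi>' \<circ> \<phi>) ` ends G e = {x}}) + int (card ?F)
        - int (card (fiber (\<phi>' \<circ> \<phi>) G x)) + (\<Sum>v\<in>fiber (\<phi>' \<circ> \<phi>) G x. int (gen G v))"
      using Zc sum_fib[of "\<lambda>_. 1"] sum_fib[of "\<lambda>v. int (gen G v)"]
      by (simp add: sum.distrib sum_subtractf)
    finally show ?thesis
      using 2(7)[OF x] Yc Wc by simp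
  qed
  show ?thesis
    unfolding contraction_def
  proof (intro conjI ballI gen bij)
    show "?W \<subseteq> edges G" using 1(1) by auto
    show "(\<phi>' \<circ> \<phi>) ` verts G = verts K" using 1(2) 2(2) by (metis image_comp)
    show "(\<phi>' \<circ> \<phi>) u = (\<phi>' \<circ> \<phi>) v \<longleftrightarrow> (u, v) \<in> joined (ends G) ?W" if "u \<in> verts G" "v \<in> verts G" for u v
      using 2(3)[of "\<phi> u" "\<phi> v"] up[OF that] down[OF that(1), of v] that 1(2) by auto
    show "marks K = map (\<phi>' \<circ> \<phi>) (marks G)" using 1(8) 2(8) by simp
  next
    fix e assume e: "e \<in> edges G - ?W"
    then have e': "\<psi> e \<in> edges H - Y" "e \<in> edges G - Z" using EW by auto
    show "ends K ((\<psi>' \<circ> \<psi>) e) = (\<phi>' \<circ> \<phi>) ` ends G e"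
      using 1(5)[of e] 2(5)[of "\<psi> e"] e' by (simp add: image_comp)
    show "wt K ((\<phi>' \<circ> \<phi>) v) ((\<psi>' \<circ> \<psi>) e) = wt G v e" if "v \<in> ends G e" for v
      using 1(5,6)[of e] 2(6)[of "\<psi> e" "\<phi> v"] e' that by auto
  qed
qed

text \<open>The labels of \<open>G\<close> determine everything in a contraction. All isomorphisms constructed below come
  from this lemma.\<close>

lemma contraction_unique:
  assumes wf: "wgraph_wf G" and c1: "contraction \<phi> \<psi> G Z H" and c2: "contraction \<phi>' \<psi>' G Z H'"
  obtains \<theta> \<xi> where "wgraph_iso \<theta> \<xi> H H'" "\<And>v. v \<in> verts G \<Longrightarrow> \<theta> (\<phi> v) = \<phi>' v"
proof -
  define \<theta> where "\<theta> x = \<phi>' (inv_into (verts G) \<phi> x)" for x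
  define \<xi> where "\<xi> f = \<psi>' (inv_into (edges G - Z) \<psi> f)" for f
  note 1 = contraction_subset[OF wf c1] contraction_verts[OF wf c1]
    contraction_joined[OF wf c1] contraction_bij[OF wf c1] contraction_ends[OF wf c1]
    contraction_wt[OF wf c1] contraction_gen[OF wf c1] contraction_marks[OF wf c1]
  note 2 = contraction_subset[OF wf c2] contraction_verts[OF wf c2]
    contraction_joined[OF wf c2] contraction_bij[OF wf c2] contraction_ends[OF wf c2]
    contraction_wt[OF wf c2] contraction_gen[OF wf c2] contraction_marks[OF wf c2]
  have same: "\<phi> u = \<phi> v \<longleftrightarrow> \<phi>' u = \<phi>' v" if "u \<in> verts G" "v \<in> verts G" for u v
    using 1(3) 2(3) that by simp
  have \<theta>: "\<theta> (\<phi> v) = \<phi>' v" if v: "v \<in> verts G" for v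
  proof -
    have "\<phi> v \<in> \<phi> ` verts G" using v by simp
    then have "inv_into (verts G) \<phi> (\<phi> v) \<in> verts G" "\<phi> (inv_into (verts G) \<phi> (\<phi> v)) = \<phi> v"
      by (auto intro: inv_into_into f_inv_into_f)
    then show ?thesis using same v by (simp add: \<theta>_def)
  qed
  have \<xi>: "\<xi> (\<psi> e) = \<psi>' e" if "e \<in> edges G - Z" for e
    unfolding \<xi>_def using inv_into_f_f[of \<psi> "edges G - Z" e] 1(4) that by (simp add: bij_betw_def)
  have bv: "bij_betw \<theta> (verts H) (verts H')"
    unfolding bij_betw_def
  proof
    show "inj_on \<theta> (verts H)"
      using \<theta> same by (auto simp: inj_on_def 1(2))
    show "\<theta> ` verts H = verts H'"
      using \<theta> by (auto simp: 1(2) 2(2) image_image)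
  qed
  have be: "bij_betw \<xi> (edges H) (edges H')"
  proof -
    have "bij_betw (inv_into (edges G - Z) \<psi>) (edges H) (edges G - Z)"
      using 1(4) by (rule bij_betw_inv_into)
    then show ?thesis
      using bij_betw_trans[OF _ 2(4)] by (simp add: \<xi>_def[abs_def] o_def)
  qed
  have fibs: "fiber \<phi> G (\<phi> v) = fiber \<phi>' G (\<phi>' v)" if "v \<in> verts G" for v
    using same[OF _ that] by (auto simp: fiber_def)
  have loops: "\<phi> ` ends G e = {\<phi> v} \<longleftrightarrow> \<phi>' ` ends G e = {\<phi>' v}" if v: "v \<in> verts G" and e: "e \<in> Z" for e v
  proof -
    have eG: "e \<in> edges G" using e 1(1) by auto
    obtain a b where ab: "ends G e = {a, b}" "a \<in> verts G" "b \<in> verts G"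
      using wf_edgeE[OF wf eG] by metis
    show ?thesis using same[OF ab(2) v] same[OF ab(3) v] by (auto simp: ab(1))
  qed
  have gen: "gen H' (\<theta> x) = gen H x" if x: "x \<in> verts H" for x
  proof -
    obtain v where v: "v \<in> verts G" "x = \<phi> v" using x by (auto simp: 1(2))
    have "\<phi>' v \<in> verts H'" using v by (simp add: 2(2))
    from 2(7)[OF this] have "int (gen H' (\<phi>' v)) = int (gen H (\<phi> v))"
      using 1(7)[of "\<phi> v"] x v fibs[OF v(1)] loops[OF v(1)] by (simp cong: conj_cong)
    then show ?thesis using \<theta> v by simp
  qed
  have "wgraph_iso \<theta> \<xi> H H'"
    unfolding wgraph_iso_def
  proof (intro conjI ballI bv be gen)
    show "marks H' = map \<theta> (marks H)"
      using wf_marks[OF wf] by (auto simp: 1(8) 2(8) \<theta> subset_iff)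
  next
    fix f assume "f \<in> edges H"
    then obtain e where e: "e \<in> edges G" "e \<notin> Z" "f = \<psi> e" by (rule contraction_edgeE[OF wf c1])
    have sub: "ends G e \<subseteq> verts G" using wf_ends(1)[OF wf e(1)] .
    have ends: "\<phi>' ` ends G e = \<theta> ` \<phi> ` ends G e"
      using \<theta> sub by (force simp: image_image)
    show "ends H' (\<xi> f) = \<theta> ` ends H f"
      using e 1(5)[of e] 2(5)[of e] \<xi>[of e] ends by simp
    show "wt H' (\<theta> x) (\<xi> f) = wt H x f" if x: "x \<in> ends H f" for x
    proof -
      obtain v where v: "v \<in> ends G e" "x = \<phi> v" using x 1(5)[of e] e by auto
      then show ?thesis
        using e 1(6)[of e v] 2(6)[of e v] \<xi>[of e] \<theta>[of v] sub by auto
    qed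
  qed
  then show thesis using \<theta> that by blast
qed

text \<open>An isomorphism is a contraction of no edges.\<close>

lemma contraction_iso:
  assumes wf: "wgraph_wf G" and iso: "wgraph_iso \<phi> \<psi> G H"
  shows "contraction \<phi> \<psi> G {} H"
proof -
  have bij: "bij_betw \<phi> (verts G) (verts H)" "bij_betw \<psi> (edges G) (edges H)"
    and ends: "\<And>e. e \<in> edges G \<Longrightarrow> ends H (\<psi> e) = \<phi> ` ends G e"
    and wt: "\<And>e v. e \<in> edges G \<Longrightarrow> v \<in> ends G e \<Longrightarrow> wt H (\<phi> v) (\<psi> e) = wt G v e"
    and gen: "\<And>v. v \<in> verts G \<Longrightarrow> gen H (\<phi> v) = gen G v"
    and marks: "marks H = map \<phi> (marks G)"
    using iso unfolding wgraph_iso_def by blast+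
  have fib: "fiber \<phi> G (\<phi> v) = {v}" if "v \<in> verts G" for v
    using bij(1) that by (auto simp: fiber_def bij_betw_def inj_on_def)
  have inj: "\<phi> u = \<phi> v \<longleftrightarrow> u = v" if "u \<in> verts G" "v \<in> verts G" for u v
    using bij(1) that by (auto simp: bij_betw_def inj_on_def)
  show ?thesis
    unfolding contraction_def
  proof (intro conjI ballI)
    fix x assume "x \<in> verts H"
    then obtain v where v: "v \<in> verts G" "x = \<phi> v" using bij(1) by (auto simp: bij_betw_def)
    then show "int (gen H x) = int (card {e \<in> {}. \<phi> ` ends G e = {x}}) + 1
        - int (card (fiber \<phi> G x)) + (\<Sum>v\<in>fiber \<phi> G x. int (gen G v))"
      by (simp add: fib gen)
  qed (use bij ends wt marks inj in \<open>auto simp: bij_betw_def\<close>)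
qed

lemma contraction_empty_iso:
  assumes wf: "wgraph_wf G" and c: "contraction \<phi> \<psi> G {} H"
  shows "wgraph_iso \<phi> \<psi> G H"
proof -
  have inj: "inj_on \<phi> (verts G)"
    using contraction_joined[OF wf c] by (simp add: inj_on_def)
  have "gen H (\<phi> v) = gen G v" if v: "v \<in> verts G" for v
  proof -
    have "fiber \<phi> G (\<phi> v) = {v}" using inj v by (auto simp: fiber_def inj_on_def)
    then show ?thesis
      using contraction_gen[OF wf c, of "\<phi> v"] v by (simp add: contraction_verts[OF wf c])
  qed
  then show ?thesis
    unfolding wgraph_iso_def bij_betw_def
    using inj contraction_verts[OF wf c] contraction_bij[OF wf c] contraction_ends[OF wf c]
      contraction_wt[OF wf c] contraction_marks[OF wf c]
    by (auto simp: bij_betw_def)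
qed

lemma contraction_id: "wgraph_wf G \<Longrightarrow> contraction (\<lambda>v. v) (\<lambda>e. e) G {} G"
  by (rule contraction_iso) (auto simp: wgraph_iso_def bij_betw_def)

lemma wgraph_iso_wf: "wgraph_wf G \<Longrightarrow> wgraph_iso \<phi> \<psi> G H \<Longrightarrow> wgraph_wf H"
  using contraction_wf contraction_iso by blast

lemma wgraph_iso_sym:
  assumes wf: "wgraph_wf G" and iso: "wgraph_iso \<phi> \<psi> G H"
  obtains \<phi>' \<psi>' where "wgraph_iso \<phi>' \<psi>' H G" "\<And>v. v \<in> verts G \<Longrightarrow> \<phi>' (\<phi> v) = v"
  using contraction_unique[OF wf contraction_iso[OF wf iso] contraction_id[OF wf]] by metis

lemma wgraph_iso_trans:
  assumes wf: "wgraph_wf G" and "wgraph_iso \<phi> \<psi> G H" "wgraph_iso \<phi>' \<psi>' H K"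
  shows "wgraph_iso (\<phi>' \<circ> \<phi>) (\<psi>' \<circ> \<psi>) G K"
proof -
  have "contraction (\<phi>' \<circ> \<phi>) (\<psi>' \<circ> \<psi>) G ({} \<union> {e \<in> edges G - {}. \<psi> e \<in> {}}) K"
    using assms contraction_iso wgraph_iso_wf by (intro contraction_compose) blast+
  then show ?thesis by (intro contraction_empty_iso[OF wf]) simp
qed

lemma iso_incident:
  assumes wf: "wgraph_wf G" and iso: "wgraph_iso \<phi> \<psi> G H" and v: "v \<in> verts G"
  shows "incident H (\<phi> v) = \<psi> ` incident G v" "vsum H (\<phi> v) = vsum G v"
    "card (incident H (\<phi> v)) = card (incident G v)"
    "removable H (\<phi> v) \<longleftrightarrow> removable G v"
proof -
  note c = contraction_iso[OF wf iso]
  have inj: "inj_on \<phi> (verts G)" and injE: "inj_on \<psi> (edges G)"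
    using iso by (auto simp: wgraph_iso_def bij_betw_def)
  have "\<phi> v \<in> \<phi> ` ends G e \<longleftrightarrow> v \<in> ends G e" if "e \<in> edges G" for e
    using inj_on_image_mem_iff[OF inj v wf_ends(1)[OF wf that]] .
  then show inc: "incident H (\<phi> v) = \<psi> ` incident G v"
    unfolding contraction_incident[OF wf c] incident_def[of G] by (intro arg_cong[of _ _ "image \<psi>"]) auto
  have "fiber \<phi> G (\<phi> v) = {v}" using inj v by (auto simp: fiber_def inj_on_def)
  then show vs: "vsum H (\<phi> v) = vsum G v"
    unfolding contraction_vsum[OF wf c] by simp
  show card: "card (incident H (\<phi> v)) = card (incident G v)"
    unfolding inc by (intro card_image inj_on_subset[OF injE]) (auto simp: incident_def)
  have "\<phi> v \<in> set (marks H) \<longleftrightarrow> v \<in> set (marks G)"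
    using inj_on_image_mem_iff[OF inj v wf_marks[OF wf]] contraction_marks[OF wf c] by simp
  moreover have "\<phi> v \<in> verts H" "gen H (\<phi> v) = gen G v"
    using iso v by (auto simp: wgraph_iso_def bij_betw_def)
  ultimately show "removable H (\<phi> v) \<longleftrightarrow> removable G v"
    using card vs v by (simp add: removable_def)
qed

lemma iso_simple:
  assumes "wgraph_wf G" "wgraph_iso \<phi> \<psi> G H"
  shows "simple_wgraph H \<longleftrightarrow> simple_wgraph G"
proof -
  have "verts H = \<phi> ` verts G" using assms(2) by (auto simp: wgraph_iso_def bij_betw_def)
  then have "(\<exists>x. removable H x) \<longleftrightarrow> (\<exists>x\<in>\<phi> ` verts G. removable H x)"
    by (metis removable_def)
  also have "\<dots> \<longleftrightarrow> (\<exists>v\<in>verts G. removable G v)"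
    using iso_incident(4)[OF assms] by simp
  also have "\<dots> \<longleftrightarrow> (\<exists>v. removable G v)"
    by (metis removable_def)
  finally show ?thesis unfolding simple_wgraph_def by blast
qed

lemma iso_genus: "wgraph_wf G \<Longrightarrow> wgraph_iso \<phi> \<psi> G H \<Longrightarrow> genus H = genus G"
  using contraction_genus contraction_iso by blast

lemma iso_length_marks: "wgraph_iso \<phi> \<psi> G H \<Longrightarrow> length (marks H) = length (marks G)"
  by (simp add: wgraph_iso_def)

text \<open>The hypothesis \<open>noloop\<close> holds as soon as the ends of the edges outside \<open>Z\<close> have different positions while
  the ends of the edges in \<open>Z\<close> have the same position.\<close>

lemma contract_contraction:
  assumes wf: "wgraph_wf G" and Z: "Z \<subseteq> edges G"
    and noloop: "\<And>e u v. e \<in> edges G - Z \<Longrightarrow> ends G e = {u, v} \<Longrightarrow> (u, v) \<notin> joined (ends G) Z"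
  shows "contraction (\<lambda>v. Min (component G Z v)) (\<lambda>e. e) G Z (contract G Z)"
proof -
  let ?r = "\<lambda>v. Min (component G Z v)"
  have sub: "component G Z v \<subseteq> verts G" if "v \<in> verts G" for v
    using joined_verts[OF wf _ Z that] by (auto simp: component_def)
  have fin: "finite (component G Z v)" if "v \<in> verts G" for v
    using sub[OF that] wf_finite(1)[OF wf] finite_subset by blast
  have self: "v \<in> component G Z v" for v by (simp add: component_def)
  have rin: "?r v \<in> component G Z v" if "v \<in> verts G" for v
    using Min_in[OF fin[OF that]] self by blast
  have comp_eq: "component G Z u = component G Z v \<longleftrightarrow> (u, v) \<in> joined (ends G) Z" for u v
    unfolding component_def using eq_equiv_class_iff[OF equiv_joined[of "ends G" Z]] by blast
  have r_eq: "?r u = ?r v \<longleftrightarrow> (u, v) \<in> joined (ends G) Z" if "u \<in> verts G" "v \<in> verts G" for u v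
  proof
    assume "?r u = ?r v"
    then have "(u, ?r v) \<in> joined (ends G) Z" "(v, ?r v) \<in> joined (ends G) Z"
      using rin[OF that(1)] rin[OF that(2)] by (auto simp: component_def)
    then show "(u, v) \<in> joined (ends G) Z" by (metis joined_sym joined_trans)
  next
    assume "(u, v) \<in> joined (ends G) Z"
    then have "component G Z u = component G Z v" using comp_eq by blast
    then show "?r u = ?r v" by simp
  qed
  have fields: "verts (contract G Z) = ?r ` verts G" "edges (contract G Z) = edges G - Z"
    "ends (contract G Z) e = ?r ` ends G e"
    "wt (contract G Z) v e = (\<Sum>u\<in>{u \<in> ends G e. ?r u = v}. wt G u e)"
    "gen (contract G Z) v = betti1 (component G Z v) {e \<in> Z. ends G e \<subseteq> component G Z v} (ends G)
                 + (\<Sum>u\<in>component G Z v. gen G u)"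
    "marks (contract G Z) = map ?r (marks G)" for v e
    by (simp_all add: contract_def Let_def)
  show ?thesis
    unfolding contraction_def
  proof (intro conjI ballI)
    show "(?r u = ?r v) = ((u, v) \<in> joined (ends G) Z)" if "u \<in> verts G" "v \<in> verts G" for u v
      using r_eq[OF that] .
  next
    fix e v assume e: "e \<in> edges G - Z" and v: "v \<in> ends G e"
    have eG: "e \<in> edges G" using e by simp
    have "u = v" if "u \<in> ends G e" "?r u = ?r v" for u
    proof (rule ccontr)
      assume "u \<noteq> v"
      then have "ends G e = {u, v}" using wf_ends_eq[OF wf eG that(1) v] by simp
      then show False
        using noloop[OF e, of u v] that(2) r_eq[of u v] wf_ends_verts[OF wf eG] by blast
    qed
    then have "{u \<in> ends G e. ?r u = ?r v} = {v}" using v by auto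
    then show "wt (contract G Z) (?r v) e = wt G v e" by (simp add: fields)
  next
    fix x assume "x \<in> verts (contract G Z)"
    then obtain v where v: "v \<in> verts G" "x = ?r v" by (auto simp: fields)
    have "(v, ?r v) \<in> joined (ends G) Z" using rin[OF v(1)] by (simp add: component_def)
    then have cx: "component G Z x = component G Z v" using comp_eq v by metis
    let ?K = "component G Z v" and ?E = "{e \<in> Z. ends G e \<subseteq> component G Z v}"
    have fib: "fiber ?r G x = ?K"
    proof -
      have "u \<in> ?K \<longleftrightarrow> (u, v) \<in> joined (ends G) Z" for u
        unfolding component_def by (simp, metis joined_sym)
      then have "u \<in> verts G \<and> ?r u = ?r v \<longleftrightarrow> u \<in> ?K" for u
        using r_eq[OF _ v(1), of u] sub[OF v(1)] by blast
      then show ?thesis by (auto simp: fiber_def v(2))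
    qed
    have conn: "(v, w) \<in> joined (ends G) ?E" if "w \<in> ?K" for w
    proof -
      have "(v, w) \<in> joined (ends G) Z" using that by (simp add: component_def)
      then show ?thesis
      proof (induction rule: joined_induct)
        case (step x y e)
        have "(v, y) \<in> joined (ends G) Z"
          using joined_trans[OF step.hyps(1) joined_edge[of e Z "ends G" x y]] step.hyps by blast
        then have "e \<in> ?E" using step.hyps by (simp add: component_def)
        then have "(x, y) \<in> joined (ends G) ?E" using step.hyps(3) by (rule joined_edge)
        then show ?case by (rule joined_trans[OF step.IH])
      qed simp
    qed
    have E: "{e \<in> Z. ?r ` ends G e = {x}} = ?E"
    proof -
      have "?r ` ends G e = {x} \<longleftrightarrow> ends G e \<subseteq> ?K" if "e \<in> Z" for e
      proof -
        have eG: "e \<in> edges G" using that Z by auto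
        have "?r ` ends G e = {x} \<longleftrightarrow> (\<forall>u\<in>ends G e. ?r u = x)"
          using wf_ends(2)[OF wf eG] by (auto simp: card_2_iff)
        also have "\<dots> \<longleftrightarrow> ends G e \<subseteq> fiber ?r G x"
          using wf_ends(1)[OF wf eG] by (auto simp: fiber_def)
        finally show ?thesis by (simp add: fib)
      qed
      then show ?thesis by auto
    qed
    have finE: "finite ?E" using finite_subset[OF Z wf_finite(2)[OF wf]] by simp
    have "int (betti1 ?K ?E (ends G)) = int (card ?E) + 1 - int (card ?K)"
      by (rule betti1_connected[OF fin[OF v(1)] finE self _ conn]) auto
    then show "int (gen (contract G Z) x) = int (card {e \<in> Z. ?r ` ends G e = {x}}) + 1
        - int (card (fiber ?r G x)) + (\<Sum>v\<in>fiber ?r G x. int (gen G v))"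
      by (simp add: fields cx E fib)
  qed (use Z in \<open>auto simp: fields bij_betw_def\<close>)
qed

text \<open>Erasing a removable vertex is the same as contracting one of its two edges: the vertex
  contributes no genus, no marking and no sum of weights to the vertex with which it is merged.
  Either of the two edges can be chosen.\<close>

lemma smooth_step_contractions:
  assumes wf: "wgraph_wf G" and u12: "u1 \<noteq> u2"
    and rem: "removable G v" and inc: "incident G v = {e1, e2}" and ne: "e1 \<noteq> e2"
    and en: "ends G e1 = {v, u1}" "ends G e2 = {v, u2}"
    and H: "H = G\<lparr>verts := verts G - {v}, edges := edges G - {e2}, ends := (ends G)(e1 := {u1, u2}),
          wt := (wt G)(u2 := (wt G u2)(e1 := wt G u2 e2))\<rparr>"
  shows "contraction (id(v := u2)) id G {e2} H" "contraction (id(v := u1)) (id(e2 := e1)) G {e1} H"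
proof -
  have E: "e1 \<in> edges G" "e2 \<in> edges G" using inc by (auto simp: incident_def)
  have nv: "v \<noteq> u1" "v \<noteq> u2" using wf_ends_neq[OF wf] E en by blast+
  have vV: "v \<in> verts G" "u1 \<in> verts G" "u2 \<in> verts G" using wf_ends_verts[OF wf] E en by blast+
  have other: "v \<notin> ends G e" if "e \<in> edges G" "e \<noteq> e1" "e \<noteq> e2" for e
    using inc that by (auto simp: incident_def)
  have wts: "wt G u1 e1 = - wt G v e1" "wt G u2 e2 = - wt G v e2"
    using wf_opp[OF wf] E en by blast+
  have "wt G v e1 + wt G v e2 = 0"
    using rem inc ne by (simp add: removable_def vsum_def)
  then have w12: "wt G v e2 = - wt G v e1" by (simp add: add_eq_0_iff)
  have g0: "gen G v = 0" "v \<notin> set (marks G)" using rem by (auto simp: removable_def)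
  have one: "(a, b) \<in> joined (ends G) {e} \<longleftrightarrow> a = b \<or> {a, b} = {v, u}" if "ends G e = {v, u}" for a b u e
  proof
    assume "(a, b) \<in> joined (ends G) {e}"
    then show "a = b \<or> {a, b} = {v, u}"
      by (induction rule: joined_induct) (use that in \<open>auto simp: doubleton_eq_iff\<close>)
  next
    assume "a = b \<or> {a, b} = {v, u}"
    then show "(a, b) \<in> joined (ends G) {e}"
      using joined_edge[of e "{e}" "ends G" a b] that by auto
  qed
  have fibs: "fiber (id(v := u)) G x = (if x = u then {u, v} else if x = v then {} else {x})"
    if "x \<in> verts G" "u \<in> verts G" "u \<noteq> v" for x u
    using that vV by (auto simp: fiber_def)
  have m: "map (id(v := u)) (marks G) = marks G" for u
    using g0 by (auto intro: map_idI)
  have gen: "int (gen H x) = int (card {e' \<in> {e}. (id(v := u)) ` ends G e' = {x}}) + 1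
        - int (card (fiber (id(v := u)) G x)) + (\<Sum>w\<in>fiber (id(v := u)) G x. int (gen G w))"
    if "x \<in> verts H" "ends G e = {v, u}" "u \<noteq> v" "u \<in> verts G" for x u e
  proof -
    have x: "x \<in> verts G" "x \<noteq> v" using that by (auto simp: H)
    have im: "(id(v := u)) ` ends G e = {u}" using that by auto
    have "{e' \<in> {e}. (id(v := u)) ` ends G e' = {x}} = (if x = u then {e} else {})"
      using im by auto
    then show ?thesis
      using x that g0 by (simp add: fibs H)
  qed
  show "contraction (id(v := u2)) id G {e2} H"
    unfolding contraction_def
  proof (intro conjI ballI)
    fix e assume e: "e \<in> edges G - {e2}"
    show "ends H (id e) = (id(v := u2)) ` ends G e"
      using e other[of e] en nv by (cases "e = e1") (auto simp: H)
    show "wt H ((id(v := u2)) a) (id e) = wt G a e" if "a \<in> ends G e" for a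
      using e that other[of e] en nv u12 wts w12 by (cases "e = e1") (auto simp: H)
  next
    show "(id(v := u2)) ` verts G = verts H" using vV nv by (auto simp: H image_iff)
    show "((id(v := u2)) a = (id(v := u2)) b) = ((a, b) \<in> joined (ends G) {e2})"
      if "a \<in> verts G" "b \<in> verts G" for a b
      using nv by (auto simp: one[OF en(2)] doubleton_eq_iff)
    show "int (gen H x) = int (card {e \<in> {e2}. (id(v := u2)) ` ends G e = {x}}) + 1
        - int (card (fiber (id(v := u2)) G x)) + (\<Sum>w\<in>fiber (id(v := u2)) G x. int (gen G w))"
      if "x \<in> verts H" for x
      using gen[OF that en(2)] nv vV by blast
  qed (use E m in \<open>auto simp: H bij_betw_def\<close>)
  show "contraction (id(v := u1)) (id(e2 := e1)) G {e1} H"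
    unfolding contraction_def
  proof (intro conjI ballI)
    fix e assume e: "e \<in> edges G - {e1}"
    show "ends H ((id(e2 := e1)) e) = (id(v := u1)) ` ends G e"
      using e other[of e] en nv by (cases "e = e2") (auto simp: H)
    show "wt H ((id(v := u1)) a) ((id(e2 := e1)) e) = wt G a e" if "a \<in> ends G e" for a
      using e that other[of e] en nv u12 wts w12 by (cases "e = e2") (auto simp: H)
  next
    show "(id(v := u1)) ` verts G = verts H" using vV nv by (auto simp: H image_iff)
    show "((id(v := u1)) a = (id(v := u1)) b) = ((a, b) \<in> joined (ends G) {e1})"
      if "a \<in> verts G" "b \<in> verts G" for a b
      using nv by (auto simp: one[OF en(1)] doubleton_eq_iff)
    show "int (gen H x) = int (card {e \<in> {e1}. (id(v := u1)) ` ends G e = {x}}) + 1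
        - int (card (fiber (id(v := u1)) G x)) + (\<Sum>w\<in>fiber (id(v := u1)) G x. int (gen G w))"
      if "x \<in> verts H" for x
      using gen[OF that en(1)] nv vV by blast
  qed (use E ne m in \<open>auto simp: H bij_betw_def inj_on_def\<close>)
qed

section \<open>Faces of the Clemens polytope and curves with edges of length zero\<close>

definition supp :: "real^'i::finite \<Rightarrow> 'i set" where
  "supp x = {i. x $ i \<noteq> 0}"

lemma supp_subset_iff: "supp x \<subseteq> I \<longleftrightarrow> (\<forall>i. i \<notin> I \<longrightarrow> x $ i = 0)"
  by (auto simp: supp_def)

lemma face_sets_subset:
  "I \<in> face_sets D \<Longrightarrow> J \<subseteq> I \<Longrightarrow> J \<noteq> {} \<Longrightarrow> J \<in> face_sets D"
  by (auto simp: face_sets_def strata_inter_def)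

lemma supp_nonempty: "(\<Sum>i\<in>UNIV. x $ i) = c \<Longrightarrow> 0 < c \<Longrightarrow> supp x \<noteq> {}"
  using sum.neutral[of UNIV "\<lambda>i. x $ i"] by (fastforce simp: supp_def)

lemma face_simplex_iff:
  "x \<in> face_simplex c I \<longleftrightarrow> (\<forall>i. 0 \<le> x $ i) \<and> (\<Sum>i\<in>UNIV. x $ i) = c \<and> supp x \<subseteq> I"
  by (auto simp: face_simplex_def supp_def)

lemma clemens_polytope_iff:
  assumes "0 < c"
  shows "x \<in> clemens_polytope D c \<longleftrightarrow>
    (\<forall>i. 0 \<le> x $ i) \<and> (\<Sum>i\<in>UNIV. x $ i) = c \<and> supp x \<in> face_sets D"
  using face_sets_subset[of _ D "supp x"] supp_nonempty[of x c] assms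
  by (auto simp: clemens_polytope_def face_simplex_iff)

lemma convex_face_simplex: "convex (face_simplex c I)"
  unfolding convex_def face_simplex_def
  by (auto simp: sum.distrib sum_distrib_left[symmetric] distrib_right[symmetric])

text \<open>From a point with full support one can move a little towards any point of the affine hull. This
  determines both the relative interior and the affine hull of a face.\<close>

lemma face_simplex_extend:
  assumes x: "x \<in> face_simplex c I" "supp x = I" and y: "(\<Sum>i\<in>UNIV. y $ i) = c" "supp y \<subseteq> I"
  obtains \<epsilon> where "0 < \<epsilon>" "x + \<epsilon> *\<^sub>R (y - x) \<in> face_simplex c I"
proof -
  define m where "m = Min (insert 1 ((\<lambda>i. x $ i) ` I))"
  have xI: "0 < x $ i" if "i \<in> I" for i
    using x that by (auto simp: face_simplex_iff supp_def less_le)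
  have m: "0 < m" "\<And>i. i \<in> I \<Longrightarrow> m \<le> x $ i"
    using xI by (auto simp: m_def)
  define \<epsilon> where "\<epsilon> = m / (1 + norm (y - x))"
  have n: "0 < 1 + norm (y - x)" by (simp add: add_pos_nonneg)
  have \<epsilon>: "0 < \<epsilon>" "\<epsilon> * norm (y - x) \<le> m"
    using m n by (auto simp: \<epsilon>_def field_simps)
  have "0 \<le> x $ i + \<epsilon> * (y $ i - x $ i)" for i
  proof (cases "i \<in> I")
    case True
    have "\<epsilon> * \<bar>y $ i - x $ i\<bar> \<le> \<epsilon> * norm (y - x)"
      using component_le_norm_cart[of "y - x" i] \<epsilon> by simp
    moreover have "- (\<epsilon> * \<bar>y $ i - x $ i\<bar>) \<le> \<epsilon> * (y $ i - x $ i)"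
      using mult_left_mono[of "- \<bar>y $ i - x $ i\<bar>" "y $ i - x $ i" \<epsilon>] \<epsilon>(1) by simp
    ultimately show ?thesis using m(2)[OF True] \<epsilon> by linarith
  next
    case False
    then have "x $ i = 0" "y $ i = 0" using x y by (auto simp: supp_def)
    then show ?thesis by simp
  qed
  moreover have "(\<Sum>i\<in>UNIV. x $ i + \<epsilon> * (y $ i - x $ i)) = c"
    using x y by (simp add: face_simplex_def sum.distrib sum_subtractf sum_distrib_left[symmetric])
  moreover have "supp (x + \<epsilon> *\<^sub>R (y - x)) \<subseteq> I"
    using x y by (auto simp: supp_def)
  ultimately show thesis
    using \<epsilon>(1) that by (auto simp: face_simplex_iff)
qed

lemma barycenter:
  assumes "0 < c" "I \<noteq> {}"
  obtains b :: "real^'i::finite" where "b \<in> face_simplex c I" "supp b = I"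
proof -
  let ?b = "(\<chi> i. if i \<in> I then c / card I else 0) :: real^'i"
  have "0 < card I" using assms by (simp add: card_gt_0_iff)
  then have "?b \<in> face_simplex c I" "supp ?b = I"
    using assms by (auto simp: face_simplex_def supp_def sum.If_cases)
  then show thesis by (rule that)
qed

lemma affine_hull_face_simplex:
  assumes "0 < c" "I \<noteq> {}"
  shows "affine hull (face_simplex c I :: (real^'i::finite) set) = {x. (\<Sum>i\<in>UNIV. x $ i) = c \<and> supp x \<subseteq> I}"
proof (rule antisym)
  have "affine {x :: real^'i. (\<Sum>i\<in>UNIV. x $ i) = c \<and> supp x \<subseteq> I}"
    unfolding affine_def supp_subset_iff
    by (auto simp: sum.distrib sum_distrib_left[symmetric] distrib_right[symmetric])
  then show "affine hull (face_simplex c I :: (real^'i) set) \<subseteq> {x. (\<Sum>i\<in>UNIV. x $ i) = c \<and> supp x \<subseteq> I}"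
    by (intro hull_minimal) (auto simp: face_simplex_iff)
next
  obtain b :: "real^'i" where b: "b \<in> face_simplex c I" "supp b = I"
    using barycenter[OF assms] by blast
  show "{x. (\<Sum>i\<in>UNIV. x $ i) = c \<and> supp x \<subseteq> I} \<subseteq> affine hull (face_simplex c I :: (real^'i) set)"
  proof
    fix y :: "real^'i" assume "y \<in> {x. (\<Sum>i\<in>UNIV. x $ i) = c \<and> supp x \<subseteq> I}"
    then obtain \<epsilon> where \<epsilon>: "0 < \<epsilon>" "b + \<epsilon> *\<^sub>R (y - b) \<in> face_simplex c I"
      using face_simplex_extend[OF b, of y] by auto
    have "y = (1 - 1 / \<epsilon>) *\<^sub>R b + (1 / \<epsilon>) *\<^sub>R (b + \<epsilon> *\<^sub>R (y - b))"
      using \<epsilon>(1) by (simp add: vec_eq_iff field_simps)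
    also have "\<dots> \<in> affine hull (face_simplex c I)"
      using b(1) \<epsilon> by (intro mem_affine[OF affine_affine_hull]) (auto intro: hull_inc)
    finally show "y \<in> affine hull (face_simplex c I)" .
  qed
qed

lemma rel_interior_face_simplex:
  assumes "0 < c" "I \<noteq> {}"
  shows "x \<in> rel_interior (face_simplex c I) \<longleftrightarrow> x \<in> face_simplex c I \<and> supp x = I"
proof
  obtain b :: "real^'a" where b: "b \<in> face_simplex c I" "supp b = I"
    using barycenter[OF assms] by blast
  assume r: "x \<in> rel_interior (face_simplex c I)"
  then have xS: "x \<in> face_simplex c I" using rel_interior_subset by blast
  obtain e where e: "e > 1" "(1 - e) *\<^sub>R b + e *\<^sub>R x \<in> face_simplex c I"
    using r b convex_rel_interior_iff[OF convex_face_simplex, of c I x] by blast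
  have "x $ i \<noteq> 0" if "i \<in> I" for i
  proof
    assume 0: "x $ i = 0"
    have "0 < b $ i" using b that by (auto simp: face_simplex_iff supp_def less_le)
    moreover have "0 \<le> (1 - e) * b $ i"
      using e(2) 0 by (auto simp: face_simplex_def dest: spec[of _ i])
    ultimately show False using e(1) by (simp add: zero_le_mult_iff)
  qed
  then show "x \<in> face_simplex c I \<and> supp x = I"
    using xS by (auto simp: face_simplex_iff supp_def)
next
  assume x: "x \<in> face_simplex c I \<and> supp x = I"
  have "\<exists>e>1. (1 - e) *\<^sub>R y + e *\<^sub>R x \<in> face_simplex c I" if y: "y \<in> face_simplex c I" for y
  proof -
    have "(\<Sum>i\<in>UNIV. (2 *\<^sub>R x - y) $ i) = c" "supp (2 *\<^sub>R x - y) \<subseteq> I"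
      using x y by (auto simp: face_simplex_iff sum_subtractf sum_distrib_left[symmetric] supp_def)
    then obtain \<epsilon> where \<epsilon>: "0 < \<epsilon>" "x + \<epsilon> *\<^sub>R (2 *\<^sub>R x - y - x) \<in> face_simplex c I"
      using face_simplex_extend[of x c I] x by metis
    moreover have "x + \<epsilon> *\<^sub>R (2 *\<^sub>R x - y - x) = (1 - (1 + \<epsilon>)) *\<^sub>R y + (1 + \<epsilon>) *\<^sub>R x"
      by (simp add: vec_eq_iff algebra_simps)
    ultimately show ?thesis by (intro exI[of _ "1 + \<epsilon>"]) simp
  qed
  then show "x \<in> rel_interior (face_simplex c I)"
    using convex_rel_interior_iff[OF convex_face_simplex, of c I x] x by blast
qed

lemma carrier_face_eq:
  assumes "0 < c" "x \<in> clemens_polytope D c"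
  shows "carrier_face D c x = supp x"
  unfolding carrier_face_def
proof (rule the_equality)
  show "supp x \<in> face_sets D \<and> x \<in> rel_interior (face_simplex c (supp x))"
    using assms rel_interior_face_simplex[of c "supp x" x]
    by (auto simp: clemens_polytope_iff face_simplex_iff face_sets_def)
next
  fix I assume "I \<in> face_sets D \<and> x \<in> rel_interior (face_simplex c I)"
  then show "I = supp x"
    using rel_interior_face_simplex[of c I x] assms(1) by (auto simp: face_sets_def)
qed

lemma real_vec_simps [simp]:
  "real_vec w $ i = real_of_int (w $ i)" "real_vec w = 0 \<longleftrightarrow> w = 0" "real_vec (- w) = - real_vec w"
  by (auto simp: real_vec_def vec_eq_iff)

text \<open>Parametrized tropical curves whose edges may have length zero. For points of the polytope, an
  edge lies in a face iff the union of the supports of its ends is the index set of a face.\<close>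

definition weak_curve :: "('i \<Rightarrow> 'p set) \<Rightarrow> real \<Rightarrow> ('i::finite) wgraph \<Rightarrow> (nat \<Rightarrow> real^'i) \<Rightarrow> bool" where
  "weak_curve D c G h \<longleftrightarrow> wgraph_wf G \<and> (\<forall>v\<in>verts G. h v \<in> clemens_polytope D c) \<and>
     (\<forall>e\<in>edges G. \<forall>u v. ends G e = {u, v} \<longrightarrow> supp (h u) \<union> supp (h v) \<in> face_sets D \<and>
        (\<exists>t\<ge>0. h v - h u = t *\<^sub>R real_vec (wt G u e)))"

definition zero_edges :: "('i::finite) wgraph \<Rightarrow> (nat \<Rightarrow> real^'i) \<Rightarrow> nat set" where
  "zero_edges G h = {e \<in> edges G. \<forall>u\<in>ends G e. \<forall>v\<in>ends G e. h u = h v}"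

lemma zero_edges_iff:
  "e \<in> edges G \<Longrightarrow> ends G e = {u, v} \<Longrightarrow> e \<in> zero_edges G h \<longleftrightarrow> h u = h v"
  by (auto simp: zero_edges_def)

lemma param_curve_iff:
  assumes c: "0 < c"
  shows "param_curve D c (G, h) \<longleftrightarrow> weak_curve D c G h \<and> zero_edges G h = {}"
proof -
  let ?P = "\<lambda>e u v. (\<exists>I\<in>face_sets D. closed_segment (h u) (h v) \<subseteq> face_simplex c I) \<and>
        (\<exists>t>0. h v - h u = t *\<^sub>R real_vec (wt G u e))"
  let ?Q = "\<lambda>e u v. supp (h u) \<union> supp (h v) \<in> face_sets D \<and>
        (\<exists>t\<ge>0. h v - h u = t *\<^sub>R real_vec (wt G u e))"
  have PQ: "?P e u v \<longleftrightarrow> ?Q e u v \<and> h u \<noteq> h v"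
    if e: "e \<in> edges G" "ends G e = {u, v}" and wf: "wgraph_wf G"
      and h: "h u \<in> clemens_polytope D c" "h v \<in> clemens_polytope D c" for e u v
  proof -
    have w0: "real_vec (wt G u e) \<noteq> 0" using wf_wt[OF wf e(1), of u] e by simp
    have "(\<exists>I\<in>face_sets D. closed_segment (h u) (h v) \<subseteq> face_simplex c I) \<longleftrightarrow>
        supp (h u) \<union> supp (h v) \<in> face_sets D"
    proof
      assume "\<exists>I\<in>face_sets D. closed_segment (h u) (h v) \<subseteq> face_simplex c I"
      then obtain I where I: "I \<in> face_sets D" "closed_segment (h u) (h v) \<subseteq> face_simplex c I" by blast
      then have "h u \<in> face_simplex c I" "h v \<in> face_simplex c I" by auto
      then have "supp (h u) \<union> supp (h v) \<subseteq> I" "supp (h u) \<noteq> {}"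
        using c supp_nonempty by (auto simp: face_simplex_iff)
      then show "supp (h u) \<union> supp (h v) \<in> face_sets D"
        using face_sets_subset[OF I(1)] by blast
    next
      assume *: "supp (h u) \<union> supp (h v) \<in> face_sets D"
      have "closed_segment (h u) (h v) \<subseteq> face_simplex c (supp (h u) \<union> supp (h v))"
        using h by (intro closed_segment_subset convex_face_simplex)
          (auto simp: face_simplex_iff clemens_polytope_iff[OF c])
      then show "\<exists>I\<in>face_sets D. closed_segment (h u) (h v) \<subseteq> face_simplex c I" using * by blast
    qed
    moreover have "(\<exists>t>0. h v - h u = t *\<^sub>R real_vec (wt G u e)) \<longleftrightarrow>
       (\<exists>t\<ge>0. h v - h u = t *\<^sub>R real_vec (wt G u e)) \<and> h u \<noteq> h v"
    proof
      assume "\<exists>t>0. h v - h u = t *\<^sub>R real_vec (wt G u e)"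
      then obtain t where t: "t > 0" "h v - h u = t *\<^sub>R real_vec (wt G u e)" by blast
      then have "h v - h u \<noteq> 0" using w0 by simp
      then show "(\<exists>t\<ge>0. h v - h u = t *\<^sub>R real_vec (wt G u e)) \<and> h u \<noteq> h v"
        using t by (auto intro!: exI[of _ t])
    next
      assume "(\<exists>t\<ge>0. h v - h u = t *\<^sub>R real_vec (wt G u e)) \<and> h u \<noteq> h v"
      then obtain t where t: "t \<ge> 0" "h v - h u = t *\<^sub>R real_vec (wt G u e)" "h u \<noteq> h v" by blast
      then have "t \<noteq> 0" by auto
      then show "\<exists>t>0. h v - h u = t *\<^sub>R real_vec (wt G u e)" using t by (intro exI[of _ t]) simp
    qed
    ultimately show ?thesis by blast
  qed
  show ?thesis
  proof
    assume p: "param_curve D c (G, h)"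
    then have wf: "wgraph_wf G" and h: "\<forall>v\<in>verts G. h v \<in> clemens_polytope D c"
      and e: "\<And>e u v. e \<in> edges G \<Longrightarrow> ends G e = {u, v} \<Longrightarrow> ?P e u v"
      by (simp_all add: param_curve_def)
    have Q: "?Q e u v \<and> h u \<noteq> h v" if "e \<in> edges G" "ends G e = {u, v}" for e u v
      using PQ[OF that wf] h e[OF that] wf_ends_verts[OF wf that] by blast
    then have "weak_curve D c G h" using wf h by (simp add: weak_curve_def)
    moreover have "e \<notin> zero_edges G h" for e
    proof
      assume z: "e \<in> zero_edges G h"
      then have "e \<in> edges G" by (simp add: zero_edges_def)
      moreover obtain u v where "ends G e = {u, v}" using wf_edgeE[OF wf \<open>e \<in> edges G\<close>] by metis
      ultimately show False using Q zero_edges_iff[of e G u v h] z by blast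
    qed
    ultimately show "weak_curve D c G h \<and> zero_edges G h = {}" by blast
  next
    assume w: "weak_curve D c G h \<and> zero_edges G h = {}"
    then have wf: "wgraph_wf G" and h: "\<forall>v\<in>verts G. h v \<in> clemens_polytope D c"
      and e: "\<And>e u v. e \<in> edges G \<Longrightarrow> ends G e = {u, v} \<Longrightarrow> ?Q e u v"
      by (simp_all add: weak_curve_def)
    have "?P e u v" if "e \<in> edges G" "ends G e = {u, v}" for e u v
      using PQ[OF that wf] h e[OF that] wf_ends_verts[OF wf that] zero_edges_iff[OF that, of h] w by blast
    then show "param_curve D c (G, h)" using wf h by (simp add: param_curve_def)
  qed
qed

lemma weak_curveD:
  assumes "weak_curve D c G h"
  shows "wgraph_wf G" "v \<in> verts G \<Longrightarrow> h v \<in> clemens_polytope D c"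
    "e \<in> edges G \<Longrightarrow> ends G e = {u, v} \<Longrightarrow> supp (h u) \<union> supp (h v) \<in> face_sets D"
    "e \<in> edges G \<Longrightarrow> ends G e = {u, v} \<Longrightarrow> \<exists>t\<ge>0. h v - h u = t *\<^sub>R real_vec (wt G u e)"
  using assms unfolding weak_curve_def by blast+

lemma curve_iso_refl: "curve_iso C C"
  unfolding curve_iso_def
  by (rule exI[of _ "\<lambda>v. v"], rule exI[of _ "\<lambda>v. v"]) (auto simp: wgraph_iso_def bij_betw_def)

lemma curve_iso_sym:
  assumes wf: "wgraph_wf (fst C)" and "curve_iso C C'"
  shows "curve_iso C' C"
proof -
  obtain \<phi> \<psi> where i: "wgraph_iso \<phi> \<psi> (fst C) (fst C')" "\<And>v. v \<in> verts (fst C) \<Longrightarrow> snd C' (\<phi> v) = snd C v"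
    using assms(2) by (auto simp: curve_iso_def)
  obtain \<phi>' \<psi>' where j: "wgraph_iso \<phi>' \<psi>' (fst C') (fst C)" "\<And>v. v \<in> verts (fst C) \<Longrightarrow> \<phi>' (\<phi> v) = v"
    using wgraph_iso_sym[OF wf i(1)] by metis
  have "verts (fst C') = \<phi> ` verts (fst C)" using i(1) by (auto simp: wgraph_iso_def bij_betw_def)
  then have "\<forall>v\<in>verts (fst C'). snd C (\<phi>' v) = snd C' v" using i(2) j(2) by auto
  then show ?thesis using j(1) by (auto simp: curve_iso_def)
qed

lemma curve_iso_trans:
  assumes wf: "wgraph_wf (fst C)" and "curve_iso C C'" "curve_iso C' C''"
  shows "curve_iso C C''"
proof -
  obtain \<phi> \<psi> where i: "wgraph_iso \<phi> \<psi> (fst C) (fst C')" "\<And>v. v \<in> verts (fst C) \<Longrightarrow> snd C' (\<phi> v) = snd C v"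
    using assms(2) by (auto simp: curve_iso_def)
  obtain \<phi>' \<psi>' where j: "wgraph_iso \<phi>' \<psi>' (fst C') (fst C'')" "\<And>v. v \<in> verts (fst C') \<Longrightarrow> snd C'' (\<phi>' v) = snd C' v"
    using assms(3) by (auto simp: curve_iso_def)
  have "verts (fst C') = \<phi> ` verts (fst C)" using i(1) by (auto simp: wgraph_iso_def bij_betw_def)
  then have "\<forall>v\<in>verts (fst C). snd C'' ((\<phi>' \<circ> \<phi>) v) = snd C v" using i(2) j(2) by auto
  then show ?thesis using wgraph_iso_trans[OF wf i(1) j(1)] unfolding curve_iso_def by blast
qed

section \<open>Removal of a vertex of degree two as a contraction\<close>

text \<open>A contraction together with the positions of the vertices. The set \<open>R\<close> consists of vertices whose
  positions are forgotten: a removable vertex takes the position of the neighbour with which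
  it is merged, whereas every vertex of \<open>H\<close> comes from a vertex outside \<open>R\<close>.\<close>

definition curve_contraction :: "(nat \<Rightarrow> nat) \<Rightarrow> (nat \<Rightarrow> nat) \<Rightarrow> ('i::finite) wgraph \<Rightarrow> (nat \<Rightarrow> real^'i) \<Rightarrow>
    nat set \<Rightarrow> nat set \<Rightarrow> 'i wgraph \<Rightarrow> (nat \<Rightarrow> real^'i) \<Rightarrow> bool" where
  "curve_contraction \<phi> \<psi> G h Z R H k \<longleftrightarrow> contraction \<phi> \<psi> G Z H \<and>
     \<phi> ` (verts G - R) = verts H \<and> (\<forall>v\<in>verts G - R. k (\<phi> v) = h v)"

lemma curve_contraction_compose:
  assumes wf: "wgraph_wf G" and 1: "curve_contraction \<phi> \<psi> G h Z R H k"
    and 2: "curve_contraction \<phi>' \<psi>' H k Y S K l"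
  shows "curve_contraction (\<phi>' \<circ> \<phi>) (\<psi>' \<circ> \<psi>) G h (Z \<union> {e \<in> edges G - Z. \<psi> e \<in> Y})
    (R \<union> {v \<in> verts G. \<phi> v \<in> S}) K l"
proof -
  let ?R = "R \<union> {v \<in> verts G. \<phi> v \<in> S}"
  have im: "\<phi> ` (verts G - ?R) = verts H - S"
  proof -
    have "\<phi> ` (verts G - ?R) = \<phi> ` (verts G - R) - S" by blast
    then show ?thesis using 1 by (simp add: curve_contraction_def)
  qed
  have "(\<phi>' \<circ> \<phi>) ` (verts G - ?R) = verts K"
    using 2 im by (simp only: curve_contraction_def image_comp[symmetric])
  moreover have "\<forall>v\<in>verts G - ?R. l ((\<phi>' \<circ> \<phi>) v) = h v"
  proof
    fix v assume v: "v \<in> verts G - ?R"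
    then have "\<phi> v \<in> verts H - S" using im by blast
    then have "l (\<phi>' (\<phi> v)) = k (\<phi> v)" using 2 by (simp add: curve_contraction_def)
    also have "\<dots> = h v" using 1 v by (simp add: curve_contraction_def)
    finally show "l ((\<phi>' \<circ> \<phi>) v) = h v" by simp
  qed
  ultimately show ?thesis
    using contraction_compose[OF wf, of \<phi> \<psi> Z H \<phi>' \<psi>' Y K] 1 2
    by (simp add: curve_contraction_def)
qed

lemma curve_contraction_unique:
  assumes wf: "wgraph_wf G" and 1: "curve_contraction \<phi> \<psi> G h Z R H k"
    and 2: "curve_contraction \<phi>' \<psi>' G h Z R H' k'"
  shows "curve_iso (H, k) (H', k')"
proof -
  obtain \<theta> \<xi> where i: "wgraph_iso \<theta> \<xi> H H'" "\<And>v. v \<in> verts G \<Longrightarrow> \<theta> (\<phi> v) = \<phi>' v"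
    using contraction_unique[OF wf, of \<phi> \<psi> Z H \<phi>' \<psi>' H'] 1 2 by (auto simp: curve_contraction_def)
  have "k' (\<theta> x) = k x" if "x \<in> verts H" for x
  proof -
    have "x \<in> \<phi> ` (verts G - R)" using that 1 by (simp add: curve_contraction_def)
    then obtain v where v: "v \<in> verts G - R" "x = \<phi> v" by blast
    then show ?thesis using 1 2 i(2) by (simp add: curve_contraction_def)
  qed
  then show ?thesis using i(1) unfolding curve_iso_def by auto
qed

lemma curve_contraction_iso:
  assumes wf: "wgraph_wf G" and i: "wgraph_iso \<phi> \<psi> G H" and k: "\<And>v. v \<in> verts G \<Longrightarrow> k (\<phi> v) = h v"
  shows "curve_contraction \<phi> \<psi> G h {} {} H k"
  using contraction_iso[OF wf i] contraction_verts[OF wf contraction_iso[OF wf i]] k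
  by (auto simp: curve_contraction_def)

lemma curve_iso_contraction:
  assumes "wgraph_wf G" "curve_iso (G, h) (H, k)"
  obtains \<phi> \<psi> where "wgraph_iso \<phi> \<psi> G H" "curve_contraction \<phi> \<psi> G h {} {} H k"
  using assms curve_contraction_iso[OF assms(1)] by (auto simp: curve_iso_def)

lemma removable_contraction:
  assumes wf: "wgraph_wf G" and c: "contraction \<phi> \<psi> G Z H"
    and rem: "removable G v" and Z: "incident G v \<inter> Z = {}"
  shows "removable H (\<phi> v)" "fiber \<phi> G (\<phi> v) = {v}" "incident H (\<phi> v) = \<psi> ` incident G v"
proof -
  have v: "v \<in> verts G" using rem by (simp add: removable_def)
  have "w = v" if "(v, w) \<in> joined (ends G) Z" for w
    using that
  proof (induction rule: joined_induct)
    case (step x y e)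
    then have "e \<in> incident G v" using contraction_subset[OF wf c] by (auto simp: incident_def)
    then show ?case using Z step by auto
  qed simp
  then have eqv: "w = v" if "w \<in> verts G" "\<phi> w = \<phi> v" for w
    using contraction_joined[OF wf c v that(1)] that(2) by metis
  then show fib: "fiber \<phi> G (\<phi> v) = {v}" using v by (auto simp: fiber_def)
  have "{e \<in> edges G - Z. \<phi> v \<in> \<phi> ` ends G e} = incident G v"
  proof (intro set_eqI iffI)
    fix e assume "e \<in> {e \<in> edges G - Z. \<phi> v \<in> \<phi> ` ends G e}"
    then obtain w where "e \<in> edges G" "w \<in> ends G e" "\<phi> w = \<phi> v" by auto
    then show "e \<in> incident G v" using eqv[of w] wf_ends(1)[OF wf] by (auto simp: incident_def)
  qed (use Z in \<open>auto simp: incident_def\<close>)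
  then show inc: "incident H (\<phi> v) = \<psi> ` incident G v"
    using contraction_incident[OF wf c] by simp
  have "inj_on \<psi> (incident G v)"
    using contraction_bij[OF wf c] Z by (auto simp: bij_betw_def inj_on_def incident_def)
  then have "card (incident H (\<phi> v)) = card (incident G v)"
    unfolding inc by (rule card_image)
  moreover have "{e \<in> Z. \<phi> ` ends G e = {\<phi> v}} = {}"
  proof -
    have False if e: "e \<in> Z" "\<phi> ` ends G e = {\<phi> v}" for e
    proof -
      have eG: "e \<in> edges G" using e contraction_subset[OF wf c] by auto
      obtain w where w: "w \<in> ends G e" "w \<in> verts G" using wf_edgeE[OF wf eG] by (metis insertI1)
      then have "\<phi> w = \<phi> v" using e by auto
      then have "v \<in> ends G e" using eqv w by metis
      then show False using eG e Z by (auto simp: incident_def)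
    qed
    then show ?thesis by auto
  qed
  moreover note * = calculation
  have vH: "\<phi> v \<in> verts H" using v contraction_verts[OF wf c] by simp
  have "int (gen H (\<phi> v)) = 0"
    using contraction_gen[OF wf c vH] rem unfolding removable_def fib *(2) by simp
  moreover have "card (incident H (\<phi> v)) = 2"
    using *(1) rem unfolding removable_def by simp
  moreover have "vsum H (\<phi> v) = 0"
    using contraction_vsum[OF wf c] fib rem unfolding removable_def by simp
  moreover have "\<phi> v \<notin> set (marks H)"
  proof
    assume "\<phi> v \<in> set (marks H)"
    then obtain m where m: "m \<in> set (marks G)" "\<phi> m = \<phi> v"
      unfolding contraction_marks[OF wf c] by auto
    then have "m = v" using eqv wf_marks[OF wf] by blast
    then show False using m rem unfolding removable_def by blast
  qed
  ultimately show "removable H (\<phi> v)" using vH by (simp add: removable_def)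
qed

text \<open>Removal of \<open>v\<close>, described through contractions. That both edges at \<open>v\<close> are available is what makes two
  removals, or a removal and a contraction, commute.\<close>

definition smooths :: "('i::finite) wgraph \<Rightarrow> nat \<Rightarrow> 'i wgraph \<Rightarrow> bool" where
  "smooths G v H \<longleftrightarrow> removable G v \<and> verts H = verts G - {v} \<and>
     (\<forall>e\<in>incident G v. \<exists>\<phi> \<psi>. contraction \<phi> \<psi> G {e} H \<and> (\<forall>w\<in>verts G - {v}. \<phi> w = w))"

lemma smoothsE:
  assumes "smooths G v H" "e \<in> incident G v"
  obtains \<phi> \<psi> where "contraction \<phi> \<psi> G {e} H" "\<forall>w\<in>verts G - {v}. \<phi> w = w"
    "\<forall>h. curve_contraction \<phi> \<psi> G h {e} {v} H h"
proof -
  obtain \<phi> \<psi> where c: "contraction \<phi> \<psi> G {e} H" "\<forall>w\<in>verts G - {v}. \<phi> w = w"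
    using assms by (auto simp: smooths_def)
  then have "\<phi> ` (verts G - {v}) = verts H" using assms(1) by (auto simp: smooths_def)
  then have "curve_contraction \<phi> \<psi> G h {e} {v} H h" for h
    using c by (simp add: curve_contraction_def)
  then show thesis using c by (intro that[of \<phi> \<psi>]) auto
qed

lemma removable_incident:
  assumes wf: "wgraph_wf G" and rem: "removable G v" and e: "e \<in> incident G v"
  obtains f u w where "incident G v = {f, e}" "f \<noteq> e" "ends G f = {v, u}" "ends G e = {v, w}"
    "u \<noteq> v" "w \<noteq> v"
proof -
  obtain a b where "incident G v = {a, b}" "a \<noteq> b"
    using rem unfolding removable_def card_2_iff by blast
  then obtain f where f: "incident G v = {f, e}" "f \<noteq> e"
    using e by (cases "e = a") auto
  have "\<exists>u. ends G x = {v, u} \<and> u \<noteq> v" if "x \<in> incident G v" for x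
  proof -
    have x: "x \<in> edges G" "v \<in> ends G x" using that by (auto simp: incident_def)
    then show ?thesis using wf_ends(2)[OF wf x(1)] by (auto simp: card_2_iff)
  qed
  then show thesis using f that by (metis insertI1 insertI2)
qed

lemma smoothsI:
  assumes wf: "wgraph_wf G" and u12: "u1 \<noteq> u2"
    and 1: "removable G v" "incident G v = {e1, e2}" "e1 \<noteq> e2" "ends G e1 = {v, u1}" "ends G e2 = {v, u2}"
    and H: "H = G\<lparr>verts := verts G - {v}, edges := edges G - {e2}, ends := (ends G)(e1 := {u1, u2}),
          wt := (wt G)(u2 := (wt G u2)(e1 := wt G u2 e2))\<rparr>"
  shows "smooths G v H"
  unfolding smooths_def
proof (intro conjI ballI)
  note c = smooth_step_contractions[OF wf u12 1 H]
  fix e assume "e \<in> incident G v"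
  then consider "e = e1" | "e = e2" using 1 by auto
  then show "\<exists>\<phi> \<psi>. contraction \<phi> \<psi> G {e} H \<and> (\<forall>w\<in>verts G - {v}. \<phi> w = w)"
  proof cases
    case 1
    then show ?thesis
      using c(2) by (intro exI[of _ "id(v := u1)"] exI[of _ "id(e2 := e1)"]) simp
  next
    case 2
    then show ?thesis using c(1) by (intro exI[of _ "id(v := u2)"] exI[of _ id]) simp
  qed
qed (use 1 in \<open>auto simp: H\<close>)

lemma smooth_step_smooths:
  assumes wf: "wgraph_wf G" and s: "smooth_step G H"
    and nb: "wgraph_wf H \<or> (\<forall>v e f. removable G v \<and> e \<in> incident G v \<and> f \<in> incident G v \<and> e \<noteq> f \<longrightarrow> ends G e \<noteq> ends G f)"
  obtains v where "smooths G v H"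
  using s
proof cases
  case (1 v e1 e2 u1 u2)
  have "u1 \<noteq> u2"
    using nb
  proof
    assume wfH: "wgraph_wf H"
    have "e1 \<in> edges H" "ends H e1 = {u1, u2}" using 1 by (auto simp: incident_def)
    then show ?thesis using wf_ends_neq[OF wfH] by blast
  next
    assume "\<forall>v e f. removable G v \<and> e \<in> incident G v \<and> f \<in> incident G v \<and> e \<noteq> f \<longrightarrow> ends G e \<noteq> ends G f"
    then have "ends G e1 \<noteq> ends G e2" using 1(1,2,3) by blast
    then show ?thesis using 1(4,5) by auto
  qed
  from smoothsI[OF wf this 1(1-6)] show thesis by (rule that)
qed

lemma smooth_step_exists:
  assumes wf: "wgraph_wf G" and rem: "removable G v"
    and nb: "\<And>e f. e \<in> incident G v \<Longrightarrow> f \<in> incident G v \<Longrightarrow> e \<noteq> f \<Longrightarrow> ends G e \<noteq> ends G f"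
  obtains H where "smooth_step G H" "smooths G v H"
proof -
  obtain e2 where e2: "e2 \<in> incident G v"
    using rem by (fastforce simp: removable_def card_2_iff)
  obtain e1 u1 u2 where 1: "incident G v = {e1, e2}" "e1 \<noteq> e2" "ends G e1 = {v, u1}" "ends G e2 = {v, u2}"
    by (rule removable_incident[OF wf rem e2])
  have u12: "u1 \<noteq> u2" using nb[of e1 e2] 1 by auto
  show thesis
    using that[OF smooth_step.intros[OF rem 1 refl] smoothsI[OF wf u12 rem 1 refl]] .
qed

lemma smooths_wf: "wgraph_wf G \<Longrightarrow> smooths G v H \<Longrightarrow> wgraph_wf H"
proof -
  assume wf: "wgraph_wf G" and s: "smooths G v H"
  then obtain e where "e \<in> incident G v" by (fastforce simp: smooths_def removable_def card_2_iff)
  then show ?thesis using smoothsE[OF s] contraction_wf[OF wf] by metis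
qed

lemma weak_curveI:
  assumes wf: "wgraph_wf G" and h: "\<And>v. v \<in> verts G \<Longrightarrow> h v \<in> clemens_polytope D c"
    and e: "\<And>e. e \<in> edges G \<Longrightarrow> \<exists>u v. ends G e = {u, v} \<and> supp (h u) \<union> supp (h v) \<in> face_sets D \<and>
        (\<exists>t\<ge>0. h v - h u = t *\<^sub>R real_vec (wt G u e))"
  shows "weak_curve D c G h"
  unfolding weak_curve_def
proof (intro conjI ballI allI impI)
  fix e u v assume eG: "e \<in> edges G" and en: "ends G e = {u, v}"
  obtain a b t where ab: "ends G e = {a, b}" "supp (h a) \<union> supp (h b) \<in> face_sets D"
    "t \<ge> 0" "h b - h a = t *\<^sub>R real_vec (wt G a e)"
    using e[OF eG] by blast
  have "real_vec (wt G b e) = - real_vec (wt G a e)"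
    using wf_opp[OF wf eG ab(1)] by simp
  then have ba: "h a - h b = t *\<^sub>R real_vec (wt G b e)"
    using ab(4) by (simp add: algebra_simps)
  have "u = a \<and> v = b \<or> u = b \<and> v = a" using en ab(1) by (auto simp: doubleton_eq_iff)
  then show "supp (h u) \<union> supp (h v) \<in> face_sets D" "\<exists>t\<ge>0. h v - h u = t *\<^sub>R real_vec (wt G u e)"
    using ab ba by (auto simp: Un_commute)
qed (use assms in auto)

lemma weak_curve_contraction:
  assumes w: "weak_curve D c G h" and cc: "curve_contraction \<phi> \<psi> G h Z {} H k"
  shows "weak_curve D c H k"
proof (rule weak_curveI)
  note wf = weak_curveD(1)[OF w]
  have con: "contraction \<phi> \<psi> G Z H" and k: "\<And>v. v \<in> verts G \<Longrightarrow> k (\<phi> v) = h v"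
    using cc by (auto simp: curve_contraction_def)
  show "wgraph_wf H" by (rule contraction_wf[OF wf con])
  show "k x \<in> clemens_polytope D c" if "x \<in> verts H" for x
    using that weak_curveD(2)[OF w] k by (auto simp: contraction_verts[OF wf con])
  fix f assume "f \<in> edges H"
  then obtain e where e: "e \<in> edges G" "e \<notin> Z" "f = \<psi> e" by (rule contraction_edgeE[OF wf con])
  obtain u v where uv: "ends G e = {u, v}" "u \<in> verts G" "v \<in> verts G"
    using wf_edgeE[OF wf e(1)] by metis
  have "ends H f = {\<phi> u, \<phi> v}" "wt H (\<phi> u) f = wt G u e"
    using contraction_ends[OF wf con, of e] contraction_wt[OF wf con, of e u] e uv by auto
  then show "\<exists>x y. ends H f = {x, y} \<and> supp (k x) \<union> supp (k y) \<in> face_sets D \<and>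
        (\<exists>t\<ge>0. k y - k x = t *\<^sub>R real_vec (wt H x f))"
    using weak_curveD(3,4)[OF w e(1) uv(1)] k uv by (intro exI[of _ "\<phi> u"] exI[of _ "\<phi> v"]) auto
qed

lemma zero_edges_subset: "zero_edges G h \<subseteq> edges G"
  by (auto simp: zero_edges_def)

lemma zero_edges_contraction:
  assumes wf: "wgraph_wf G" and cc: "curve_contraction \<phi> \<psi> G h Z {} H k" and Z: "Z \<subseteq> zero_edges G h"
  shows "zero_edges G h = Z \<union> {e \<in> edges G - Z. \<psi> e \<in> zero_edges H k}"
proof -
  have con: "contraction \<phi> \<psi> G Z H" and k: "\<And>v. v \<in> verts G \<Longrightarrow> k (\<phi> v) = h v"
    using cc by (auto simp: curve_contraction_def)
  have "e \<in> zero_edges G h \<longleftrightarrow> \<psi> e \<in> zero_edges H k" if e: "e \<in> edges G - Z" for e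
  proof -
    have eG: "e \<in> edges G" using e by simp
    obtain u v where uv: "ends G e = {u, v}" "u \<in> verts G" "v \<in> verts G"
      using wf_edgeE[OF wf eG] by metis
    have "ends H (\<psi> e) = {\<phi> u, \<phi> v}" "\<psi> e \<in> edges H"
      using contraction_ends[OF wf con, of e] contraction_edge_in[OF wf con, of e] e uv by auto
    then show ?thesis using zero_edges_iff[OF eG uv(1)] zero_edges_iff[of "\<psi> e" H "\<phi> u" "\<phi> v"] k uv by simp
  qed
  then show ?thesis using Z zero_edges_subset[of G h] by blast
qed

lemma smooths_edges:
  assumes wf: "wgraph_wf G" and s: "smooths G v H" and con: "contraction \<phi> \<psi> G {e1} H"
    and id: "\<forall>w\<in>verts G - {v}. \<phi> w = w" and e1: "e1 \<in> incident G v"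
  obtains e2 u1 u2 where "incident G v = {e1, e2}" "e1 \<noteq> e2" "ends G e1 = {v, u1}" "ends G e2 = {v, u2}"
    "u1 \<noteq> v" "u2 \<noteq> v" "wt G v e1 = wt G u2 e2"
    "ends H (\<psi> e2) = {u1, u2}" "wt H u2 (\<psi> e2) = wt G u2 e2" "\<psi> e2 \<in> edges H"
    "\<forall>f\<in>edges G. f \<noteq> e1 \<and> f \<noteq> e2 \<longrightarrow> v \<notin> ends G f \<and> ends H (\<psi> f) = ends G f \<and> \<psi> f \<in> edges H \<and>
       (\<forall>x\<in>ends G f. wt H x (\<psi> f) = wt G x f)"
proof -
  have rem: "removable G v" using s by (simp add: smooths_def)
  obtain e2 u2 u1 where *: "incident G v = {e2, e1}" "e2 \<noteq> e1" "ends G e2 = {v, u2}" "ends G e1 = {v, u1}"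
    "u2 \<noteq> v" "u1 \<noteq> v"
    by (rule removable_incident[OF wf rem e1])
  have E: "e1 \<in> edges G" "e2 \<in> edges G" using * by (auto simp: incident_def)
  have V: "u1 \<in> verts G" "u2 \<in> verts G" using wf_ends_verts[OF wf] E * by blast+
  have w1: "wt G u2 e2 = - wt G v e2" using wf_opp[OF wf E(2) *(3)] .
  have "wt G v e1 + wt G v e2 = 0" using rem * by (simp add: removable_def vsum_def add.commute)
  then have w2: "wt G v e1 = wt G u2 e2" using w1 by (simp add: add_eq_0_iff2)
  have "\<phi> ` ends G e1 = {\<phi> u1}" using contraction_zero_edge[OF wf con, of e1 u1] * by auto
  then have \<phi>: "\<phi> v = u1" "\<phi> u1 = u1" "\<phi> u2 = u2" using * id V by auto
  have 2: "ends H (\<psi> e2) = {u1, u2}" "wt H u2 (\<psi> e2) = wt G u2 e2" "\<psi> e2 \<in> edges H"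
    using contraction_ends[OF wf con, of e2] contraction_wt[OF wf con, of e2 u2]
      contraction_edge_in[OF wf con, of e2] E * \<phi> by auto
  have "v \<notin> ends G f \<and> ends H (\<psi> f) = ends G f \<and> \<psi> f \<in> edges H \<and> (\<forall>x\<in>ends G f. wt H x (\<psi> f) = wt G x f)"
    if f: "f \<in> edges G" "f \<noteq> e1" "f \<noteq> e2" for f
  proof -
    have v: "v \<notin> ends G f" using f *(1) by (auto simp: incident_def)
    then have "\<phi> x = x" if "x \<in> ends G f" for x using id wf_ends(1)[OF wf f(1)] that by blast
    then show ?thesis
      using contraction_ends[OF wf con, of f] contraction_wt[OF wf con, of f]
        contraction_edge_in[OF wf con, of f] f v by force
  qed
  then have oth: "\<forall>f\<in>edges G. f \<noteq> e1 \<and> f \<noteq> e2 \<longrightarrow> v \<notin> ends G f \<and> ends H (\<psi> f) = ends G f \<and> \<psi> f \<in> edges H \<and>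
       (\<forall>x\<in>ends G f. wt H x (\<psi> f) = wt G x f)" by blast
  have "incident G v = {e1, e2}" "e1 \<noteq> e2" using * by auto
  from that[OF this *(4) *(3) *(6) *(5) w2 2 oth] show thesis .
qed

text \<open>Both edges at a removable vertex \<open>v\<close> are parallel to the same vector, so that every
  coordinate vanishing at \<open>h v\<close> vanishes along both edges: the glued edge lies in a face.\<close>

lemma weak_smooths:
  assumes c: "0 < c" and w: "weak_curve D c G h" and s: "smooths G v H"
  shows "weak_curve D c H h"
    and "\<lbrakk>contraction \<phi> \<psi> G {e} H; \<forall>w\<in>verts G - {v}. \<phi> w = w; e \<in> incident G v;
          incident G v \<inter> zero_edges G h = {}\<rbrakk> \<Longrightarrow>
        {f \<in> edges G - {e}. \<psi> f \<in> zero_edges H h} = zero_edges G h"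
proof -
  note wf = weak_curveD(1)[OF w]
  have rem: "removable G v" and vH: "verts H = verts G - {v}" using s by (auto simp: smooths_def)
  have wfH: "wgraph_wf H" by (rule smooths_wf[OF wf s])
  have key: "\<exists>e2 u1 u2 t1 t2. incident G v = {e1, e2} \<and> e1 \<noteq> e2 \<and> ends G e1 = {v, u1} \<and> ends G e2 = {v, u2} \<and>
      t1 \<ge> 0 \<and> t2 \<ge> 0 \<and> h u1 - h v = t1 *\<^sub>R real_vec (wt G u2 e2) \<and> h v - h u2 = t2 *\<^sub>R real_vec (wt G u2 e2) \<and>
      ends H (\<psi> e2) = {u1, u2} \<and> wt H u2 (\<psi> e2) = wt G u2 e2 \<and> \<psi> e2 \<in> edges H \<and>
      (\<forall>f\<in>edges G. f \<noteq> e1 \<and> f \<noteq> e2 \<longrightarrow> v \<notin> ends G f \<and> ends H (\<psi> f) = ends G f \<and> \<psi> f \<in> edges H \<and>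
         (\<forall>x\<in>ends G f. wt H x (\<psi> f) = wt G x f))"
    if con: "contraction \<phi> \<psi> G {e1} H" "\<forall>w\<in>verts G - {v}. \<phi> w = w" "e1 \<in> incident G v" for \<phi> \<psi> e1
  proof -
    obtain e2 u1 u2 where *: "incident G v = {e1, e2}" "e1 \<noteq> e2" "ends G e1 = {v, u1}" "ends G e2 = {v, u2}"
      "u1 \<noteq> v" "u2 \<noteq> v" "wt G v e1 = wt G u2 e2"
      "ends H (\<psi> e2) = {u1, u2}" "wt H u2 (\<psi> e2) = wt G u2 e2" "\<psi> e2 \<in> edges H"
      "\<forall>f\<in>edges G. f \<noteq> e1 \<and> f \<noteq> e2 \<longrightarrow> v \<notin> ends G f \<and> ends H (\<psi> f) = ends G f \<and> \<psi> f \<in> edges H \<and>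
         (\<forall>x\<in>ends G f. wt H x (\<psi> f) = wt G x f)"
      by (rule smooths_edges[OF wf s con])
    have E: "e1 \<in> edges G" "e2 \<in> edges G" using *(1) by (auto simp: incident_def)
    obtain t1 where t1: "t1 \<ge> 0" "h u1 - h v = t1 *\<^sub>R real_vec (wt G u2 e2)"
      using weak_curveD(4)[OF w E(1) *(3)] *(7) by auto
    have "ends G e2 = {u2, v}" using *(4) by auto
    then obtain t2 where t2: "t2 \<ge> 0" "h v - h u2 = t2 *\<^sub>R real_vec (wt G u2 e2)"
      using weak_curveD(4)[OF w E(2)] by blast
    show ?thesis
      by (rule exI[of _ e2], rule exI[of _ u1], rule exI[of _ u2], rule exI[of _ t1], rule exI[of _ t2])
        (intro conjI *(1-4) *(8-11) t1 t2)
  qed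
  show "weak_curve D c H h"
  proof (rule weak_curveI)
    show "wgraph_wf H" by (rule wfH)
    show "h x \<in> clemens_polytope D c" if "x \<in> verts H" for x
      using weak_curveD(2)[OF w] that vH by auto
    obtain e1 where e1: "e1 \<in> incident G v"
      using rem by (fastforce simp: removable_def card_2_iff)
    obtain \<phi> \<psi> where con: "contraction \<phi> \<psi> G {e1} H" "\<forall>w\<in>verts G - {v}. \<phi> w = w"
      "\<forall>h. curve_contraction \<phi> \<psi> G h {e1} {v} H h"
      by (rule smoothsE[OF s e1])
    obtain e2 u1 u2 t1 t2 where *: "incident G v = {e1, e2}" "e1 \<noteq> e2" "ends G e1 = {v, u1}" "ends G e2 = {v, u2}"
      "t1 \<ge> 0" "t2 \<ge> 0" "h u1 - h v = t1 *\<^sub>R real_vec (wt G u2 e2)" "h v - h u2 = t2 *\<^sub>R real_vec (wt G u2 e2)"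
      "ends H (\<psi> e2) = {u1, u2}" "wt H u2 (\<psi> e2) = wt G u2 e2"
      and oth: "\<forall>f\<in>edges G. f \<noteq> e1 \<and> f \<noteq> e2 \<longrightarrow> v \<notin> ends G f \<and> ends H (\<psi> f) = ends G f \<and> \<psi> f \<in> edges H \<and>
         (\<forall>x\<in>ends G f. wt H x (\<psi> f) = wt G x f)"
      using key[OF con(1,2) e1] by (elim exE conjE) (rule that; assumption)
    have E: "e1 \<in> edges G" "e2 \<in> edges G" using * by (auto simp: incident_def)
    have V: "u1 \<in> verts G" "u2 \<in> verts G" "v \<in> verts G" using wf_ends_verts[OF wf] E * by blast+
    fix f assume "f \<in> edges H"
    then obtain e where e: "e \<in> edges G" "e \<notin> {e1}" "f = \<psi> e" by (rule contraction_edgeE[OF wf con(1)])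
    show "\<exists>x y. ends H f = {x, y} \<and> supp (h x) \<union> supp (h y) \<in> face_sets D \<and>
        (\<exists>t\<ge>0. h y - h x = t *\<^sub>R real_vec (wt H x f))"
    proof (cases "e = e2")
      case False
      obtain a b where "ends G e = {a, b}" using wf_edgeE[OF wf e(1)] by metis
      then show ?thesis
        using oth e False weak_curveD(3,4)[OF w e(1), of a b] by (intro exI[of _ a] exI[of _ b]) auto
    next
      case True
      have dir: "h u1 - h u2 = (t1 + t2) *\<^sub>R real_vec (wt H u2 f)"
        using *(7,8,10) e(3) True by (simp add: algebra_simps)
      have F: "supp (h v) \<union> supp (h u1) \<in> face_sets D" "supp (h v) \<union> supp (h u2) \<in> face_sets D"
        using weak_curveD(3)[OF w E(1) *(3)] weak_curveD(3)[OF w E(2) *(4)] by auto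
      have nn: "0 \<le> h x $ i" if "x \<in> verts G" for x i
        using weak_curveD(2)[OF w that] clemens_polytope_iff[OF c] by blast
      have "supp (h u2) \<union> supp (h u1) \<in> face_sets D"
      proof (cases "t1 = 0 \<or> t2 = 0")
        case True
        then have "h u1 = h v \<or> h v = h u2" using * by auto
        then show ?thesis using F by (auto simp: Un_commute)
      next
        case False
        then have t: "0 < t1" "0 < t2" using * by auto
        have "h u1 $ i = 0" if "h v $ i = 0" for i
        proof -
          have "h u1 $ i = t1 * real_of_int (wt G u2 e2 $ i)" "- h u2 $ i = t2 * real_of_int (wt G u2 e2 $ i)"
            using arg_cong[OF *(7), of "\<lambda>x. x $ i"] arg_cong[OF *(8), of "\<lambda>x. x $ i"] that by simp_all
          moreover have "0 \<le> h u1 $ i" "0 \<le> h u2 $ i" using nn V by auto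
          ultimately show ?thesis
            using t by (smt (verit) mult_pos_pos mult_pos_neg mult_eq_0_iff)
        qed
        then have "supp (h u1) \<subseteq> supp (h v)" by (auto simp: supp_def)
        moreover have "supp (h u1) \<noteq> {}"
          using weak_curveD(2)[OF w V(1)] clemens_polytope_iff[OF c] by (auto simp: face_sets_def)
        ultimately show ?thesis
          using face_sets_subset[OF F(2), of "supp (h u2) \<union> supp (h u1)"] by blast
      qed
      moreover have "ends H f = {u2, u1}" using *(9) e(3) True by (simp add: insert_commute)
      moreover have "0 \<le> t1 + t2" using *(5,6) by simp
      ultimately show ?thesis using dir by blast
    qed
  qed
  assume con: "contraction \<phi> \<psi> G {e} H" "\<forall>w\<in>verts G - {v}. \<phi> w = w" "e \<in> incident G v"
    and nz: "incident G v \<inter> zero_edges G h = {}"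
  obtain e2 u1 u2 t1 t2 where *: "incident G v = {e, e2}" "e \<noteq> e2" "ends G e = {v, u1}" "ends G e2 = {v, u2}"
    "t1 \<ge> 0" "t2 \<ge> 0" "h u1 - h v = t1 *\<^sub>R real_vec (wt G u2 e2)" "h v - h u2 = t2 *\<^sub>R real_vec (wt G u2 e2)"
    "ends H (\<psi> e2) = {u1, u2}" "\<psi> e2 \<in> edges H"
    and oth: "\<forall>f\<in>edges G. f \<noteq> e \<and> f \<noteq> e2 \<longrightarrow> v \<notin> ends G f \<and> ends H (\<psi> f) = ends G f \<and> \<psi> f \<in> edges H \<and>
       (\<forall>x\<in>ends G f. wt H x (\<psi> f) = wt G x f)"
    using key[OF con] by (elim exE conjE) (rule that; assumption)
  have E: "e \<in> edges G" "e2 \<in> edges G" using * by (auto simp: incident_def)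
  have "h v \<noteq> h u1" "h v \<noteq> h u2"
    using nz *(1) zero_edges_iff[OF E(1) *(3), of h] zero_edges_iff[OF E(2) *(4), of h] by auto
  then have "t1 \<noteq> 0" "t2 \<noteq> 0" using * by auto
  then have "t1 + t2 \<noteq> 0" using *(5,6) by linarith
  moreover have "h u1 - h u2 = (t1 + t2) *\<^sub>R real_vec (wt G u2 e2)"
    using *(7,8) by (simp add: algebra_simps)
  moreover have "wt G u2 e2 \<noteq> 0" using wf_wt[OF wf E(2), of u2] * by auto
  ultimately have "h u1 \<noteq> h u2" by auto
  then have "\<psi> e2 \<notin> zero_edges H h" using zero_edges_iff[OF *(10,9)] by simp
  moreover have "e \<notin> zero_edges G h" "e2 \<notin> zero_edges G h" using nz * by auto
  moreover have "\<psi> f \<in> zero_edges H h \<longleftrightarrow> f \<in> zero_edges G h" if "f \<in> edges G" "f \<noteq> e" "f \<noteq> e2" for f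
    using oth that by (auto simp: zero_edges_def)
  ultimately show "{f \<in> edges G - {e}. \<psi> f \<in> zero_edges H h} = zero_edges G h"
    using zero_edges_subset[of G h] by blast
qed

section \<open>Uniqueness of simplifications and of normal forms\<close>

text \<open>The curve \<open>(K, k)\<close> is the value of the attaching map at \<open>(G, h)\<close>, up to isomorphism.\<close>

definition normal_form :: "('i::finite) wgraph \<Rightarrow> (nat \<Rightarrow> real^'i) \<Rightarrow> 'i wgraph \<Rightarrow> (nat \<Rightarrow> real^'i) \<Rightarrow> bool" where
  "normal_form G h K k \<longleftrightarrow>
     (\<exists>\<phi> \<psi> G'. curve_contraction \<phi> \<psi> G h (zero_edges G h) {} G' k \<and> simplification G' K)"

context
  fixes D :: "'i::finite \<Rightarrow> 'p set" and c :: real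
  assumes c: "0 < c"
begin

lemma param_curve_wf: "param_curve D c (G, h) \<Longrightarrow> wgraph_wf G"
  by (simp add: param_curve_def)

text \<open>The two edges leave \<open>v\<close> in opposite directions, so they cannot end at the same point.\<close>

lemma param_no_bigon:
  assumes p: "param_curve D c (G, h)" and rem: "removable G v"
    and ef: "e \<in> incident G v" "f \<in> incident G v" "e \<noteq> f"
  shows "ends G e \<noteq> ends G f"
proof
  assume eq: "ends G e = ends G f"
  note wf = param_curve_wf[OF p]
  have w: "weak_curve D c G h" and z: "zero_edges G h = {}" using p param_curve_iff[OF c] by auto
  have E: "e \<in> edges G" "f \<in> edges G" using ef by (auto simp: incident_def)
  obtain g u w' where *: "incident G v = {g, e}" "g \<noteq> e" "ends G g = {v, u}" "ends G e = {v, w'}"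
    by (rule removable_incident[OF wf rem ef(1)])
  have "g = f" using * ef by auto
  then have en: "ends G e = {v, u}" "ends G f = {v, u}" using * eq by auto
  have "wt G v f + wt G v e = 0"
    using rem * \<open>g = f\<close> by (simp add: removable_def vsum_def)
  then have wt: "wt G v f = - wt G v e" by (simp add: add_eq_0_iff2)
  obtain t where t: "t \<ge> 0" "h u - h v = t *\<^sub>R real_vec (wt G v e)"
    using weak_curveD(4)[OF w E(1) en(1)] by blast
  obtain s where s: "s \<ge> 0" "h u - h v = s *\<^sub>R real_vec (wt G v f)"
    using weak_curveD(4)[OF w E(2) en(2)] by blast
  have "t *\<^sub>R real_vec (wt G v e) = - (s *\<^sub>R real_vec (wt G v e))"
    using t(2) s(2) wt by simp
  then have "(t + s) *\<^sub>R real_vec (wt G v e) = 0"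
    by (simp only: scaleR_left_distrib) simp
  moreover have "wt G v e \<noteq> 0" using wf_wt[OF wf E(1)] en by auto
  ultimately have "t + s = 0" by simp
  then have "t = 0" using t s by simp
  then have "h v = h u" using t by simp
  then show False using zero_edges_iff[OF E(1) en(1)] z by blast
qed

lemma param_smooths:
  assumes p: "param_curve D c (G, h)" and s: "smooths G v H"
  shows "param_curve D c (H, h)"
proof -
  have w: "weak_curve D c G h" and z: "zero_edges G h = {}" using p param_curve_iff[OF c] by auto
  note wf = weak_curveD(1)[OF w]
  obtain e where e: "e \<in> incident G v"
    using s by (fastforce simp: smooths_def removable_def card_2_iff)
  obtain \<phi> \<psi> where *: "contraction \<phi> \<psi> G {e} H" "\<forall>w\<in>verts G - {v}. \<phi> w = w"
    "\<forall>h :: nat \<Rightarrow> real^'i. curve_contraction \<phi> \<psi> G h {e} {v} H h"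
    by (rule smoothsE[OF s e])
  have 0: "{f \<in> edges G - {e}. \<psi> f \<in> zero_edges H h} = {}"
    using weak_smooths(2)[OF c w s *(1,2) e] z by simp
  have "zero_edges H h = {}"
  proof (rule ccontr)
    assume "zero_edges H h \<noteq> {}"
    then obtain f where f: "f \<in> zero_edges H h" by blast
    then have "f \<in> edges H" using zero_edges_subset by blast
    then obtain g where "g \<in> edges G" "g \<notin> {e}" "f = \<psi> g" by (rule contraction_edgeE[OF wf *(1)])
    then show False using 0 f by blast
  qed
  then show ?thesis using weak_smooths(1)[OF c w s] param_curve_iff[OF c] by blast
qed

lemma param_smooth_step:
  assumes p: "param_curve D c (G, h)" and s: "smooth_step G H"
  obtains v where "smooths G v H" "param_curve D c (H, h)"
proof -
  have "\<forall>v e f. removable G v \<and> e \<in> incident G v \<and> f \<in> incident G v \<and> e \<noteq> f \<longrightarrow> ends G e \<noteq> ends G f"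
    using param_no_bigon[OF p] by blast
  then obtain v where "smooths G v H"
    using smooth_step_smooths[OF param_curve_wf[OF p] s] by blast
  then show thesis using that param_smooths[OF p] by blast
qed

lemma param_smooth_exists:
  assumes p: "param_curve D c (G, h)" and rem: "removable G v"
  obtains H where "smooth_step G H" "smooths G v H"
  using smooth_step_exists[OF param_curve_wf[OF p] rem] param_no_bigon[OF p rem] by metis

lemma smooths_invariants:
  fixes G H :: "'i wgraph"
  assumes wf: "wgraph_wf G" and s: "smooths G v H"
  shows "genus H = genus G" "length (marks H) = length (marks G)" "card (verts H) < card (verts G)"
    "verts H \<subseteq> verts G"
proof -
  have rem: "removable G v" and vH: "verts H = verts G - {v}" using s by (auto simp: smooths_def)
  obtain e where e: "e \<in> incident G v"
    using s by (fastforce simp: smooths_def removable_def card_2_iff)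
  obtain \<phi> \<psi> where *: "contraction \<phi> \<psi> G {e} H" "\<forall>w\<in>verts G - {v}. \<phi> w = w"
    "\<forall>h :: nat \<Rightarrow> real^'i. curve_contraction \<phi> \<psi> G h {e} {v} H h"
    by (rule smoothsE[OF s e])
  show "genus H = genus G" by (rule contraction_genus[OF wf *(1)])
  show "length (marks H) = length (marks G)" using contraction_marks[OF wf *(1)] by simp
  show "verts H \<subseteq> verts G" using vH by blast
  show "card (verts H) < card (verts G)"
    unfolding vH using rem wf_finite(1)[OF wf] by (intro card_Diff1_less) (auto simp: removable_def)
qed

lemma smooth_steps_invariants:
  assumes "smooth_step\<^sup>*\<^sup>* G H" "param_curve D c (G, h)"
  shows "param_curve D c (H, h) \<and> genus H = genus G \<and> length (marks H) = length (marks G) \<and> verts H \<subseteq> verts G"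
  using assms
proof (induction rule: rtranclp_induct)
  case (step H K)
  then have p: "param_curve D c (H, h)" by blast
  obtain v where v: "smooths H v K" "param_curve D c (K, h)" by (rule param_smooth_step[OF p step.hyps(2)])
  note i = smooths_invariants[OF param_curve_wf[OF p] v(1)]
  show ?case using step.IH[OF step.prems] v(2) i(1,2) i(4) by auto
qed simp

lemma simplification_exists:
  assumes "param_curve D c (G, h)"
  shows "\<exists>K. simplification G K"
  using assms
proof (induction "card (verts G)" arbitrary: G rule: less_induct)
  case less
  show ?case
  proof (cases "simple_wgraph G")
    case False
    then obtain v where v: "removable G v" by (auto simp: simple_wgraph_def)
    obtain H where H: "smooth_step G H" "smooths G v H" by (rule param_smooth_exists[OF less.prems v])
    obtain K where "simplification H K"
      using less.hyps[of H] smooths_invariants(3)[OF param_curve_wf[OF less.prems] H(2)]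
        param_smooths[OF less.prems H(2)] by blast
    then show ?thesis
      using H(1) unfolding simplification_def by (meson converse_rtranclp_into_rtranclp)
  qed (auto simp: simplification_def)
qed

lemma simple_no_smooth_step: "simple_wgraph G \<Longrightarrow> \<not> smooth_step G H"
  by (auto simp: simple_wgraph_def elim: smooth_step.cases)

text \<open>The common source of the commutation properties: it is applied with \<open>Z\<close> empty to transport a removal along an
  isomorphism, with one edge of another removable vertex, and with the edges of length zero.\<close>

lemma smooth_after_contraction:
  assumes wf: "wgraph_wf G" and cc: "curve_contraction \<phi> \<psi> G h Z R H k" and p: "param_curve D c (H, k)"
    and rem: "removable G v" and Z: "incident G v \<inter> Z = {}" and b: "b \<in> incident G v"
  obtains K \<phi>' \<psi>' where "smooth_step H K" "curve_contraction \<phi>' \<psi>' G h (insert b Z) (insert v R) K k"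
proof -
  have con: "contraction \<phi> \<psi> G Z H" using cc by (simp add: curve_contraction_def)
  note r = removable_contraction[OF wf con rem Z]
  obtain K where K: "smooth_step H K" "smooths H (\<phi> v) K" by (rule param_smooth_exists[OF p r(1)])
  have "\<psi> b \<in> incident H (\<phi> v)" using r(3) b by simp
  then obtain \<phi>' \<psi>' where *: "contraction \<phi>' \<psi>' H {\<psi> b} K" "\<forall>w\<in>verts H - {\<phi> v}. \<phi>' w = w"
    "\<forall>h :: nat \<Rightarrow> real^'i. curve_contraction \<phi>' \<psi>' H h {\<psi> b} {\<phi> v} K h"
    by (rule smoothsE[OF K(2)])
  have bE: "b \<in> edges G - Z" using b Z by (auto simp: incident_def)
  have "Z \<union> {e \<in> edges G - Z. \<psi> e \<in> {\<psi> b}} = insert b Z"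
    using contraction_bij[OF wf con] bE by (auto simp: bij_betw_def inj_on_def)
  moreover have "R \<union> {w \<in> verts G. \<phi> w \<in> {\<phi> v}} = insert v R"
    using r(2) by (auto simp: fiber_def)
  ultimately have "curve_contraction (\<phi>' \<circ> \<phi>) (\<psi>' \<circ> \<psi>) G h (insert b Z) (insert v R) K k"
    using curve_contraction_compose[OF wf cc *(3)[rule_format, of k]] by simp
  then show thesis using K(1) that by blast
qed

lemma smooth_step_transport:
  assumes p: "param_curve D c (G, h)" and p': "param_curve D c (G', h')"
    and iso: "curve_iso (G, h) (G', h')" and s: "smooth_step G H"
  obtains H' where "smooth_step G' H'" "curve_iso (H, h) (H', h')"
proof -
  note wf = param_curve_wf[OF p]
  obtain \<phi> \<psi> where i: "curve_contraction \<phi> \<psi> G h {} {} G' h'"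
    using curve_iso_contraction[OF wf iso] by metis
  obtain v where v: "smooths G v H" by (rule param_smooth_step[OF p s])
  have rem: "removable G v" using v by (simp add: smooths_def)
  obtain e where e: "e \<in> incident G v"
    using rem by (fastforce simp: smooths_def removable_def card_2_iff)
  obtain H' \<phi>' \<psi>' where H': "smooth_step G' H'" "curve_contraction \<phi>' \<psi>' G h (insert e {}) (insert v {}) H' h'"
    by (rule smooth_after_contraction[OF wf i p' rem _ e]) auto
  obtain \<phi>2 \<psi>2 where *: "contraction \<phi>2 \<psi>2 G {e} H" "\<forall>w\<in>verts G - {v}. \<phi>2 w = w"
    "\<forall>h :: nat \<Rightarrow> real^'i. curve_contraction \<phi>2 \<psi>2 G h {e} {v} H h"
    by (rule smoothsE[OF v e])
  show thesis
    using that[OF H'(1)] curve_contraction_unique[OF wf *(3)[rule_format, of h]] H'(2) by blast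
qed

lemma simplification_transport:
  assumes p: "param_curve D c (G, h)" and p': "param_curve D c (G', h')"
    and iso: "curve_iso (G, h) (G', h')" and s: "simplification G H"
  obtains H' where "simplification G' H'" "curve_iso (H, h) (H', h')"
proof -
  have "\<exists>H'. smooth_step\<^sup>*\<^sup>* G' H' \<and> curve_iso (H, h) (H', h')" if "smooth_step\<^sup>*\<^sup>* G H" for H
    using that
  proof (induction rule: rtranclp_induct)
    case base
    then show ?case using iso by blast
  next
    case (step H K)
    then obtain H' where H': "smooth_step\<^sup>*\<^sup>* G' H'" "curve_iso (H, h) (H', h')" by blast
    have pH: "param_curve D c (H, h)" and pH': "param_curve D c (H', h')"
      using smooth_steps_invariants[OF step.hyps(1) p] smooth_steps_invariants[OF H'(1) p'] by auto
    obtain K' where "smooth_step H' K'" "curve_iso (K, h) (K', h')"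
      by (rule smooth_step_transport[OF pH pH' H'(2) step.hyps(2)])
    then show ?case using H'(1) by (meson rtranclp.rtrancl_into_rtrancl)
  qed
  then obtain H' where H': "smooth_step\<^sup>*\<^sup>* G' H'" "curve_iso (H, h) (H', h')"
    using s by (auto simp: simplification_def)
  have pH: "param_curve D c (H, h)"
    using smooth_steps_invariants[OF _ p, of H] s by (auto simp: simplification_def)
  obtain \<phi> \<psi> where "wgraph_iso \<phi> \<psi> H H'"
    using H'(2) by (auto simp: curve_iso_def)
  then have "simple_wgraph H'"
    using iso_simple[OF param_curve_wf[OF pH]] s by (auto simp: simplification_def)
  then show thesis using H' that by (simp add: simplification_def)
qed

text \<open>Two removable vertices: choose at each of them an edge that avoids the other one. Then both
  orders of removal amount to the contraction of these two edges.\<close>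

lemma smooth_step_diamond:
  assumes p: "param_curve D c (G, h)" and s: "smooth_step G H1" "smooth_step G H2"
  shows "curve_iso (H1, h) (H2, h) \<or>
    (\<exists>K1 K2. smooth_step H1 K1 \<and> smooth_step H2 K2 \<and> curve_iso (K1, h) (K2, h))"
proof -
  note wf = param_curve_wf[OF p]
  obtain v1 where v1: "smooths G v1 H1" "param_curve D c (H1, h)" by (rule param_smooth_step[OF p s(1)])
  obtain v2 where v2: "smooths G v2 H2" "param_curve D c (H2, h)" by (rule param_smooth_step[OF p s(2)])
  have rem: "removable G v1" "removable G v2" using v1 v2 by (auto simp: smooths_def)
  have avoid: "\<exists>e\<in>incident G v. w \<notin> ends G e" if r: "removable G v" and vw: "v \<noteq> w" for v w
  proof (rule ccontr)
    assume *: "\<not> ?thesis"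
    obtain e f where ef: "incident G v = {e, f}" "e \<noteq> f"
      using r unfolding removable_def card_2_iff by blast
    have "ends G x = {v, w}" if "x \<in> incident G v" for x
      using that * wf_ends_eq[OF wf _ _ _ vw, of x] by (auto simp: incident_def)
    then show False using param_no_bigon[OF p r, of e f] ef by auto
  qed
  show ?thesis
  proof (cases "v1 = v2")
    case True
    obtain e where e: "e \<in> incident G v1"
      using rem by (fastforce simp: removable_def card_2_iff)
    obtain \<phi> \<psi> where 1: "contraction \<phi> \<psi> G {e} H1" "\<forall>w\<in>verts G - {v1}. \<phi> w = w"
      "\<forall>h :: nat \<Rightarrow> real^'i. curve_contraction \<phi> \<psi> G h {e} {v1} H1 h"
      by (rule smoothsE[OF v1(1) e])
    obtain \<phi>' \<psi>' where 2: "contraction \<phi>' \<psi>' G {e} H2" "\<forall>w\<in>verts G - {v2}. \<phi>' w = w"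
      "\<forall>h :: nat \<Rightarrow> real^'i. curve_contraction \<phi>' \<psi>' G h {e} {v2} H2 h"
      using e unfolding True by (rule smoothsE[OF v2(1)])
    show ?thesis
      using curve_contraction_unique[OF wf 1(3)[rule_format] ] 2(3) True by blast
  next
    case False
    obtain a where a: "a \<in> incident G v1" "v2 \<notin> ends G a" using avoid[OF rem(1) False] by blast
    obtain b where b: "b \<in> incident G v2" "v1 \<notin> ends G b" using avoid[OF rem(2)] False by metis
    have half: "\<exists>K \<phi> \<psi>. smooth_step H K \<and> curve_contraction \<phi> \<psi> G h {a, b} {v, w} K h"
      if sm: "smooths G v H" "param_curve D c (H, h)" and r: "removable G w"
        and ab: "a \<in> incident G v" "w \<notin> ends G a" "b \<in> incident G w" for v w a b H
    proof -
      obtain \<phi> \<psi> where 1: "contraction \<phi> \<psi> G {a} H" "\<forall>x\<in>verts G - {v}. \<phi> x = x"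
        "\<forall>h :: nat \<Rightarrow> real^'i. curve_contraction \<phi> \<psi> G h {a} {v} H h"
        by (rule smoothsE[OF sm(1) ab(1)])
      have "incident G w \<inter> {a} = {}" using ab by (auto simp: incident_def)
      then obtain K \<phi>' \<psi>' where "smooth_step H K" "curve_contraction \<phi>' \<psi>' G h (insert b {a}) (insert w {v}) K h"
        using smooth_after_contraction[OF wf 1(3)[rule_format] sm(2) r _ ab(3)] by metis
      then show ?thesis by (metis insert_commute)
    qed
    obtain K1 \<phi>1 \<psi>1 where 1: "smooth_step H1 K1" "curve_contraction \<phi>1 \<psi>1 G h {a, b} {v1, v2} K1 h"
      using half[OF v1 rem(2) a b(1)] by blast
    obtain K2 \<phi>2 \<psi>2 where "smooth_step H2 K2" "curve_contraction \<phi>2 \<psi>2 G h {b, a} {v2, v1} K2 h"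
      using half[OF v2 rem(1) b a(1)] by blast
    then have 2: "smooth_step H2 K2" "curve_contraction \<phi>2 \<psi>2 G h {a, b} {v1, v2} K2 h"
      by (simp_all add: insert_commute)
    show ?thesis using 1(1) 2(1) curve_contraction_unique[OF wf 1(2) 2(2)] by blast
  qed
qed

text \<open>The diamond property gives uniqueness by induction on the number of vertices, as in Newman's lemma.\<close>

lemma simplification_unique:
  assumes "param_curve D c (G, h)" "simplification G H" "simplification G H'"
  shows "curve_iso (H, h) (H', h)"
  using assms
proof (induction "card (verts G)" arbitrary: G H H' rule: less_induct)
  case less
  note p = less.prems(1)
  have via: "\<exists>X. smooth_step G X \<and> simplification X Y" if "simplification G Y" "\<not> simple_wgraph G" for Y
    using that unfolding simplification_def by (metis converse_rtranclpE)
  have down: "card (verts X) < card (verts G) \<and> param_curve D c (X, h)" if "smooth_step G X" for X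
    using param_smooth_step[OF p that] smooths_invariants(3)[OF param_curve_wf[OF p]] by metis
  show ?case
  proof (cases "simple_wgraph G")
    case True
    then have "H = G" "H' = G"
      using less.prems(2,3) simple_no_smooth_step unfolding simplification_def by (metis converse_rtranclpE)+
    then show ?thesis by (simp add: curve_iso_refl)
  next
    case False
    obtain X where X: "smooth_step G X" "simplification X H" using via[OF less.prems(2) False] by blast
    obtain Y where Y: "smooth_step G Y" "simplification Y H'" using via[OF less.prems(3) False] by blast
    have dX: "card (verts X) < card (verts G)" "param_curve D c (X, h)" using down[OF X(1)] by auto
    have dY: "card (verts Y) < card (verts G)" "param_curve D c (Y, h)" using down[OF Y(1)] by auto
    have wfH: "wgraph_wf (fst (H, h))"
      using smooth_steps_invariants[OF _ p, of H] param_curve_wf less.prems(2) by (auto simp: simplification_def)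
    from smooth_step_diamond[OF p X(1) Y(1)] show ?thesis
    proof
      assume iso: "curve_iso (X, h) (Y, h)"
      obtain T where T: "simplification Y T" "curve_iso (H, h) (T, h)"
        by (rule simplification_transport[OF dX(2) dY(2) iso X(2)])
      have "curve_iso (T, h) (H', h)" by (rule less.hyps[OF dY T(1) Y(2)])
      then show ?thesis using curve_iso_trans[OF wfH T(2)] by blast
    next
      assume "\<exists>K1 K2. smooth_step X K1 \<and> smooth_step Y K2 \<and> curve_iso (K1, h) (K2, h)"
      then obtain K1 K2 where K: "smooth_step X K1" "smooth_step Y K2" "curve_iso (K1, h) (K2, h)" by blast
      have pK: "param_curve D c (K1, h)" "param_curve D c (K2, h)"
        using param_smooth_step[OF dX(2) K(1)] param_smooth_step[OF dY(2) K(2)] by metis+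
      obtain T1 where T1: "simplification K1 T1" using simplification_exists[OF pK(1)] by blast
      obtain T2 where T2: "simplification K2 T2" "curve_iso (T1, h) (T2, h)"
        by (rule simplification_transport[OF pK K(3) T1])
      have "simplification X T1" "simplification Y T2"
        using K T1 T2 unfolding simplification_def by (meson converse_rtranclp_into_rtranclp)+
      then have "curve_iso (H, h) (T1, h)" "curve_iso (T2, h) (H', h)"
        using less.hyps[OF dX X(2)] less.hyps[OF dY _ Y(2)] by blast+
      moreover have "wgraph_wf (fst (T1, h))"
        using smooth_steps_invariants[OF _ pK(1), of T1] param_curve_wf T1 by (auto simp: simplification_def)
      ultimately show ?thesis using curve_iso_trans[OF wfH] T2(2) curve_iso_trans by blast
    qed
  qed
qed

lemma zero_edges_joined:
  assumes "(u, v) \<in> joined (ends G) Z" "Z \<subseteq> zero_edges G h"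
  shows "h u = h v"
  using assms(1)
proof (induction rule: joined_induct)
  case (step x y e)
  have "x \<in> ends G e" "y \<in> ends G e" using step.hyps(3) by auto
  then have "h x = h y" using step.hyps(2) assms(2) unfolding zero_edges_def by blast
  then show ?case using step.IH by simp
qed simp

lemma contract_curve_contraction:
  assumes wf: "wgraph_wf G" and Z: "Z \<subseteq> zero_edges G h"
    and con: "contraction (\<lambda>v. Min (component G Z v)) (\<lambda>e. e) G Z (contract G Z)"
  shows "curve_contraction (\<lambda>v. Min (component G Z v)) (\<lambda>e. e) G h Z {} (contract G Z) h"
proof -
  have ZE: "Z \<subseteq> edges G" using Z zero_edges_subset by blast
  have "h (Min (component G Z v)) = h v" if v: "v \<in> verts G" for v
  proof -
    have "component G Z v \<subseteq> verts G"
      using joined_verts[OF wf _ ZE v] by (auto simp: component_def)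
    then have "finite (component G Z v)" using wf_finite(1)[OF wf] finite_subset by blast
    moreover have "v \<in> component G Z v" by (simp add: component_def)
    ultimately have "Min (component G Z v) \<in> component G Z v" using Min_in by blast
    then show ?thesis using zero_edges_joined[OF _ Z] by (simp add: component_def)
  qed
  then show ?thesis
    using con contraction_verts[OF wf con] by (simp add: curve_contraction_def)
qed

lemma zero_contract:
  assumes w: "weak_curve D c G h"
  shows "curve_contraction (\<lambda>v. Min (component G (zero_edges G h) v)) (\<lambda>e. e) G h (zero_edges G h) {}
    (contract G (zero_edges G h)) h"
proof (rule contract_curve_contraction[OF weak_curveD(1)[OF w] order_refl])
  show "contraction (\<lambda>v. Min (component G (zero_edges G h) v)) (\<lambda>e. e) G (zero_edges G h) (contract G (zero_edges G h))"
  proof (rule contract_contraction[OF weak_curveD(1)[OF w] zero_edges_subset])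
    fix e u v assume e: "e \<in> edges G - zero_edges G h" "ends G e = {u, v}"
    then show "(u, v) \<notin> joined (ends G) (zero_edges G h)"
      using zero_edges_joined[of u v G "zero_edges G h" h] zero_edges_iff[of e G u v h] by blast
  qed
qed

lemma zero_contraction_param:
  assumes w: "weak_curve D c G h" and cc: "curve_contraction \<phi> \<psi> G h (zero_edges G h) {} H k"
  shows "param_curve D c (H, k)"
proof -
  note wf = weak_curveD(1)[OF w]
  have con: "contraction \<phi> \<psi> G (zero_edges G h) H" using cc by (simp add: curve_contraction_def)
  have "f \<notin> zero_edges H k" for f
  proof
    assume f: "f \<in> zero_edges H k"
    then have "f \<in> edges H" using zero_edges_subset by blast
    then obtain g where "g \<in> edges G" "g \<notin> zero_edges G h" "f = \<psi> g" by (rule contraction_edgeE[OF wf con])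
    then show False using zero_edges_contraction[OF wf cc] f by blast
  qed
  then show ?thesis using weak_curve_contraction[OF w cc] param_curve_iff[OF c] by blast
qed

lemma normal_form_exists:
  assumes w: "weak_curve D c G h"
  obtains K where "simplification (contract G (zero_edges G h)) K" "normal_form G h K h"
proof -
  obtain K where "simplification (contract G (zero_edges G h)) K"
    using simplification_exists[OF zero_contraction_param[OF w zero_contract[OF w]]] by blast
  then show thesis using that zero_contract[OF w] unfolding normal_form_def by blast
qed

lemma normal_form_contract:
  "weak_curve D c G h \<Longrightarrow> simplification (contract G (zero_edges G h)) K \<Longrightarrow> normal_form G h K h"
  using zero_contract unfolding normal_form_def by blast

lemma normal_form_invariants:
  assumes w: "weak_curve D c G h" and n: "normal_form G h K k"
  shows "param_curve D c (K, k)" "simple_wgraph K" "genus K = genus G" "length (marks K) = length (marks G)"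
proof -
  note wf = weak_curveD(1)[OF w]
  obtain \<phi> \<psi> G' where cc: "curve_contraction \<phi> \<psi> G h (zero_edges G h) {} G' k" and s: "simplification G' K"
    using n by (auto simp: normal_form_def)
  have con: "contraction \<phi> \<psi> G (zero_edges G h) G'" using cc by (simp add: curve_contraction_def)
  have p: "param_curve D c (G', k)" by (rule zero_contraction_param[OF w cc])
  have st: "smooth_step\<^sup>*\<^sup>* G' K" using s by (simp add: simplification_def)
  show "simple_wgraph K" using s by (simp add: simplification_def)
  show "param_curve D c (K, k)" "genus K = genus G" "length (marks K) = length (marks G)"
    using smooth_steps_invariants[OF st p] contraction_genus[OF wf con] contraction_marks[OF wf con] by auto
qed

lemma normal_form_unique:
  assumes w: "weak_curve D c G h" and 1: "normal_form G h K1 k1" and 2: "normal_form G h K2 k2"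
  shows "curve_iso (K1, k1) (K2, k2)"
proof -
  note wf = weak_curveD(1)[OF w]
  obtain \<phi> \<psi> G' where cc: "curve_contraction \<phi> \<psi> G h (zero_edges G h) {} G' k1" and s: "simplification G' K1"
    using 1 by (auto simp: normal_form_def)
  obtain \<phi>' \<psi>' G'' where cc': "curve_contraction \<phi>' \<psi>' G h (zero_edges G h) {} G'' k2" and s': "simplification G'' K2"
    using 2 by (auto simp: normal_form_def)
  have p: "param_curve D c (G', k1)" "param_curve D c (G'', k2)"
    using zero_contraction_param[OF w] cc cc' by blast+
  obtain T where T: "simplification G'' T" "curve_iso (K1, k1) (T, k2)"
    by (rule simplification_transport[OF p curve_contraction_unique[OF wf cc cc'] s])
  have "wgraph_wf (fst (K1, k1))"
    using normal_form_invariants(1)[OF w 1] param_curve_wf by auto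
  then show ?thesis
    using curve_iso_trans[OF _ T(2) simplification_unique[OF p(2) T(1) s']] by blast
qed

text \<open>Contracting the edges of length zero in two stages or at once makes no difference.\<close>

lemma normal_form_contraction:
  assumes w: "weak_curve D c G h" and cc: "curve_contraction \<phi> \<psi> G h Z {} H k" and Z: "Z \<subseteq> zero_edges G h"
    and n: "normal_form H k K l"
  shows "normal_form G h K l"
proof -
  note wf = weak_curveD(1)[OF w]
  obtain \<phi>' \<psi>' H' where cc': "curve_contraction \<phi>' \<psi>' H k (zero_edges H k) {} H' l" and s: "simplification H' K"
    using n by (auto simp: normal_form_def)
  have "curve_contraction (\<phi>' \<circ> \<phi>) (\<psi>' \<circ> \<psi>) G h (zero_edges G h) {} H' l"
    using curve_contraction_compose[OF wf cc cc'] zero_edges_contraction[OF wf cc Z] by simp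
  then show ?thesis using s unfolding normal_form_def by blast
qed

text \<open>If one of the two edges at the removed vertex has length zero, the removal may be regarded as
  the contraction of that edge. Otherwise the removal commutes with the contraction of the edges of
  length zero, because both are contractions of subsets of edges.\<close>

lemma normal_form_smooths:
  assumes w: "weak_curve D c G h" and s: "smooths G v H" and n: "normal_form H h K k"
  obtains K' k' where "normal_form G h K' k'" "curve_iso (K, k) (K', k')"
proof -
  note wf = weak_curveD(1)[OF w]
  have wH: "weak_curve D c H h" by (rule weak_smooths(1)[OF c w s])
  have rem: "removable G v" using s by (simp add: smooths_def)
  show thesis
  proof (cases "incident G v \<inter> zero_edges G h = {}")
    case False
    then obtain e where e: "e \<in> incident G v" "e \<in> zero_edges G h" by blast
    obtain \<phi> \<psi> where *: "contraction \<phi> \<psi> G {e} H" "\<forall>w\<in>verts G - {v}. \<phi> w = w"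
      "\<forall>h :: nat \<Rightarrow> real^'i. curve_contraction \<phi> \<psi> G h {e} {v} H h"
      by (rule smoothsE[OF s e(1)])
    obtain f u w' where f: "incident G v = {f, e}" "f \<noteq> e" "ends G f = {v, u}" "ends G e = {v, w'}" "w' \<noteq> v"
      by (rule removable_incident[OF wf rem e(1)])
    have eG: "e \<in> edges G" using e by (simp add: incident_def)
    have "w' \<in> verts G" using wf_ends_verts[OF wf eG f(4)] by simp
    then have "\<phi> w' = w'" using *(2) f(5) by simp
    moreover have "\<phi> ` ends G e = {\<phi> w'}" using contraction_zero_edge[OF wf *(1), of e w'] f by auto
    ultimately have "\<phi> v = w'" using f(4) by auto
    moreover have "h v = h w'" using zero_edges_iff[OF eG f(4)] e by blast
    ultimately have "h (\<phi> x) = h x" if "x \<in> verts G" for x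
      using that *(2) by (cases "x = v") auto
    then have "curve_contraction \<phi> \<psi> G h {e} {} H h"
      using *(1) contraction_verts[OF wf *(1)] by (simp add: curve_contraction_def)
    then have "normal_form G h K k"
      using e(2) n by (intro normal_form_contraction[OF w, of \<phi> \<psi> "{e}" H h]) auto
    then show thesis using that curve_iso_refl by blast
  next
    case True
    obtain b where b: "b \<in> incident G v"
      using rem by (fastforce simp: smooths_def removable_def card_2_iff)
    obtain \<phi> \<psi> where *: "contraction \<phi> \<psi> G {b} H" "\<forall>w\<in>verts G - {v}. \<phi> w = w"
      "\<forall>h :: nat \<Rightarrow> real^'i. curve_contraction \<phi> \<psi> G h {b} {v} H h"
      by (rule smoothsE[OF s b])
    obtain \<phi>' \<psi>' H' where cc': "curve_contraction \<phi>' \<psi>' H h (zero_edges H h) {} H' k" and s': "simplification H' K"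
      using n by (auto simp: normal_form_def)
    have "{b} \<union> {f \<in> edges G - {b}. \<psi> f \<in> zero_edges H h} = insert b (zero_edges G h)"
      using weak_smooths(2)[OF c w s *(1,2) b True] by simp
    then have ccH: "curve_contraction (\<phi>' \<circ> \<phi>) (\<psi>' \<circ> \<psi>) G h (insert b (zero_edges G h)) (insert v {}) H' k"
      using curve_contraction_compose[OF wf *(3)[rule_format, of h] cc'] by simp
    let ?G' = "contract G (zero_edges G h)"
    note ccG = zero_contract[OF w]
    have pG: "param_curve D c (?G', h)" by (rule zero_contraction_param[OF w ccG])
    obtain K0 \<phi>0 \<psi>0 where K0: "smooth_step ?G' K0"
      "curve_contraction \<phi>0 \<psi>0 G h (insert b (zero_edges G h)) (insert v {}) K0 h"
      by (rule smooth_after_contraction[OF wf ccG pG rem True b])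
    have iso: "curve_iso (H', k) (K0, h)" by (rule curve_contraction_unique[OF wf ccH K0(2)])
    have pH': "param_curve D c (H', k)" by (rule zero_contraction_param[OF wH cc'])
    have pK0: "param_curve D c (K0, h)" by (rule param_smooth_step[OF pG K0(1)])
    obtain K' where K': "simplification K0 K'" "curve_iso (K, k) (K', h)"
      by (rule simplification_transport[OF pH' pK0 iso s'])
    have "simplification ?G' K'"
      using K0(1) K'(1) unfolding simplification_def by (meson converse_rtranclp_into_rtranclp)
    then have "normal_form G h K' h" by (rule normal_form_contract[OF w])
    then show thesis using that K'(2) by blast
  qed
qed

end

section \<open>Semicontinuity of the degree and the attaching maps\<close>

lemma tropical_degree_cong:
  assumes "\<And>v. v \<in> verts G \<Longrightarrow> I v = J v"
  shows "tropical_degree D \<omega> (G, I) = tropical_degree D \<omega> (G, J)"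
  unfolding tropical_degree_def local_degree_def using assms by (intro sum.cong) auto

lemma tropical_degree_iso:
  assumes wf: "wgraph_wf (fst \<alpha>)" and i: "ctype_iso_via \<phi> \<psi> \<alpha> \<beta>"
  shows "tropical_degree D \<omega> \<beta> = tropical_degree D \<omega> \<alpha>"
proof -
  have iso: "wgraph_iso \<phi> \<psi> (fst \<alpha>) (fst \<beta>)" and I: "\<And>v. v \<in> verts (fst \<alpha>) \<Longrightarrow> snd \<beta> (\<phi> v) = snd \<alpha> v"
    using i by (auto simp: ctype_iso_via_def)
  have "bij_betw \<phi> (verts (fst \<alpha>)) (verts (fst \<beta>))" using iso by (simp add: wgraph_iso_def)
  then have "tropical_degree D \<omega> \<beta> = (\<Sum>v\<in>verts (fst \<alpha>). local_degree D \<omega> \<beta> (\<phi> v))"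
    unfolding tropical_degree_def by (rule sum.reindex_bij_betw[symmetric])
  also have "\<dots> = tropical_degree D \<omega> \<alpha>"
    unfolding tropical_degree_def local_degree_def
    using I iso_incident(2)[OF wf iso] by (intro sum.cong) auto
  finally show ?thesis .
qed

lemma ctype_iso_refl: "ctype_iso \<alpha> \<alpha>"
  unfolding ctype_iso_def ctype_iso_via_def
  by (rule exI[of _ "\<lambda>v. v"], rule exI[of _ "\<lambda>v. v"]) (auto simp: wgraph_iso_def bij_betw_def)

lemma ctype_iso_sym:
  assumes wf: "wgraph_wf (fst \<alpha>)" and "ctype_iso \<alpha> \<beta>"
  shows "ctype_iso \<beta> \<alpha>"
proof -
  obtain \<phi> \<psi> where i: "wgraph_iso \<phi> \<psi> (fst \<alpha>) (fst \<beta>)" "\<And>v. v \<in> verts (fst \<alpha>) \<Longrightarrow> snd \<beta> (\<phi> v) = snd \<alpha> v"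
    using assms(2) by (auto simp: ctype_iso_def ctype_iso_via_def)
  obtain \<phi>' \<psi>' where j: "wgraph_iso \<phi>' \<psi>' (fst \<beta>) (fst \<alpha>)" "\<And>v. v \<in> verts (fst \<alpha>) \<Longrightarrow> \<phi>' (\<phi> v) = v"
    using wgraph_iso_sym[OF wf i(1)] by metis
  have "verts (fst \<beta>) = \<phi> ` verts (fst \<alpha>)" using i(1) by (auto simp: wgraph_iso_def bij_betw_def)
  then have "\<forall>v\<in>verts (fst \<beta>). snd \<alpha> (\<phi>' v) = snd \<beta> v" using i(2) j(2) by auto
  then show ?thesis using j(1) by (auto simp: ctype_iso_def ctype_iso_via_def)
qed

lemma ctype_iso_trans:
  assumes wf: "wgraph_wf (fst \<alpha>)" and "ctype_iso \<alpha> \<beta>" "ctype_iso \<beta> \<gamma>"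
  shows "ctype_iso \<alpha> \<gamma>"
proof -
  obtain \<phi> \<psi> where i: "wgraph_iso \<phi> \<psi> (fst \<alpha>) (fst \<beta>)" "\<And>v. v \<in> verts (fst \<alpha>) \<Longrightarrow> snd \<beta> (\<phi> v) = snd \<alpha> v"
    using assms(2) by (auto simp: ctype_iso_def ctype_iso_via_def)
  obtain \<phi>' \<psi>' where j: "wgraph_iso \<phi>' \<psi>' (fst \<beta>) (fst \<gamma>)" "\<And>v. v \<in> verts (fst \<beta>) \<Longrightarrow> snd \<gamma> (\<phi>' v) = snd \<beta> v"
    using assms(3) by (auto simp: ctype_iso_def ctype_iso_via_def)
  have "verts (fst \<beta>) = \<phi> ` verts (fst \<alpha>)" using i(1) by (auto simp: wgraph_iso_def bij_betw_def)
  then have "\<forall>v\<in>verts (fst \<alpha>). snd \<gamma> ((\<phi>' \<circ> \<phi>) v) = snd \<alpha> v" using i(2) j(2) by auto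
  then show ?thesis using wgraph_iso_trans[OF wf i(1) j(1)] unfolding ctype_iso_def ctype_iso_via_def by blast
qed

lemma equiv_ctype_iso_rel: "equiv {\<alpha>. comb_type \<alpha>} ctype_iso_rel"
proof (rule equivI)
  show "ctype_iso_rel \<subseteq> {\<alpha>. comb_type \<alpha>} \<times> {\<alpha>. comb_type \<alpha>}" by (auto simp: ctype_iso_rel_def)
  show "refl_on {\<alpha>. comb_type \<alpha>} ctype_iso_rel"
    by (auto simp: ctype_iso_rel_def ctype_iso_refl intro!: refl_onI)
  show "sym ctype_iso_rel"
    by (rule symI) (auto simp: ctype_iso_rel_def comb_type_def intro: ctype_iso_sym)
  show "trans ctype_iso_rel"
    by (rule transI) (auto simp: ctype_iso_rel_def comb_type_def intro: ctype_iso_trans)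
qed

lemma equiv_curve_iso_rel: "equiv {C. param_curve D c C} (curve_iso_rel D c)"
proof (rule equivI)
  have wf: "wgraph_wf (fst C)" if "param_curve D c C" for C
    using that by (cases C) (simp add: param_curve_def)
  show "curve_iso_rel D c \<subseteq> {C. param_curve D c C} \<times> {C. param_curve D c C}" by (auto simp: curve_iso_rel_def)
  show "refl_on {C. param_curve D c C} (curve_iso_rel D c)"
    by (auto simp: curve_iso_rel_def curve_iso_refl intro!: refl_onI)
  show "sym (curve_iso_rel D c)"
    by (rule symI) (auto simp: curve_iso_rel_def intro: curve_iso_sym wf)
  show "trans (curve_iso_rel D c)"
    by (rule transI) (auto simp: curve_iso_rel_def intro: curve_iso_trans wf)
qed

text \<open>The possible positions of the vertices in the closure of the polyhedron of a type.\<close>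

definition placement :: "('i \<Rightarrow> 'p set) \<Rightarrow> real \<Rightarrow> ('i::finite) ctype \<Rightarrow> (nat \<Rightarrow> real^'i) \<Rightarrow> bool" where
  "placement D c \<alpha> h \<longleftrightarrow> weak_curve D c (fst \<alpha>) h \<and> (\<forall>v\<in>verts (fst \<alpha>). supp (h v) \<subseteq> snd \<alpha> v)"

definition strict_placement :: "('i \<Rightarrow> 'p set) \<Rightarrow> real \<Rightarrow> ('i::finite) ctype \<Rightarrow> (nat \<Rightarrow> real^'i) \<Rightarrow> bool" where
  "strict_placement D c \<alpha> h \<longleftrightarrow> param_curve D c (fst \<alpha>, h) \<and> (\<forall>v\<in>verts (fst \<alpha>). supp (h v) = snd \<alpha> v)"

context
  fixes D :: "'i::finite \<Rightarrow> 'p set" and c :: real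
  assumes c: "0 < c"
begin

lemma param_curve_verts: "param_curve D c (G, h) \<Longrightarrow> v \<in> verts G \<Longrightarrow> h v \<in> clemens_polytope D c"
  by (simp add: param_curve_def)

lemma carrier_supp: "param_curve D c (G, h) \<Longrightarrow> v \<in> verts G \<Longrightarrow> carrier_face D c (h v) = supp (h v)"
  using carrier_face_eq[OF c] param_curve_verts by blast

lemma supp_face: "x \<in> clemens_polytope D c \<Longrightarrow> supp x \<in> face_sets D"
  using clemens_polytope_iff[OF c] by blast

lemma curve_iso_type:
  assumes "curve_iso C C'" shows "ctype_iso (type_of_curve D c C) (type_of_curve D c C')"
proof -
  obtain \<phi> \<psi> where "wgraph_iso \<phi> \<psi> (fst C) (fst C')" "\<forall>v\<in>verts (fst C). snd C' (\<phi> v) = snd C v"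
    using assms by (auto simp: curve_iso_def)
  then show ?thesis unfolding ctype_iso_def ctype_iso_via_def type_of_curve_def by auto
qed

lemma type_of_curve_degree:
  assumes "param_curve D c (G, h)"
  shows "tropical_degree D \<omega> (type_of_curve D c (G, h)) = tropical_degree D \<omega> (G, \<lambda>v. supp (h v))"
  unfolding type_of_curve_def using carrier_supp[OF assms] by (auto intro: tropical_degree_cong)

lemma strict_placement: "strict_placement D c \<alpha> h \<Longrightarrow> placement D c \<alpha> h"
  using param_curve_iff[OF c] by (auto simp: strict_placement_def placement_def)

lemma good_ctype_iff: "good_ctype D c \<alpha> \<longleftrightarrow> (\<exists>h. strict_placement D c \<alpha> h)"
proof
  assume "good_ctype D c \<alpha>"
  then obtain G h where p: "param_curve D c (G, h)" and "ctype_iso (type_of_curve D c (G, h)) \<alpha>"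
    by (auto simp: good_ctype_def)
  then obtain \<phi> \<psi> where i: "wgraph_iso \<phi> \<psi> G (fst \<alpha>)"
    and I: "\<And>v. v \<in> verts G \<Longrightarrow> snd \<alpha> (\<phi> v) = carrier_face D c (h v)"
    by (auto simp: ctype_iso_def ctype_iso_via_def type_of_curve_def)
  note wf = param_curve_wf[OF c p]
  define k where "k x = h (inv_into (verts G) \<phi> x)" for x
  have bij: "bij_betw \<phi> (verts G) (verts (fst \<alpha>))" using i by (simp add: wgraph_iso_def)
  then have k: "k (\<phi> v) = h v" if "v \<in> verts G" for v
    using that by (simp add: k_def bij_betw_def)
  have cc: "curve_contraction \<phi> \<psi> G h {} {} (fst \<alpha>) k"
    using curve_contraction_iso[OF wf i, of k h] k by blast
  have w: "weak_curve D c G h" and z: "zero_edges G h = {}" using p param_curve_iff[OF c] by auto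
  have "param_curve D c (fst \<alpha>, k)" using zero_contraction_param[OF c w] cc z by simp
  moreover have "supp (k x) = snd \<alpha> x" if "x \<in> verts (fst \<alpha>)" for x
  proof -
    obtain v where "v \<in> verts G" "x = \<phi> v" using bij \<open>x \<in> _\<close> by (auto simp: bij_betw_def)
    then show ?thesis using k I carrier_supp[OF p] by simp
  qed
  ultimately show "\<exists>h. strict_placement D c \<alpha> h" unfolding strict_placement_def by blast
next
  assume "\<exists>h. strict_placement D c \<alpha> h"
  then obtain h where p: "param_curve D c (fst \<alpha>, h)" and "\<forall>v\<in>verts (fst \<alpha>). supp (h v) = snd \<alpha> v"
    by (auto simp: strict_placement_def)
  then have "ctype_iso_via (\<lambda>v. v) (\<lambda>e. e) (type_of_curve D c (fst \<alpha>, h)) \<alpha>"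
    using carrier_supp[OF p] by (auto simp: ctype_iso_via_def type_of_curve_def wgraph_iso_def bij_betw_def)
  then show "good_ctype D c \<alpha>" using p unfolding good_ctype_def ctype_iso_def by blast
qed

lemma good_types_iff:
  "\<alpha> \<in> good_types D c \<omega> g n A \<longleftrightarrow> (\<exists>h. strict_placement D c \<alpha> h) \<and> simple_wgraph (fst \<alpha>) \<and>
     genus (fst \<alpha>) = g \<and> length (marks (fst \<alpha>)) = n \<and> tropical_degree D \<omega> \<alpha> \<le> ennreal A"
proof -
  have "comb_type \<alpha>" if s: "strict_placement D c \<alpha> h" for h
  proof -
    have p: "param_curve D c (fst \<alpha>, h)" using s by (simp add: strict_placement_def)
    have "snd \<alpha> v \<noteq> {}" if "v \<in> verts (fst \<alpha>)" for v
    proof -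
      have "supp (h v) \<in> face_sets D" by (rule supp_face[OF param_curve_verts[OF p that]])
      then show ?thesis using s that by (auto simp: strict_placement_def face_sets_def)
    qed
    then show ?thesis using param_curve_wf[OF c p] by (simp add: comb_type_def)
  qed
  then show ?thesis unfolding good_types_def good_ctype_iff by auto
qed

lemma strict_placement_face:
  assumes "strict_placement D c \<alpha> h" "v \<in> verts (fst \<alpha>)"
  shows "snd \<alpha> v \<in> face_sets D"
proof -
  have p: "param_curve D c (fst \<alpha>, h)" using assms by (simp add: strict_placement_def)
  have "supp (h v) \<in> face_sets D" by (rule supp_face[OF param_curve_verts[OF p assms(2)]])
  then show ?thesis using assms by (simp add: strict_placement_def)
qed

lemma strict_placement_edge_face:
  assumes s: "strict_placement D c \<alpha> h" and e: "e \<in> edges (fst \<alpha>)" "ends (fst \<alpha>) e = {u, v}"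
  shows "snd \<alpha> u \<union> snd \<alpha> v \<in> face_sets D"
proof -
  have p: "param_curve D c (fst \<alpha>, h)" and I: "\<And>v. v \<in> verts (fst \<alpha>) \<Longrightarrow> supp (h v) = snd \<alpha> v"
    using s by (auto simp: strict_placement_def)
  have w: "weak_curve D c (fst \<alpha>) h" using p param_curve_iff[OF c] by auto
  have "u \<in> verts (fst \<alpha>)" "v \<in> verts (fst \<alpha>)" using wf_ends_verts[OF weak_curveD(1)[OF w] e] by auto
  then show ?thesis using weak_curveD(3)[OF w e] I by simp
qed

text \<open>Every edge at \<open>v\<close> lies in a face containing the carrier of \<open>v\<close>.\<close>

lemma vsum_adjacent:
  assumes s: "strict_placement D c \<alpha> h" and v: "v \<in> verts (fst \<alpha>)" and j: "vsum (fst \<alpha>) v $ j \<noteq> 0"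
  shows "j \<in> adjacent D (snd \<alpha> v)"
proof -
  have p: "param_curve D c (fst \<alpha>, h)" and I: "\<And>v. v \<in> verts (fst \<alpha>) \<Longrightarrow> supp (h v) = snd \<alpha> v"
    using s by (auto simp: strict_placement_def)
  have w: "weak_curve D c (fst \<alpha>) h" and z: "zero_edges (fst \<alpha>) h = {}" using p param_curve_iff[OF c] by auto
  note wf = weak_curveD(1)[OF w]
  have "\<exists>e\<in>incident (fst \<alpha>) v. wt (fst \<alpha>) v e $ j \<noteq> 0"
  proof (rule ccontr)
    assume "\<not> ?thesis"
    then have "(\<Sum>e\<in>incident (fst \<alpha>) v. wt (fst \<alpha>) v e $ j) = 0" by (intro sum.neutral) auto
    then show False using j by (simp add: vsum_def)
  qed
  then obtain e where e: "e \<in> edges (fst \<alpha>)" "v \<in> ends (fst \<alpha>) e" "wt (fst \<alpha>) v e $ j \<noteq> 0"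
    by (auto simp: incident_def)
  obtain u where u: "ends (fst \<alpha>) e = {v, u}"
    using wf_ends(2)[OF wf e(1)] e(2) unfolding card_2_iff by (metis insertE insert_commute singletonD)
  have uV: "u \<in> verts (fst \<alpha>)" using wf_ends_verts[OF wf e(1) u] by simp
  obtain t where t: "t \<ge> 0" "h u - h v = t *\<^sub>R real_vec (wt (fst \<alpha>) v e)"
    using weak_curveD(4)[OF w e(1) u] by blast
  have "h v \<noteq> h u" using zero_edges_iff[OF e(1) u] z by blast
  then have "t \<noteq> 0" using t by auto
  moreover have "(h u - h v) $ j = t * real_of_int (wt (fst \<alpha>) v e $ j)" using t by simp
  ultimately have "h u $ j \<noteq> h v $ j" using e(3) by auto
  then have "j \<in> snd \<alpha> v \<union> snd \<alpha> u"
    unfolding I[OF v, symmetric] I[OF uV, symmetric] by (auto simp: supp_def)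
  then have "insert j (snd \<alpha> v) \<subseteq> snd \<alpha> v \<union> snd \<alpha> u" by blast
  from face_sets_subset[OF strict_placement_edge_face[OF s e(1) u] this]
  show ?thesis by (simp add: adjacent_def face_sets_def)
qed

lemma adjacent_nonempty: "I \<in> face_sets D \<Longrightarrow> adjacent D I \<noteq> {}"
proof -
  assume I: "I \<in> face_sets D"
  then obtain i where "i \<in> I" by (auto simp: face_sets_def)
  then have "insert i I = I" by blast
  then show "adjacent D I \<noteq> {}" using I by (auto simp: face_sets_def adjacent_def intro!: exI[of _ i])
qed

lemma local_degree_ge:
  "j \<in> adjacent D (snd \<alpha> v) \<Longrightarrow>
    \<omega> (snd \<alpha> v) j * ennreal \<bar>real_of_int (vsum (fst \<alpha>) v $ j)\<bar> \<le> local_degree D \<omega> \<alpha> v"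
  unfolding local_degree_def by (rule Max_ge) auto

text \<open>Semicontinuity of the degree. In a limit the carriers shrink, which makes the density
  smaller, and vertices are merged, which adds up their vectors \<open>\<sigma>\<close>. A coordinate in which some
  \<open>\<sigma>\<close> does not vanish belongs to a face containing the larger carrier, so the monotonicity of the
  density applies to it.\<close>

lemma degree_contraction:
  assumes s: "strict_placement D c \<alpha> h0" and pl: "placement D c \<alpha> h" and \<omega>: "simple_density D \<omega>"
    and cc: "curve_contraction \<phi> \<psi> (fst \<alpha>) h Z {} H k"
  shows "tropical_degree D \<omega> (H, \<lambda>x. supp (k x)) \<le> tropical_degree D \<omega> \<alpha>"
proof -
  let ?G = "fst \<alpha>"
  have w: "weak_curve D c ?G h" and sub: "\<And>v. v \<in> verts ?G \<Longrightarrow> supp (h v) \<subseteq> snd \<alpha> v"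
    using pl by (auto simp: placement_def)
  note wf = weak_curveD(1)[OF w]
  have con: "contraction \<phi> \<psi> ?G Z H" and k: "\<And>v. v \<in> verts ?G \<Longrightarrow> k (\<phi> v) = h v"
    using cc by (auto simp: curve_contraction_def)
  have "local_degree D \<omega> (H, \<lambda>x. supp (k x)) x \<le> (\<Sum>v\<in>fiber \<phi> ?G x. local_degree D \<omega> \<alpha> v)" if x: "x \<in> verts H" for x
  proof -
    obtain v0 where v0: "v0 \<in> verts ?G" "x = \<phi> v0" using x by (auto simp: contraction_verts[OF wf con])
    have F: "supp (k x) \<in> face_sets D"
      using supp_face[OF weak_curveD(2)[OF w v0(1)]] k[OF v0(1)] v0(2) by simp
    have bound: "\<omega> (supp (k x)) j * ennreal \<bar>real_of_int (vsum H x $ j)\<bar> \<le> (\<Sum>v\<in>fiber \<phi> ?G x. local_degree D \<omega> \<alpha> v)" for j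
    proof -
      have "\<bar>real_of_int (vsum H x $ j)\<bar> \<le> (\<Sum>v\<in>fiber \<phi> ?G x. \<bar>real_of_int (vsum ?G v $ j)\<bar>)"
        unfolding contraction_vsum[OF wf con] by simp
      then have "\<omega> (supp (k x)) j * ennreal \<bar>real_of_int (vsum H x $ j)\<bar>
          \<le> \<omega> (supp (k x)) j * ennreal (\<Sum>v\<in>fiber \<phi> ?G x. \<bar>real_of_int (vsum ?G v $ j)\<bar>)"
        by (intro mult_left_mono ennreal_leI) auto
      also have "\<dots> = (\<Sum>v\<in>fiber \<phi> ?G x. \<omega> (supp (k x)) j * ennreal \<bar>real_of_int (vsum ?G v $ j)\<bar>)"
        by (simp only: sum_ennreal[OF abs_ge_zero, symmetric] sum_distrib_left)
      also have "\<dots> \<le> (\<Sum>v\<in>fiber \<phi> ?G x. local_degree D \<omega> \<alpha> v)"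
      proof (rule sum_mono)
        fix v assume "v \<in> fiber \<phi> ?G x"
        then have v: "v \<in> verts ?G" "\<phi> v = x" by (auto simp: fiber_def)
        show "\<omega> (supp (k x)) j * ennreal \<bar>real_of_int (vsum ?G v $ j)\<bar> \<le> local_degree D \<omega> \<alpha> v"
        proof (cases "vsum ?G v $ j = 0")
          case False
          have j: "j \<in> adjacent D (snd \<alpha> v)" by (rule vsum_adjacent[OF s v(1) False])
          have "supp (k x) \<subseteq> snd \<alpha> v" using sub[OF v(1)] k[OF v(1)] v(2) by simp
          then have "\<omega> (supp (k x)) j \<le> \<omega> (snd \<alpha> v) j"
            using \<omega> F strict_placement_face[OF s v(1)] j unfolding simple_density_def by blast
          then have "\<omega> (supp (k x)) j * ennreal \<bar>real_of_int (vsum ?G v $ j)\<bar>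
              \<le> \<omega> (snd \<alpha> v) j * ennreal \<bar>real_of_int (vsum ?G v $ j)\<bar>"
            by (rule mult_right_mono) simp
          also have "\<dots> \<le> local_degree D \<omega> \<alpha> v" by (rule local_degree_ge[OF j])
          finally show ?thesis .
        qed simp
      qed
      finally show ?thesis .
    qed
    show ?thesis
      unfolding local_degree_def[of D \<omega> "(H, \<lambda>x. supp (k x))"] fst_conv snd_conv
      using bound adjacent_nonempty[OF F] by (intro Max.boundedI) auto
  qed
  then have "tropical_degree D \<omega> (H, \<lambda>x. supp (k x)) \<le> (\<Sum>x\<in>verts H. \<Sum>v\<in>fiber \<phi> ?G x. local_degree D \<omega> \<alpha> v)"
    unfolding tropical_degree_def by (simp add: sum_mono)
  also have "\<dots> = tropical_degree D \<omega> \<alpha>"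
    unfolding tropical_degree_def
    using sum.image_gen[OF wf_finite(1)[OF wf], of "local_degree D \<omega> \<alpha>" \<phi>]
    by (simp add: contraction_verts[OF wf con] fiber_def)
  finally show ?thesis .
qed

lemma smooths_vsum:
  assumes wf: "wgraph_wf G" and s: "smooths G v H" and x: "x \<in> verts H"
  shows "vsum H x = vsum (G :: 'i wgraph) x"
proof -
  have rem: "removable G v" and vH: "verts H = verts G - {v}" using s by (auto simp: smooths_def)
  obtain e where e: "e \<in> incident G v"
    using rem by (fastforce simp: removable_def card_2_iff)
  obtain \<phi> \<psi> where *: "contraction \<phi> \<psi> G {e} H" "\<forall>w\<in>verts G - {v}. \<phi> w = w"
    "\<forall>h :: nat \<Rightarrow> real^'i. curve_contraction \<phi> \<psi> G h {e} {v} H h"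
    by (rule smoothsE[OF s e])
  have fin: "finite (fiber \<phi> G x)" by (rule fiber_finite[OF wf])
  have "vsum H x = (\<Sum>w\<in>fiber \<phi> G x. vsum G w)" by (rule contraction_vsum[OF wf *(1)])
  also have "\<dots> = (\<Sum>w\<in>{x}. vsum G w)"
  proof (rule sum.mono_neutral_right[OF fin])
    show "{x} \<subseteq> fiber \<phi> G x" using x *(2) vH by (auto simp: fiber_def)
    show "\<forall>w\<in>fiber \<phi> G x - {x}. vsum G w = 0"
    proof
      fix w assume w: "w \<in> fiber \<phi> G x - {x}"
      then have "w \<in> verts G" "\<phi> w = x" "w \<noteq> x" by (auto simp: fiber_def)
      then have "w = v" using *(2) by (metis DiffI singletonD)
      then show "vsum G w = 0" using rem by (simp add: removable_def)
    qed
  qed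
  finally show ?thesis by simp
qed

text \<open>A removed vertex contributes nothing to the degree, and the vectors \<open>\<sigma>\<close> of the others do not change.\<close>

lemma smooth_steps_degree:
  assumes "smooth_step\<^sup>*\<^sup>* G H" "param_curve D c (G, h)"
  shows "tropical_degree D \<omega> (H, \<lambda>v. supp (h v)) \<le> tropical_degree D \<omega> (G, \<lambda>v. supp (h v))"
  using assms
proof (induction rule: rtranclp_induct)
  case (step H K)
  then have p: "param_curve D c (H, h)" using smooth_steps_invariants[OF c] by blast
  obtain v where v: "smooths H v K" by (rule param_smooth_step[OF c p step.hyps(2)])
  note wf = param_curve_wf[OF c p]
  have "tropical_degree D \<omega> (K, \<lambda>v. supp (h v)) = (\<Sum>x\<in>verts K. local_degree D \<omega> (H, \<lambda>v. supp (h v)) x)"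
    unfolding tropical_degree_def local_degree_def using smooths_vsum[OF wf v] by (auto intro!: sum.cong)
  also have "\<dots> \<le> tropical_degree D \<omega> (H, \<lambda>v. supp (h v))"
    unfolding tropical_degree_def using smooths_invariants(4)[OF c wf v] wf_finite(1)[OF wf]
    by (auto intro: sum_mono2)
  finally show ?case using step.IH[OF step.prems] by simp
qed simp

lemma normal_form_simple_curve:
  assumes \<alpha>: "\<alpha> \<in> good_types D c \<omega> g n A" and \<omega>: "simple_density D \<omega>"
    and pl: "placement D c \<alpha> h" and n: "normal_form (fst \<alpha>) h K k"
  shows "(K, k) \<in> simple_curves D c \<omega> g n A"
proof -
  have w: "weak_curve D c (fst \<alpha>) h" using pl by (simp add: placement_def)
  obtain h0 where h0: "strict_placement D c \<alpha> h0" using \<alpha> by (auto simp: good_types_iff)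
  obtain \<phi> \<psi> G' where cc: "curve_contraction \<phi> \<psi> (fst \<alpha>) h (zero_edges (fst \<alpha>) h) {} G' k" and s: "simplification G' K"
    using n by (auto simp: normal_form_def)
  have p: "param_curve D c (G', k)" by (rule zero_contraction_param[OF c w cc])
  note inv = normal_form_invariants[OF c w n]
  have "tropical_degree D \<omega> (type_of_curve D c (K, k)) = tropical_degree D \<omega> (K, \<lambda>v. supp (k v))"
    by (rule type_of_curve_degree[OF inv(1)])
  also have "\<dots> \<le> tropical_degree D \<omega> (G', \<lambda>v. supp (k v))"
    using smooth_steps_degree[OF _ p] s by (simp add: simplification_def)
  also have "\<dots> \<le> tropical_degree D \<omega> \<alpha>" by (rule degree_contraction[OF h0 pl \<omega> cc])
  also have "\<dots> \<le> ennreal A" using \<alpha> by (simp add: good_types_iff)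
  finally show ?thesis
    using inv \<alpha> by (simp add: simple_curves_def good_types_iff)
qed

lemma moduli_class:
  assumes "C \<in> simple_curves D c \<omega> g n A"
  shows "curve_iso_rel D c `` {C} \<in> moduli D c \<omega> g n A"
  unfolding moduli_def using assms by (rule quotientI)

lemma contract_verts_subset:
  assumes wf: "wgraph_wf G" and Z: "Z \<subseteq> edges G"
  shows "verts (contract G Z) \<subseteq> verts G"
proof
  fix x assume "x \<in> verts (contract G Z)"
  then obtain v where v: "v \<in> verts G" "x = Min (component G Z v)" by (auto simp: contract_def Let_def)
  have sub: "component G Z v \<subseteq> verts G"
    using joined_verts[OF wf _ Z v(1)] by (auto simp: component_def)
  then have "finite (component G Z v)" using wf_finite(1)[OF wf] finite_subset by blast
  moreover have "v \<in> component G Z v" by (simp add: component_def)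
  ultimately have "x \<in> component G Z v" using v(2) Min_in by blast
  then show "x \<in> verts G" using sub by blast
qed

lemma realizes_unique:
  assumes wf: "wgraph_wf G" and 1: "realizes G p h" and 2: "realizes G p k" and v: "v \<in> verts G"
  shows "k v = h v"
proof -
  have "root G \<in> verts G" unfolding root_def using wf_nonempty[OF wf] by (simp add: some_in_eq)
  then have "(root G, v) \<in> joined (ends G) (edges G)" using wf_connected[OF wf] v by blast
  then show ?thesis
  proof (induction rule: joined_induct)
    case base
    then show ?case using 1 2 by (simp add: realizes_def)
  next
    case (step x y e)
    have "h y - h x = k y - k x" using 1 2 step.hyps by (simp add: realizes_def)
    then show ?case using step.IH by simp
  qed
qed

lemma realizes_zero_edges:
  assumes wf: "wgraph_wf G" and r: "realizes G p h"
  shows "{e \<in> edges G. snd p e = 0} = zero_edges G h"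
proof -
  have "snd p e = 0 \<longleftrightarrow> e \<in> zero_edges G h" if e: "e \<in> edges G" for e
  proof -
    obtain u v where uv: "ends G e = {u, v}" "wt G u e \<noteq> 0" using wf_edgeE[OF wf e] by metis
    have "h v - h u = (snd p e / norm (real_vec (wt G u e))) *\<^sub>R real_vec (wt G u e)"
      using r e uv by (simp add: realizes_def)
    then have "h u = h v \<longleftrightarrow> snd p e = 0" using uv(2) by (metis (no_types) divide_eq_0_iff eq_iff_diff_eq_0 norm_eq_zero real_vec_simps(2) scaleR_eq_0_iff)
    then show ?thesis using zero_edges_iff[OF e uv(1)] by blast
  qed
  then show ?thesis using zero_edges_subset by blast
qed

text \<open>Neither the choice of the simplification nor the positions of numbers that are not vertices matter, so
  the value of the attaching map is a single isomorphism class.\<close>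

lemma attaching_map_eq:
  assumes w: "weak_curve D c (fst \<alpha>) h" and r: "realizes (fst \<alpha>) p h" and n: "normal_form (fst \<alpha>) h K k"
  shows "attaching_map D c \<alpha> p = curve_iso_rel D c `` {(K, k)}"
proof -
  let ?G = "fst \<alpha>" and ?R = "curve_iso_rel D c"
  note wf = weak_curveD(1)[OF w]
  have Z: "{e \<in> edges ?G. snd p e = 0} = zero_edges ?G h" by (rule realizes_zero_edges[OF wf r])
  have eq: "?R `` {(H, h')} = ?R `` {(K, k)}"
    if r': "realizes ?G p h'" and H: "simplification (contract ?G (zero_edges ?G h)) H" for h' H
  proof -
    have nH: "normal_form ?G h H h" by (rule normal_form_contract[OF c w H])
    have iso: "curve_iso (H, h) (K, k)" by (rule normal_form_unique[OF c w nH n])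
    have p: "param_curve D c (H, h)" "param_curve D c (K, k)"
      using normal_form_invariants(1)[OF c w] nH n by blast+
    have pc: "param_curve D c (contract ?G (zero_edges ?G h), h)"
      by (rule zero_contraction_param[OF c w zero_contract[OF c w]])
    have "verts H \<subseteq> verts ?G"
      using smooth_steps_invariants[OF c _ pc, of H] H contract_verts_subset[OF wf zero_edges_subset]
      unfolding simplification_def by blast
    then have "h' v = h v" if "v \<in> verts H" for v using realizes_unique[OF wf r r'] that by blast
    then have cc: "curve_contraction (\<lambda>v. v) (\<lambda>e. e) H h {} {} H h'"
      by (intro curve_contraction_iso[OF param_curve_wf[OF c p(1)]]) (auto simp: wgraph_iso_def bij_betw_def)
    have "weak_curve D c H h" "zero_edges H h = {}" using p param_curve_iff[OF c] by auto
    then have p': "param_curve D c (H, h')" using zero_contraction_param[OF c] cc by metis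
    have "curve_iso (H, h) (H, h')"
      using \<open>\<And>v. v \<in> verts H \<Longrightarrow> h' v = h v\<close> unfolding curve_iso_def
      by (intro exI[of _ "\<lambda>v. v"]) (auto simp: wgraph_iso_def bij_betw_def)
    then have "((H, h), (H, h')) \<in> ?R" "((H, h), (K, k)) \<in> ?R"
      using p p' iso by (auto simp: curve_iso_rel_def)
    then have "((H, h'), (K, k)) \<in> ?R"
      using equiv_curve_iso_rel unfolding equiv_def by (meson symD transD)
    then show ?thesis by (rule equiv_class_eq[OF equiv_curve_iso_rel])
  qed
  have "attaching_map D c \<alpha> p = (\<Union>{?R `` {(H, h')} | h' H. realizes ?G p h' \<and>
      simplification (contract ?G (zero_edges ?G h)) H})"
    unfolding attaching_map_def Z by blast
  also have "\<dots> = ?R `` {(K, k)}"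
  proof -
    obtain H where "simplification (contract ?G (zero_edges ?G h)) H" using normal_form_exists[OF c w] by metis
    then show ?thesis using eq r by blast
  qed
  finally show ?thesis .
qed

end

section \<open>Finiteness of the set of combinatorial types\<close>

lemma handshake:
  assumes wf: "wgraph_wf G"
  shows "(\<Sum>v\<in>verts G. card (incident G v)) = 2 * card (edges G)"
proof -
  have fin: "finite (verts G)" "finite (edges G)" using wf_finite[OF wf] by auto
  have "(\<Sum>v\<in>verts G. card (incident G v)) = (\<Sum>v\<in>verts G. \<Sum>e\<in>edges G. if v \<in> ends G e then 1 else 0)"
    unfolding incident_def using fin by (simp add: sum.If_cases Int_def)
  also have "\<dots> = (\<Sum>e\<in>edges G. \<Sum>v\<in>verts G. if v \<in> ends G e then 1 else 0)"
    by (rule sum.swap)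
  also have "\<dots> = (\<Sum>e\<in>edges G. 2)"
  proof (rule sum.cong[OF refl])
    fix e assume e: "e \<in> edges G"
    have "verts G \<inter> {v. v \<in> ends G e} = ends G e" using wf_ends(1)[OF wf e] by blast
    then show "(\<Sum>v\<in>verts G. if v \<in> ends G e then 1 else 0) = (2::nat)"
      using fin wf_ends(2)[OF wf e] by (simp add: sum.If_cases)
  qed
  finally show ?thesis by simp
qed

lemma incident_nonempty:
  assumes wf: "wgraph_wf G" and v: "v \<in> verts G" and V: "card (verts G) \<noteq> 1"
  shows "incident G v \<noteq> {}"
proof
  assume inc: "incident G v = {}"
  have "w = v" if "w \<in> verts G" for w
    using wf_connected[OF wf v that]
  proof (induction rule: joined_induct)
    case (step x y e)
    then have "e \<in> incident G v" by (auto simp: incident_def)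
    then show ?case using inc by blast
  qed simp
  then have "verts G = {v}" using v by blast
  then show False using V by simp
qed

text \<open>In a simple graph with more than one vertex, only the vertices of type A, the marked ones and those
  of positive genus can have degree less than three, and the genus bounds the number of the others.\<close>

lemma card_verts_bound:
  fixes G :: "('i::finite) wgraph"
  assumes wf: "wgraph_wf G" and sim: "simple_wgraph G"
    and a: "card {v \<in> verts G. vsum G v \<noteq> 0} \<le> a"
  shows "card (verts G) \<le> 1 + 2 * genus G + 3 * (a + length (marks G) + genus G)"
    "card (edges G) \<le> genus G + card (verts G)"
proof -
  let ?X = "{v \<in> verts G. vsum G v \<noteq> 0} \<union> (set (marks G) \<union> {v \<in> verts G. gen G v > 0})"
  let ?Y = "verts G - ?X"
  have fin: "finite (verts G)" "finite (edges G)" using wf_finite[OF wf] by auto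
  have gen: "(\<Sum>v\<in>verts G. gen G v) \<le> genus G" by (simp add: genus_def)
  have "int (card (edges G)) + 1 - int (card (verts G)) \<le> int (genus G)"
    using int_genus[OF wf] by (simp add: sum_nonneg)
  then have E: "card (edges G) + 1 \<le> genus G + card (verts G)" by linarith
  then show "card (edges G) \<le> genus G + card (verts G)" by simp
  have "card {v \<in> verts G. gen G v > 0} \<le> (\<Sum>v\<in>{v \<in> verts G. gen G v > 0}. gen G v)"
    using sum_mono[of "{v \<in> verts G. gen G v > 0}" "\<lambda>_. 1" "gen G"] by simp
  also have "\<dots> \<le> (\<Sum>v\<in>verts G. gen G v)" using fin by (intro sum_mono2) auto
  finally have g: "card {v \<in> verts G. gen G v > 0} \<le> genus G" using gen by simp
  have X: "card ?X \<le> a + (length (marks G) + genus G)"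
    using card_Un_le[of "{v \<in> verts G. vsum G v \<noteq> 0}" "set (marks G) \<union> {v \<in> verts G. gen G v > 0}"]
      card_Un_le[of "set (marks G)" "{v \<in> verts G. gen G v > 0}"] card_length[of "marks G"] a g by linarith
  have Xsub: "?X \<subseteq> verts G" using wf_marks[OF wf] by auto
  show "card (verts G) \<le> 1 + 2 * genus G + 3 * (a + length (marks G) + genus G)"
  proof (cases "card (verts G) = 1")
    case False
    have three: "3 \<le> card (incident G v)" if v: "v \<in> ?Y" for v
    proof -
      have 0: "card (incident G v) \<noteq> 0"
        using incident_nonempty[OF wf _ False, of v] finite_incident[OF wf] v by auto
      have 1: "card (incident G v) \<noteq> 1"
      proof
        assume "card (incident G v) = 1"
        then obtain e where e: "incident G v = {e}" by (auto simp: card_1_singleton_iff)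
        then have "e \<in> edges G" "v \<in> ends G e" by (auto simp: incident_def)
        then have "wt G v e \<noteq> 0" using wf_wt[OF wf] by blast
        moreover have "vsum G v = wt G v e" by (simp add: vsum_def e)
        moreover have "vsum G v = 0" using v by blast
        ultimately show False by simp
      qed
      have 2: "card (incident G v) \<noteq> 2"
        using v sim by (auto simp: simple_wgraph_def removable_def)
      show ?thesis using 0 1 2 by linarith
    qed
    have "3 * card ?Y = (\<Sum>v\<in>?Y. 3)" by simp
    also have "\<dots> \<le> (\<Sum>v\<in>?Y. card (incident G v))" using three by (intro sum_mono) blast
    also have "\<dots> \<le> (\<Sum>v\<in>verts G. card (incident G v))" using fin by (intro sum_mono2) auto
    also have "\<dots> = 2 * card (edges G)" by (rule handshake[OF wf])
    finally have Y: "3 * card ?Y \<le> 2 * card (edges G)" .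
    have V: "card (verts G) = card ?X + card ?Y"
      using card_Diff_subset[OF finite_subset[OF Xsub fin(1)] Xsub] card_mono[OF fin(1) Xsub] by linarith
    have "v \<le> 1 + 2 * k + 3 * s"
      if "3 * y \<le> 2 * e" "v = x + y" "e + 1 \<le> k + v" "x \<le> s" for x y e v k s :: nat
      using that by linarith
    from this[OF Y V E X] show ?thesis by (simp only: add.assoc)
  qed simp
qed

text \<open>A parametrized curve maps the flow of weights uphill in every coordinate. Hence the weight of
  an edge is at most the flow out of the sublevel set of its lower end, that is, at most the sum of
  the vectors \<open>\<sigma>\<close> over this set.\<close>

lemma weight_bound:
  assumes c: "0 < c" and p: "param_curve D c (G, h)"
    and e: "e \<in> edges G" "u \<in> ends G e" and pos: "wt G u e $ i > 0"
  shows "wt G u e $ i \<le> (\<Sum>x\<in>verts G. \<bar>vsum G x $ i\<bar>)"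
proof -
  have w: "weak_curve D c G h" and z: "zero_edges G h = {}" using p param_curve_iff[OF c] by auto
  note wf = weak_curveD(1)[OF w]
  have fin: "finite (verts G)" "finite (edges G)" using wf_finite[OF wf] by auto
  define S where "S = {x \<in> verts G. h x $ i \<le> h u $ i}"
  have finS: "finite S" using fin by (simp add: S_def)
  let ?F = "\<lambda>f. \<Sum>x\<in>ends G f \<inter> S. wt G x f $ i"
  have up: "\<exists>t>0. h y $ i - h x $ i = t * real_of_int (wt G x f $ i)"
    if f: "f \<in> edges G" "ends G f = {x, y}" for f x y
  proof -
    obtain t where t: "t \<ge> 0" "h y - h x = t *\<^sub>R real_vec (wt G x f)"
      using weak_curveD(4)[OF w f] by blast
    have "h x \<noteq> h y" using zero_edges_iff[OF f] z by blast
    then have "t \<noteq> 0" using t by auto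
    moreover have "(h y - h x) $ i = t * real_of_int (wt G x f $ i)" using t(2) by simp
    ultimately show ?thesis using t(1) by (intro exI[of _ t]) simp
  qed
  have nonneg: "?F f \<ge> 0" if f: "f \<in> edges G" for f
  proof -
    obtain a b where ab: "ends G f = {a, b}" "a \<noteq> b" "a \<in> verts G" "b \<in> verts G" "wt G b f = - wt G a f"
      using wf_edgeE[OF wf f] by metis
    obtain t where t: "t > 0" "h b $ i - h a $ i = t * real_of_int (wt G a f $ i)" using up[OF f ab(1)] by blast
    consider "a \<in> S" "b \<in> S" | "a \<in> S" "b \<notin> S" | "a \<notin> S" "b \<in> S" | "a \<notin> S" "b \<notin> S" by blast
    then show ?thesis
    proof cases
      case 1
      then show ?thesis using ab by simp
    next
      case 2
      then have "0 < t * real_of_int (wt G a f $ i)" using ab t(2) by (auto simp: S_def)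
      then have "0 < wt G a f $ i" using t(1) by (simp add: zero_less_mult_iff)
      then show ?thesis using 2 ab by simp
    next
      case 3
      then have "t * real_of_int (wt G a f $ i) < 0" using ab t(2) by (auto simp: S_def)
      then have "wt G a f $ i < 0" using t(1) by (simp add: mult_less_0_iff)
      then show ?thesis using 3 ab by simp
    next
      case 4
      then show ?thesis using ab by simp
    qed
  qed
  have Fe: "?F e = wt G u e $ i"
  proof -
    obtain v where v: "ends G e = {u, v}"
      using wf_ends(2)[OF wf e(1)] e(2) unfolding card_2_iff by (metis insertE insert_commute singletonD)
    have uV: "u \<in> verts G" using wf_ends_verts[OF wf e(1) v] by simp
    obtain t where t: "t > 0" "h v $ i - h u $ i = t * real_of_int (wt G u e $ i)" using up[OF e(1) v] by blast
    have "0 < t * real_of_int (wt G u e $ i)" using t(1) pos by simp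
    then have "v \<notin> S" "u \<in> S" using t(2) uV by (auto simp: S_def)
    then have "ends G e \<inter> S = {u}" using v by auto
    then show ?thesis by simp
  qed
  have "(\<Sum>x\<in>S. vsum G x $ i) = (\<Sum>x\<in>S. \<Sum>f\<in>edges G. if x \<in> ends G f then wt G x f $ i else 0)"
    unfolding vsum_def incident_def using fin by (auto simp: sum.inter_filter intro!: sum.cong)
  also have "\<dots> = (\<Sum>f\<in>edges G. \<Sum>x\<in>S. if x \<in> ends G f then wt G x f $ i else 0)"
    by (rule sum.swap)
  also have "\<dots> = (\<Sum>f\<in>edges G. ?F f)"
    by (rule sum.cong[OF refl]) (simp add: sum.inter_restrict[OF finS, symmetric] Int_commute)
  finally have S: "(\<Sum>x\<in>S. vsum G x $ i) = (\<Sum>f\<in>edges G. ?F f)" .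
  have "wt G u e $ i = (\<Sum>f\<in>{e}. ?F f)" using Fe by simp
  also have "\<dots> \<le> (\<Sum>f\<in>edges G. ?F f)" using fin e nonneg by (intro sum_mono2) auto
  also have "\<dots> \<le> (\<Sum>x\<in>S. \<bar>vsum G x $ i\<bar>)" unfolding S[symmetric] by (intro sum_mono) auto
  also have "\<dots> \<le> (\<Sum>x\<in>verts G. \<bar>vsum G x $ i\<bar>)" using fin by (intro sum_mono2) (auto simp: S_def)
  finally show ?thesis .
qed

lemma density_lower_bound:
  fixes D :: "'i::finite \<Rightarrow> 'p set"
  assumes "simple_density D \<omega>"
  obtains \<delta> :: real where "0 < \<delta>" "\<And>I j. I \<in> face_sets D \<Longrightarrow> j \<in> adjacent D I \<Longrightarrow> ennreal \<delta> \<le> \<omega> I j"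
proof -
  define S where "S = insert 1 {\<omega> I j | I j. I \<in> face_sets D \<and> j \<in> adjacent D I}"
  have "finite {\<omega> I j | I j. I \<in> face_sets D \<and> j \<in> adjacent D I}"
    by (rule finite_subset[of _ "(\<lambda>(I, j). \<omega> I j) ` UNIV"]) auto
  then have fin: "finite S" by (simp add: S_def)
  have "0 < x" if "x \<in> S" for x using that assms by (auto simp: S_def simple_density_def)
  then have m: "0 < Min S" "Min S \<le> 1" using fin by (auto simp: S_def)
  then have "Min S < \<infinity>" by (metis ennreal_one_less_top infinity_ennreal_def order_le_less_trans)
  then have e: "ennreal (enn2real (Min S)) = Min S" by simp
  have "0 < enn2real (Min S)" using m e by (metis enn2real_nonneg ennreal_0 less_le order.strict_iff_order)
  moreover have "ennreal (enn2real (Min S)) \<le> \<omega> I j" if "I \<in> face_sets D" "j \<in> adjacent D I" for I j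
    unfolding e using fin that by (intro Min_le) (auto simp: S_def)
  ultimately show thesis using that by blast
qed

lemma vsum_bound:
  fixes D :: "'i::finite \<Rightarrow> 'p set"
  assumes c: "0 < c" and \<delta>: "0 < \<delta>" "\<And>I j. I \<in> face_sets D \<Longrightarrow> j \<in> adjacent D I \<Longrightarrow> ennreal \<delta> \<le> \<omega> I j"
    and s: "strict_placement D c \<alpha> h" and A: "0 < A" "tropical_degree D \<omega> \<alpha> \<le> ennreal A"
  shows "(\<Sum>v\<in>verts (fst \<alpha>). \<bar>real_of_int (vsum (fst \<alpha>) v $ j)\<bar>) \<le> A / \<delta>"
proof -
  have "ennreal \<delta> * ennreal \<bar>real_of_int (vsum (fst \<alpha>) v $ j)\<bar> \<le> local_degree D \<omega> \<alpha> v"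
    if v: "v \<in> verts (fst \<alpha>)" for v
  proof (cases "vsum (fst \<alpha>) v $ j = 0")
    case False
    have j: "j \<in> adjacent D (snd \<alpha> v)" by (rule vsum_adjacent[OF c s v False])
    have "ennreal \<delta> \<le> \<omega> (snd \<alpha> v) j" by (rule \<delta>(2)[OF strict_placement_face[OF c s v] j])
    then show ?thesis using local_degree_ge[OF c j] by (meson mult_right_mono order_trans zero_le)
  qed simp
  then have "(\<Sum>v\<in>verts (fst \<alpha>). ennreal \<delta> * ennreal \<bar>real_of_int (vsum (fst \<alpha>) v $ j)\<bar>) \<le> tropical_degree D \<omega> \<alpha>"
    unfolding tropical_degree_def by (rule sum_mono)
  then have "ennreal \<delta> * ennreal (\<Sum>v\<in>verts (fst \<alpha>). \<bar>real_of_int (vsum (fst \<alpha>) v $ j)\<bar>) \<le> ennreal A"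
    using A(2) by (simp only: sum_distrib_left[symmetric] sum_ennreal[OF abs_ge_zero])
  then have "ennreal (\<delta> * (\<Sum>v\<in>verts (fst \<alpha>). \<bar>real_of_int (vsum (fst \<alpha>) v $ j)\<bar>)) \<le> ennreal A"
    using \<delta>(1) by (simp add: ennreal_mult sum_nonneg)
  then have "\<delta> * (\<Sum>v\<in>verts (fst \<alpha>). \<bar>real_of_int (vsum (fst \<alpha>) v $ j)\<bar>) \<le> A"
    using A(1) by (simp add: ennreal_le_iff)
  then show ?thesis using \<delta>(1) by (simp add: field_simps)
qed

definition bounded_type :: "nat \<Rightarrow> int \<Rightarrow> nat \<Rightarrow> ('i::finite) ctype \<Rightarrow> bool" where
  "bounded_type N b n \<alpha> \<longleftrightarrow> comb_type \<alpha> \<and> card (verts (fst \<alpha>)) \<le> N \<and> card (edges (fst \<alpha>)) \<le> N \<and>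
     (\<forall>e\<in>edges (fst \<alpha>). \<forall>v\<in>ends (fst \<alpha>) e. \<forall>i. \<bar>wt (fst \<alpha>) v e $ i\<bar> \<le> b) \<and>
     (\<forall>v\<in>verts (fst \<alpha>). gen (fst \<alpha>) v \<le> N) \<and> length (marks (fst \<alpha>)) = n"

text \<open>Relabelling the vertices and edges by initial segments, and normalizing the irrelevant data,
  leaves only finitely many possibilities.\<close>

lemma finite_bounded_types:
  assumes b: "0 \<le> b"
  shows "finite ({\<alpha> :: ('i::finite) ctype. bounded_type N b n \<alpha>} // ctype_iso_rel)"
proof -
  \<comment> \<open>Data outside the ranges of the labels take the default values \<open>{}\<close> and \<open>0\<close>.\<close>
  let ?Wv = "{w :: int^'i. \<forall>i. w $ i \<in> {-b..b}}"
  let ?fun = "\<lambda>(B :: _ set) d. {f. \<forall>x::nat. (x \<in> {..<N} \<longrightarrow> f x \<in> B) \<and> (x \<notin> {..<N} \<longrightarrow> f x = d)}"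
  have "finite {f :: 'i \<Rightarrow> int. \<forall>i. (i \<in> UNIV \<longrightarrow> f i \<in> {-b..b}) \<and> (i \<notin> UNIV \<longrightarrow> f i = 0)}"
    by (rule finite_set_of_finite_funs) auto
  then have "finite (vec_lambda ` {f :: 'i \<Rightarrow> int. \<forall>i. f i \<in> {-b..b}})" by simp
  moreover have "?Wv \<subseteq> vec_lambda ` {f :: 'i \<Rightarrow> int. \<forall>i. f i \<in> {-b..b}}"
  proof
    fix w :: "int^'i" assume "w \<in> ?Wv"
    then show "w \<in> vec_lambda ` {f :: 'i \<Rightarrow> int. \<forall>i. f i \<in> {-b..b}}"
      by (intro image_eqI[of _ _ "($) w"]) auto
  qed
  ultimately have Wv: "finite ?Wv" by (rule finite_subset[rotated])
  let ?W = "?fun (?fun ?Wv 0) (\<lambda>_. 0)"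
  let ?T = "Pow {..<N} \<times> Pow {..<N} \<times> ?fun (Pow {..<N}) {} \<times> ?W \<times> ?fun {..N} 0 \<times>
      {xs. set xs \<subseteq> {..<N} \<and> length xs = n} \<times> ?fun (UNIV :: 'i set set) {}"
  let ?mk = "\<lambda>(V, E, en, w, g, m, I). (\<lparr>verts = V, edges = E, ends = en, wt = w, gen = g, marks = m\<rparr>, I) :: 'i ctype"
  have "finite ?T"
    by (intro finite_cartesian_product finite_set_of_finite_funs Wv finite_lists_length_eq) auto
  then have fin: "finite ((\<lambda>\<beta>. ctype_iso_rel `` {\<beta>}) ` ?mk ` ?T)" by simp
  have "{\<alpha> :: 'i ctype. bounded_type N b n \<alpha>} // ctype_iso_rel \<subseteq> (\<lambda>\<beta>. ctype_iso_rel `` {\<beta>}) ` ?mk ` ?T"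
  proof
    fix a assume "a \<in> {\<alpha> :: 'i ctype. bounded_type N b n \<alpha>} // ctype_iso_rel"
    then obtain G I where a: "a = ctype_iso_rel `` {(G, I)}" and bd: "bounded_type N b n (G, I :: nat \<Rightarrow> 'i set)"
      by (auto simp: quotient_def)
    have wf: "wgraph_wf G" and I: "\<And>v. v \<in> verts G \<Longrightarrow> I v \<noteq> {}"
      using bd by (auto simp: bounded_type_def comb_type_def)
    obtain \<phi> where \<phi>: "bij_betw \<phi> (verts G) {0..<card (verts G)}"
      using ex_bij_betw_finite_nat[OF wf_finite(1)[OF wf]] by blast
    obtain \<psi> where \<psi>: "bij_betw \<psi> (edges G) {0..<card (edges G)}"
      using ex_bij_betw_finite_nat[OF wf_finite(2)[OF wf]] by blast
    let ?k = "card (verts G)" and ?m = "card (edges G)"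
    have kN: "?k \<le> N" "?m \<le> N" using bd by (auto simp: bounded_type_def)
    define p where "p = inv_into (verts G) \<phi>"
    define q where "q = inv_into (edges G) \<psi>"
    have p: "p (\<phi> v) = v" if "v \<in> verts G" for v using \<phi> that by (simp add: p_def bij_betw_def)
    have q: "q (\<psi> e) = e" if "e \<in> edges G" for e using \<psi> that by (simp add: q_def bij_betw_def)
    have pV: "p x \<in> verts G" if "x < ?k" for x
      using \<phi> that by (metis atLeast0LessThan bij_betw_def inv_into_into lessThan_iff p_def)
    have qE: "q x \<in> edges G" if "x < ?m" for x
      using \<psi> that by (metis atLeast0LessThan bij_betw_def inv_into_into lessThan_iff q_def)
    have \<phi>lt: "\<phi> v < ?k" if "v \<in> verts G" for v using \<phi> that by (auto simp: bij_betw_def)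
    have \<psi>lt: "\<psi> e < ?m" if "e \<in> edges G" for e using \<psi> that by (auto simp: bij_betw_def)
    define en where "en f = (if f < ?m then \<phi> ` ends G (q f) else {})" for f
    define w where "w x f = (if f < ?m \<and> x \<in> en f then wt G (p x) (q f) else 0)" for x f
    define H where "H = \<lparr>verts = {0..<?k}, edges = {0..<?m}, ends = en, wt = w,
      gen = (\<lambda>x. if x < ?k then gen G (p x) else 0), marks = map \<phi> (marks G)\<rparr>"
    define J where "J x = (if x < ?k then I (p x) else {})" for x
    have iso: "wgraph_iso \<phi> \<psi> G H"
      unfolding wgraph_iso_def
    proof (intro conjI ballI)
      fix e assume e: "e \<in> edges G"
      show "ends H (\<psi> e) = \<phi> ` ends G e" using \<psi>lt[OF e] q[OF e] by (simp add: H_def en_def)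
      show "wt H (\<phi> v) (\<psi> e) = wt G v e" if v: "v \<in> ends G e" for v
      proof -
        have "v \<in> verts G" using wf_ends(1)[OF wf e] v by blast
        then show ?thesis using \<psi>lt[OF e] q[OF e] p v by (simp add: H_def w_def en_def)
      qed
    qed (use \<phi> \<psi> \<phi>lt p in \<open>auto simp: H_def\<close>)
    have "ctype_iso (G, I) (H, J)"
      unfolding ctype_iso_def ctype_iso_via_def using iso \<phi>lt p by (auto simp: J_def)
    moreover have "comb_type (H, J)"
      using wgraph_iso_wf[OF wf iso] I pV by (auto simp: comb_type_def H_def J_def)
    moreover have "comb_type (G, I)" using bd by (simp add: bounded_type_def)
    ultimately have "((G, I), (H, J)) \<in> ctype_iso_rel" by (simp add: ctype_iso_rel_def)
    then have "a = ctype_iso_rel `` {(H, J)}"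
      unfolding a by (rule equiv_class_eq[OF equiv_ctype_iso_rel])
    moreover have "(H, J) \<in> ?mk ` ?T"
    proof (rule image_eqI)
      show "(H, J) = ?mk ({0..<?k}, {0..<?m}, en, w, (\<lambda>x. if x < ?k then gen G (p x) else 0), map \<phi> (marks G), J)"
        by (simp add: H_def)
      have en: "en f \<subseteq> {..<N}" for f
      proof (cases "f < ?m")
        case True
        then show ?thesis using wf_ends(1)[OF wf qE[OF True]] \<phi>lt kN by (fastforce simp: en_def)
      qed (simp add: en_def)
      have wb: "w x f \<in> ?Wv" for x f
      proof (cases "f < ?m \<and> x \<in> en f")
        case True
        then obtain v where v: "v \<in> ends G (q f)" "x = \<phi> v" by (auto simp: en_def)
        have e: "q f \<in> edges G" using True qE by blast
        have "w x f = wt G v (q f)" using True v p wf_ends(1)[OF wf e] by (auto simp: w_def)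
        moreover have "\<bar>wt G v (q f) $ i\<bar> \<le> b" for i using bd e v by (auto simp: bounded_type_def)
        ultimately show ?thesis by (auto simp: abs_le_iff minus_le_iff)
      next
        case False
        then have "w x f = 0" by (auto simp: w_def)
        then show ?thesis using b by simp
      qed
      have w0: "w x f = 0" if "N \<le> x \<or> N \<le> f" for x f
        using that en[of f] kN by (auto simp: w_def)
      have "w \<in> ?W"
        using wb w0 by auto
      moreover have "en \<in> ?fun (Pow {..<N}) {}" using en kN by (auto simp: en_def)
      moreover have "(\<lambda>x. if x < ?k then gen G (p x) else 0) \<in> ?fun {..N} 0"
        using bd pV kN by (auto simp: bounded_type_def)
      moreover have "map \<phi> (marks G) \<in> {xs. set xs \<subseteq> {..<N} \<and> length xs = n}"
        using bd wf_marks[OF wf] \<phi>lt kN by (fastforce simp: bounded_type_def)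
      moreover have "J \<in> ?fun (UNIV :: 'i set set) {}" using kN by (auto simp: J_def)
      moreover have "{0..<?k} \<in> Pow {..<N}" "{0..<?m} \<in> Pow {..<N}" using kN by auto
      ultimately show "({0..<?k}, {0..<?m}, en, w, (\<lambda>x. if x < ?k then gen G (p x) else 0), map \<phi> (marks G), J) \<in> ?T"
        by (intro SigmaI)
    qed
    ultimately show "a \<in> (\<lambda>\<beta>. ctype_iso_rel `` {\<beta>}) ` ?mk ` ?T" by blast
  qed
  then show ?thesis using fin by (rule finite_subset)
qed

theorem finite_good_types:
  fixes D :: "'i::finite \<Rightarrow> 'p set"
  assumes c: "0 < c" and \<omega>: "simple_density D \<omega>" and A: "0 < A"
  shows "finite (good_types D c \<omega> g n A // ctype_iso_rel)"
proof -
  obtain \<delta> where \<delta>: "0 < \<delta>" "\<And>I j. I \<in> face_sets D \<Longrightarrow> j \<in> adjacent D I \<Longrightarrow> ennreal \<delta> \<le> \<omega> I j"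
    using density_lower_bound[OF \<omega>] by blast
  define b where "b = \<lfloor>A / \<delta>\<rfloor>"
  have b0: "0 \<le> b" using A \<delta>(1) by (simp add: b_def)
  define a where "a = CARD('i) * nat b"
  define N where "N = g + (1 + 2 * g + 3 * (a + n + g))"
  have "bounded_type N b n \<alpha>" if \<alpha>: "\<alpha> \<in> good_types D c \<omega> g n A" for \<alpha>
  proof -
    let ?G = "fst \<alpha>"
    obtain h where s: "strict_placement D c \<alpha> h" and sim: "simple_wgraph ?G" and g: "genus ?G = g"
      and n: "length (marks ?G) = n" and deg: "tropical_degree D \<omega> \<alpha> \<le> ennreal A"
      using \<alpha> by (auto simp: good_types_iff[OF c])
    have p: "param_curve D c (?G, h)" using s by (simp add: strict_placement_def)
    note wf = param_curve_wf[OF c p]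
    have fin: "finite (verts ?G)" using wf_finite[OF wf] by blast
    have vb: "(\<Sum>v\<in>verts ?G. \<bar>vsum ?G v $ j\<bar>) \<le> b" for j
      using vsum_bound[OF c \<delta> s A deg, of j] by (simp add: b_def le_floor_iff)
    have "int (card {v \<in> verts ?G. vsum ?G v \<noteq> 0}) = (\<Sum>v\<in>{v \<in> verts ?G. vsum ?G v \<noteq> 0}. 1)" by simp
    also have "\<dots> \<le> (\<Sum>v\<in>{v \<in> verts ?G. vsum ?G v \<noteq> 0}. \<Sum>j\<in>UNIV. \<bar>vsum ?G v $ j\<bar>)"
    proof (rule sum_mono)
      fix v assume "v \<in> {v \<in> verts ?G. vsum ?G v \<noteq> 0}"
      then obtain j where "vsum ?G v $ j \<noteq> 0" by (auto simp: vec_eq_iff)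
      then have "1 \<le> \<bar>vsum ?G v $ j\<bar>" by linarith
      also have "\<dots> \<le> (\<Sum>j\<in>UNIV. \<bar>vsum ?G v $ j\<bar>)" by (rule member_le_sum) auto
      finally show "1 \<le> (\<Sum>j\<in>UNIV. \<bar>vsum ?G v $ j\<bar>)" .
    qed
    also have "\<dots> \<le> (\<Sum>v\<in>verts ?G. \<Sum>j\<in>UNIV. \<bar>vsum ?G v $ j\<bar>)"
      using fin by (intro sum_mono2) (auto intro: sum_nonneg)
    also have "\<dots> = (\<Sum>j\<in>UNIV. \<Sum>v\<in>verts ?G. \<bar>vsum ?G v $ j\<bar>)" by (rule sum.swap)
    also have "\<dots> \<le> (\<Sum>j\<in>(UNIV :: 'i set). b)" using vb by (intro sum_mono)
    also have "\<dots> = int a" using b0 by (simp add: a_def)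
    finally have ca: "card {v \<in> verts ?G. vsum ?G v \<noteq> 0} \<le> a" by simp
    have wb: "\<bar>wt ?G v e $ i\<bar> \<le> b" if e: "e \<in> edges ?G" and v: "v \<in> ends ?G e" for e v i
    proof -
      obtain u where u: "ends ?G e = {v, u}"
        using wf_ends(2)[OF wf e] v unfolding card_2_iff by (metis insertE insert_commute singletonD)
      have op: "wt ?G u e = - wt ?G v e" by (rule wf_opp[OF wf e u])
      have "u \<in> ends ?G e" using u by simp
      then have "wt ?G v e $ i > 0 \<Longrightarrow> wt ?G v e $ i \<le> b" "wt ?G v e $ i < 0 \<Longrightarrow> - wt ?G v e $ i \<le> b"
        using weight_bound[OF c p e v, of i] weight_bound[OF c p e, of u i] vb[of i] op by auto
      then show ?thesis using b0 by linarith
    qed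
    have gb: "gen ?G v \<le> N" if "v \<in> verts ?G" for v
    proof -
      have "gen ?G v \<le> (\<Sum>v\<in>verts ?G. gen ?G v)" using that fin by (intro member_le_sum) auto
      also have "\<dots> \<le> g" using g by (simp add: genus_def)
      finally show ?thesis by (simp add: N_def)
    qed
    have "comb_type \<alpha>" using \<alpha> by (simp add: good_types_def)
    moreover have "card (verts ?G) \<le> N" "card (edges ?G) \<le> N"
      using card_verts_bound[OF wf sim ca] g n by (auto simp: N_def)
    ultimately show ?thesis using wb gb n by (simp add: bounded_type_def)
  qed
  then have "good_types D c \<omega> g n A // ctype_iso_rel \<subseteq> {\<alpha>. bounded_type N b n \<alpha>} // ctype_iso_rel"
    unfolding quotient_def by blast
  then show ?thesis by (rule finite_subset[OF _ finite_bounded_types[OF b0]])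
qed

section \<open>The polyhedra of a combinatorial type\<close>

text \<open>The position of a vertex is an affine function of the parameters: one follows a path from the root.
  This is the coefficient of the length of an edge in the position of a vertex, for some choice of
  paths.\<close>

definition displacement :: "('i::finite) wgraph \<Rightarrow> nat \<Rightarrow> nat \<Rightarrow> real^'i" where
  "displacement G = (SOME \<kappa>. \<forall>v\<in>verts G. \<forall>p h. realizes G p h \<longrightarrow>
     h v = fst p + (\<Sum>e\<in>edges G. snd p e *\<^sub>R \<kappa> v e))"

definition position :: "('i::finite) wgraph \<Rightarrow> 'i param \<Rightarrow> nat \<Rightarrow> real^'i" where
  "position G p v = fst p + (\<Sum>e\<in>edges G. snd p e *\<^sub>R displacement G v e)"

lemma position:
  assumes wf: "wgraph_wf G" and r: "realizes G p h" and v: "v \<in> verts G"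
  shows "h v = position G p v"
proof -
  let ?P = "\<lambda>\<kappa>v v. \<forall>p h. realizes G p h \<longrightarrow> h v = fst p + (\<Sum>e\<in>edges G. snd p e *\<^sub>R \<kappa>v e)"
  have fin: "finite (edges G)" using wf_finite[OF wf] by blast
  have "root G \<in> verts G" unfolding root_def using wf_nonempty[OF wf] by (simp add: some_in_eq)
  have "\<exists>\<kappa>v. ?P \<kappa>v v" if v: "v \<in> verts G" for v
    using wf_connected[OF wf \<open>root G \<in> verts G\<close> v]
  proof (induction rule: joined_induct)
    case base
    show ?case by (rule exI[of _ "\<lambda>e. 0"]) (simp add: realizes_def)
  next
    case (step x y e)
    then obtain \<kappa>v where k: "?P \<kappa>v x" by blast
    define d where "d = (1 / norm (real_vec (wt G x e))) *\<^sub>R real_vec (wt G x e)"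
    have "h y = fst p + (\<Sum>f\<in>edges G. snd p f *\<^sub>R (\<kappa>v f + (if f = e then d else 0)))" if r: "realizes G p h" for p h
    proof -
      have "h y - h x = snd p e *\<^sub>R d" using r step.hyps by (simp add: realizes_def d_def)
      moreover have "(\<Sum>f\<in>edges G. snd p f *\<^sub>R (\<kappa>v f + (if f = e then d else 0)))
          = (\<Sum>f\<in>edges G. snd p f *\<^sub>R \<kappa>v f) + (\<Sum>f\<in>edges G. if f = e then snd p f *\<^sub>R d else 0)"
        unfolding sum.distrib[symmetric] by (intro sum.cong) (auto simp: scaleR_right_distrib)
      moreover have "(\<Sum>f\<in>edges G. if f = e then snd p f *\<^sub>R d else 0) = snd p e *\<^sub>R d"
        using fin step.hyps(2) by simp
      moreover have "h x = fst p + (\<Sum>f\<in>edges G. snd p f *\<^sub>R \<kappa>v f)" using k r by blast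
      ultimately show ?thesis by (simp add: algebra_simps)
    qed
    then have "?P (\<lambda>f. \<kappa>v f + (if f = e then d else 0)) y" by blast
    then show ?case by (rule exI[of _ "\<lambda>f. \<kappa>v f + (if f = e then d else 0)"])
  qed
  then have "\<exists>\<kappa>. \<forall>v\<in>verts G. ?P (\<kappa> v) v" by (rule bchoice[OF ballI])
  then have "\<forall>v\<in>verts G. ?P (displacement G v) v" unfolding displacement_def by (rule someI_ex)
  then show ?thesis using r v unfolding position_def by blast
qed

lemma root_in_verts: "wgraph_wf G \<Longrightarrow> root G \<in> verts G"
  unfolding root_def using wf_nonempty by (simp add: some_in_eq)

lemma realizes_cong:
  assumes wf: "wgraph_wf G" and eq: "\<And>v. v \<in> verts G \<Longrightarrow> h v = k v" and r: "realizes G p h"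
  shows "realizes G p k"
  using r root_in_verts[OF wf] eq wf_ends_verts[OF wf] unfolding realizes_def by metis

lemma realizes_coords: "realizes G p k \<longleftrightarrow> (\<forall>i. k (root G) $ i = fst p $ i) \<and>
     (\<forall>e u v i. e \<in> edges G \<and> ends G e = {u, v} \<longrightarrow>
        k v $ i - k u $ i = snd p e * (real_vec (wt G u e) $ i / norm (real_vec (wt G u e))))"
  unfolding realizes_def vec_eq_iff vector_minus_component vector_scaleR_component real_scaleR_def
    times_divide_eq_left times_divide_eq_right by blast

lemma realizes_position: "wgraph_wf G \<Longrightarrow> realizes G p h \<Longrightarrow> realizes G p (position G p)"
  using realizes_cong position by metis

lemma continuous_on_position [continuous_intros]:
  "continuous_on S (\<lambda>p. position G p v)"
proof -
  have "continuous_on S (\<lambda>p :: 'a param. snd p e)" for e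
    by (rule continuous_on_compose2[OF continuous_on_product_coordinates continuous_on_snd[OF continuous_on_id]]) auto
  then show ?thesis unfolding position_def by (intro continuous_intros)
qed

lemma continuous_on_length [continuous_intros]:
  "continuous_on S (\<lambda>p :: ('i::finite) param. snd p e)"
  by (rule continuous_on_compose2[OF continuous_on_product_coordinates continuous_on_snd[OF continuous_on_id]]) auto

lemma diameter_doubleton: "diameter {a, b :: 'a :: real_normed_vector} = dist a b"
proof (rule antisym)
  show "diameter {a, b} \<le> dist a b"
    by (rule diameter_le) (auto simp: dist_norm norm_minus_commute)
  show "dist a b \<le> diameter {a, b}"
    by (rule diameter_bounded_bound) auto
qed

lemma params_simps:
  assumes "e \<in> edges G" "ends G e = {u, v}"
  shows "snd (params (G, h)) e = dist (h u) (h v)"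
  using assms by (simp add: params_def diameter_doubleton)

lemma realizes_params:
  assumes w: "weak_curve D c G h"
  shows "realizes G (params (G, h)) h"
  unfolding realizes_def
proof (intro conjI ballI allI impI)
  show "h (root G) = fst (params (G, h))" by (simp add: params_def)
  fix e u v assume e: "e \<in> edges G" "ends G e = {u, v}"
  obtain t where t: "t \<ge> 0" "h v - h u = t *\<^sub>R real_vec (wt G u e)" using weak_curveD(4)[OF w e] by blast
  have "wt G u e \<noteq> 0" using wf_wt[OF weak_curveD(1)[OF w] e(1), of u] e by simp
  then have n: "norm (real_vec (wt G u e)) \<noteq> 0" by simp
  have "dist (h u) (h v) = t * norm (real_vec (wt G u e))"
    using t by (metis abs_of_nonneg dist_commute dist_norm norm_scaleR)
  then show "h v - h u = (snd (params (G, h)) e / norm (real_vec (wt G u e))) *\<^sub>R real_vec (wt G u e)"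
    using t(2) n params_simps[OF e] by simp
qed

lemma params_realizes:
  assumes wf: "wgraph_wf G" and r: "realizes G p h" and 0: "\<And>e. e \<notin> edges G \<Longrightarrow> snd p e = 0"
    and nn: "\<And>e. e \<in> edges G \<Longrightarrow> 0 \<le> snd p e"
  shows "params (G, h) = p"
proof (rule prod_eqI)
  show "fst (params (G, h)) = fst p" using r by (simp add: params_def realizes_def)
  show "snd (params (G, h)) = snd p"
  proof
    fix e show "snd (params (G, h)) e = snd p e"
    proof (cases "e \<in> edges G")
      case True
      obtain u v where uv: "ends G e = {u, v}" "wt G u e \<noteq> 0" using wf_edgeE[OF wf True] by metis
      have "h v - h u = (snd p e / norm (real_vec (wt G u e))) *\<^sub>R real_vec (wt G u e)"
        using r True uv by (simp add: realizes_def)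
      then have "dist (h v) (h u) = \<bar>snd p e / norm (real_vec (wt G u e))\<bar> * norm (real_vec (wt G u e))"
        by (simp add: dist_norm)
      then show ?thesis using nn[OF True] uv(2) params_simps[OF True uv(1), of h] by (simp add: dist_commute)
    next
      case False
      then show ?thesis using 0 by (simp add: params_def)
    qed
  qed
qed

lemma params_nonneg: "wgraph_wf G \<Longrightarrow> e \<in> edges G \<Longrightarrow> 0 \<le> snd (params (G, h)) e"
  by (erule (1) wf_edgeE) (simp add: params_simps)

lemma params_off: "e \<notin> edges G \<Longrightarrow> snd (params (G, h)) e = 0"
  by (simp add: params_def)

context
  fixes D :: "'i::finite \<Rightarrow> 'p set" and c :: real and \<alpha> :: "'i ctype" and h0
  assumes c: "0 < c" and s0: "strict_placement D c \<alpha> h0"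
begin

private abbreviation (input) "G \<equiv> fst \<alpha>"
private abbreviation (input) "I \<equiv> snd \<alpha>"

lemma type_wf: "wgraph_wf G"
  using s0 param_curve_wf[OF c] by (auto simp: strict_placement_def)

lemma placement_params_iff:
  "p \<in> params ` Pair G ` {h. placement D c \<alpha> h} \<longleftrightarrow> (\<forall>e. e \<notin> edges G \<longrightarrow> snd p e = 0) \<and>
     (\<forall>e\<in>edges G. 0 \<le> snd p e) \<and> realizes G p (position G p) \<and>
     (\<forall>v\<in>verts G. position G p v \<in> face_simplex c (I v))"
proof
  assume "p \<in> params ` Pair G ` {h. placement D c \<alpha> h}"
  then obtain h where h: "placement D c \<alpha> h" "p = params (G, h)" by blast
  then have w: "weak_curve D c G h" and I: "\<And>v. v \<in> verts G \<Longrightarrow> supp (h v) \<subseteq> I v"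
    by (auto simp: placement_def)
  have r: "realizes G p h" unfolding h(2) by (rule realizes_params[OF w])
  have "position G p v \<in> face_simplex c (I v)" if v: "v \<in> verts G" for v
    using position[OF type_wf r v] weak_curveD(2)[OF w v] I[OF v]
    by (auto simp: clemens_polytope_iff[OF c] face_simplex_iff)
  then show "(\<forall>e. e \<notin> edges G \<longrightarrow> snd p e = 0) \<and>
     (\<forall>e\<in>edges G. 0 \<le> snd p e) \<and> realizes G p (position G p) \<and>
     (\<forall>v\<in>verts G. position G p v \<in> face_simplex c (I v))"
    using params_off params_nonneg[OF type_wf] realizes_position[OF type_wf r] h(2) by blast
next
  assume p: "(\<forall>e. e \<notin> edges G \<longrightarrow> snd p e = 0) \<and>
     (\<forall>e\<in>edges G. 0 \<le> snd p e) \<and> realizes G p (position G p) \<and>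
     (\<forall>v\<in>verts G. position G p v \<in> face_simplex c (I v))"
  let ?h = "position G p"
  have cl: "?h v \<in> clemens_polytope D c" "supp (?h v) \<subseteq> I v" "supp (?h v) \<noteq> {}" if "v \<in> verts G" for v
  proof -
    have "?h v \<in> face_simplex c (I v)" using p that by blast
    then show "?h v \<in> clemens_polytope D c" "supp (?h v) \<subseteq> I v" "supp (?h v) \<noteq> {}"
      using strict_placement_face[OF c s0 that] supp_nonempty[of "?h v" c] c
      by (auto simp: clemens_polytope_def face_simplex_iff)
  qed
  have "weak_curve D c G ?h"
    unfolding weak_curve_def
  proof (intro conjI ballI allI impI type_wf cl)
    fix e u v assume e: "e \<in> edges G" "ends G e = {u, v}"
    have V: "u \<in> verts G" "v \<in> verts G" using wf_ends_verts[OF type_wf e] by auto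
    show "supp (?h u) \<union> supp (?h v) \<in> face_sets D"
      using face_sets_subset[OF strict_placement_edge_face[OF c s0 e], of "supp (?h u) \<union> supp (?h v)"]
        cl(2,3)[OF V(1)] cl(2,3)[OF V(2)] by blast
    show "\<exists>t\<ge>0. ?h v - ?h u = t *\<^sub>R real_vec (wt G u e)"
      using p e by (intro exI[of _ "snd p e / norm (real_vec (wt G u e))"]) (auto simp: realizes_def)
  qed
  then have "placement D c \<alpha> ?h" using cl by (simp add: placement_def)
  moreover have "params (G, ?h) = p" using p by (intro params_realizes[OF type_wf]) auto
  ultimately show "p \<in> params ` Pair G ` {h. placement D c \<alpha> h}" by force
qed

lemma strict_iff: "strict_placement D c \<alpha> h \<longleftrightarrow> placement D c \<alpha> h \<and> zero_edges G h = {} \<and> (\<forall>v\<in>verts G. supp (h v) = I v)"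
  unfolding strict_placement_def placement_def param_curve_iff[OF c] by auto

lemma polyhedron_of_eq: "polyhedron_of D c \<alpha> = params ` Pair G ` {h. strict_placement D c \<alpha> h}"
proof -
  have "param_curve D c (G, h) \<and> (\<forall>v\<in>verts G. carrier_face D c (h v) = I v) \<longleftrightarrow> strict_placement D c \<alpha> h" for h
    by (cases "param_curve D c (G, h)") (simp_all add: strict_placement_def carrier_supp[OF c])
  then show ?thesis unfolding polyhedron_of_def by auto
qed

lemma polyhedron_of_iff:
  "p \<in> polyhedron_of D c \<alpha> \<longleftrightarrow> p \<in> params ` Pair G ` {h. placement D c \<alpha> h} \<and>
     (\<forall>e\<in>edges G. 0 < snd p e) \<and> (\<forall>v\<in>verts G. supp (position G p v) = I v)"
proof -
  have "p \<in> polyhedron_of D c \<alpha> \<longleftrightarrow> (\<exists>h. placement D c \<alpha> h \<and> p = params (G, h) \<and> zero_edges G h = {} \<and> (\<forall>v\<in>verts G. supp (h v) = I v))"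
    unfolding polyhedron_of_eq using strict_iff by auto
  also have "\<dots> \<longleftrightarrow> (\<exists>h. placement D c \<alpha> h \<and> p = params (G, h) \<and> (\<forall>e\<in>edges G. 0 < snd p e) \<and> (\<forall>v\<in>verts G. supp (position G p v) = I v))"
  proof -
    have "(zero_edges G h = {} \<longleftrightarrow> (\<forall>e\<in>edges G. 0 < snd p e)) \<and> (\<forall>v\<in>verts G. position G p v = h v)"
      if "placement D c \<alpha> h" "p = params (G, h)" for h
    proof -
      have r: "realizes G p h" using that realizes_params by (auto simp: placement_def)
      have "snd p e = 0 \<longleftrightarrow> e \<in> zero_edges G h" if "e \<in> edges G" for e
        using realizes_zero_edges[OF c type_wf r] that by blast
      then have "zero_edges G h = {} \<longleftrightarrow> (\<forall>e\<in>edges G. 0 < snd p e)"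
        using params_nonneg[OF type_wf] zero_edges_subset[of G h] \<open>p = _\<close> by (force simp: less_le)
      then show ?thesis using position[OF type_wf r] by simp
    qed
    then show ?thesis by (metis (no_types, lifting))
  qed
  finally show ?thesis by blast
qed

lemma closed_placement_params: "closed (params ` Pair G ` {h. placement D c \<alpha> h})"
proof -
  have eq: "params ` Pair G ` {h. placement D c \<alpha> h} = {p. (\<forall>e. e \<notin> edges G \<longrightarrow> snd p e = 0) \<and>
     (\<forall>e. e \<in> edges G \<longrightarrow> 0 \<le> snd p e) \<and> (\<forall>i. position G p (root G) $ i = fst p $ i) \<and>
     (\<forall>e u v i. e \<in> edges G \<and> ends G e = {u, v} \<longrightarrow>
        position G p v $ i - position G p u $ i = snd p e * (real_vec (wt G u e) $ i / norm (real_vec (wt G u e)))) \<and>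
     (\<forall>v. v \<in> verts G \<longrightarrow> (\<forall>i. 0 \<le> position G p v $ i) \<and> (\<Sum>i\<in>UNIV. position G p v $ i) = c \<and>
        (\<forall>i. i \<notin> I v \<longrightarrow> position G p v $ i = 0))}"
    unfolding set_eq_iff placement_params_iff realizes_coords face_simplex_def mem_Collect_eq by blast
  show ?thesis
    unfolding eq
    by (intro closed_Collect_conj closed_Collect_all closed_Collect_imp open_Collect_const
        closed_Collect_eq closed_Collect_le continuous_intros)
qed

lemma compact_placement_params: "compact (params ` Pair G ` {h. placement D c \<alpha> h})"
proof -
  have "compact (Pi\<^sub>E UNIV (\<lambda>_::nat. {0..2 * c}))"
  proof -
    have "compactin (product_topology (\<lambda>_. euclidean) UNIV) (Pi\<^sub>E UNIV (\<lambda>_::nat. {0..2 * c}))"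
      by (subst compactin_PiE) auto
    then show ?thesis by (simp add: euclidean_product_topology)
  qed
  then have K: "compact (cball (0 :: real^'i) c \<times> Pi\<^sub>E UNIV (\<lambda>_::nat. {0..2 * c}))"
    by (intro compact_Times compact_cball)
  have "p \<in> cball (0 :: real^'i) c \<times> Pi\<^sub>E UNIV (\<lambda>_::nat. {0..2 * c})" if pp: "p \<in> params ` Pair G ` {h. placement D c \<alpha> h}" for p
  proof -
    obtain h where h: "placement D c \<alpha> h" "p = params (G, h)" using pp by blast
    then have w: "weak_curve D c G h" by (simp add: placement_def)
    have nh: "norm (h v) \<le> c" if v: "v \<in> verts G" for v
    proof -
      have "norm (h v) \<le> (\<Sum>i\<in>UNIV. \<bar>h v $ i\<bar>)" by (rule norm_le_l1_cart)
      also have "\<dots> = c" using weak_curveD(2)[OF w v] by (simp add: clemens_polytope_iff[OF c])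
      finally show ?thesis .
    qed
    have "snd p e \<in> {0..2 * c}" for e
    proof (cases "e \<in> edges G")
      case True
      obtain u v where uv: "ends G e = {u, v}" "u \<in> verts G" "v \<in> verts G" using wf_edgeE[OF type_wf True] by metis
      have "dist (h u) (h v) \<le> norm (h u) + norm (h v)" by (simp add: dist_norm norm_triangle_ineq4)
      then show ?thesis using nh[OF uv(2)] nh[OF uv(3)] by (simp add: h(2) params_simps[OF True uv(1)])
    next
      case False
      then show ?thesis using c by (simp add: h(2) params_off)
    qed
    moreover have "norm (fst p) \<le> c"
      using nh[OF root_in_verts[OF type_wf]] by (simp add: h(2) params_def)
    ultimately show ?thesis by (simp add: mem_Times_iff PiE_iff)
  qed
  then have "params ` Pair G ` {h. placement D c \<alpha> h} \<inter> (cball (0 :: real^'i) c \<times> Pi\<^sub>E UNIV (\<lambda>_::nat. {0..2 * c}))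
      = params ` Pair G ` {h. placement D c \<alpha> h}" by blast
  then show ?thesis using closed_Int_compact[OF closed_placement_params K] by simp
qed

text \<open>Moving any point of the closed polyhedron towards a strict one makes all inequalities strict.\<close>

lemma closure_polyhedron: "closure (polyhedron_of D c \<alpha>) = params ` Pair G ` {h. placement D c \<alpha> h}"
proof (rule antisym)
  show "closure (polyhedron_of D c \<alpha>) \<subseteq> params ` Pair G ` {h. placement D c \<alpha> h}"
    using polyhedron_of_iff by (intro closure_minimal closed_placement_params) auto
  show "params ` Pair G ` {h. placement D c \<alpha> h} \<subseteq> closure (polyhedron_of D c \<alpha>)"
  proof
    fix p assume p: "p \<in> params ` Pair G ` {h. placement D c \<alpha> h}"
    define q where "q = params (G, h0)"
    have q: "q \<in> polyhedron_of D c \<alpha>" using s0 by (auto simp: polyhedron_of_eq q_def)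
    define \<gamma> where "\<gamma> s = ((1 - s) *\<^sub>R fst p + s *\<^sub>R fst q, \<lambda>e. (1 - s) * snd p e + s * snd q e)" for s :: real
    have pos: "position G (\<gamma> s) v = (1 - s) *\<^sub>R position G p v + s *\<^sub>R position G q v" for s v
    proof -
      have "(\<Sum>e\<in>edges G. ((1 - s) * snd p e + s * snd q e) *\<^sub>R displacement G v e)
        = (1 - s) *\<^sub>R (\<Sum>e\<in>edges G. snd p e *\<^sub>R displacement G v e)
          + s *\<^sub>R (\<Sum>e\<in>edges G. snd q e *\<^sub>R displacement G v e)"
        by (simp only: scaleR_left_distrib sum.distrib scaleR_sum_right scaleR_scaleR)
      then show ?thesis by (simp add: position_def \<gamma>_def scaleR_right_distrib)
    qed
    note P = iffD1[OF placement_params_iff p]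
    have qp: "q \<in> params ` Pair G ` {h. placement D c \<alpha> h}" using q polyhedron_of_iff by blast
    note Q = iffD1[OF placement_params_iff qp]
    have "\<gamma> s \<in> polyhedron_of D c \<alpha>" if s: "s \<in> {0<..1}" for s
    proof -
      have s': "0 < s" "s \<le> 1" using s by auto
      have len: "snd (\<gamma> s) e = (1 - s) * snd p e + s * snd q e" for e by (simp add: \<gamma>_def)
      have "realizes G (\<gamma> s) (position G (\<gamma> s))"
        unfolding realizes_def
      proof (intro conjI ballI allI impI)
        show "position G (\<gamma> s) (root G) = fst (\<gamma> s)"
          using P Q unfolding pos by (simp add: realizes_def \<gamma>_def)
        fix e u v assume e: "e \<in> edges G" "ends G e = {u, v}"
        let ?w = "real_vec (wt G u e)"
        have 1: "position G p v - position G p u = (snd p e / norm ?w) *\<^sub>R ?w"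
          "position G q v - position G q u = (snd q e / norm ?w) *\<^sub>R ?w"
          using P Q e by (auto simp: realizes_def)
        have "position G (\<gamma> s) v - position G (\<gamma> s) u
          = (1 - s) *\<^sub>R (position G p v - position G p u) + s *\<^sub>R (position G q v - position G q u)"
          unfolding pos by (simp add: algebra_simps)
        also have "\<dots> = (snd (\<gamma> s) e / norm ?w) *\<^sub>R ?w"
          unfolding 1 len by (simp add: add_divide_distrib scaleR_left_distrib)
        finally show "position G (\<gamma> s) v - position G (\<gamma> s) u = (snd (\<gamma> s) e / norm ?w) *\<^sub>R ?w" .
      qed
      moreover have "position G (\<gamma> s) v \<in> face_simplex c (I v)" if "v \<in> verts G" for v
        unfolding pos using P Q s' that by (intro convexD[OF convex_face_simplex]) auto
      moreover have "0 < snd (\<gamma> s) e" if "e \<in> edges G" for e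
      proof -
        have "0 < snd q e" using q that polyhedron_of_iff by blast
        moreover have "0 \<le> snd p e" using P that by blast
        ultimately show ?thesis unfolding len using s' by (simp add: add_nonneg_pos)
      qed
      moreover have "supp (position G (\<gamma> s) v) = I v" if v: "v \<in> verts G" for v
      proof -
        have F: "position G p v \<in> face_simplex c (I v)" "position G q v \<in> face_simplex c (I v)"
          using P Q v by auto
        have qI: "supp (position G q v) = I v" using q v polyhedron_of_iff by blast
        have "position G (\<gamma> s) v $ i \<noteq> 0" if "i \<in> I v" for i
        proof -
          have "position G q v $ i \<noteq> 0" using qI that by (auto simp: supp_def)
          then have "0 < position G q v $ i" using F(2) by (auto simp: face_simplex_def less_le)
          moreover have "0 \<le> position G p v $ i" using F(1) by (auto simp: face_simplex_def)
          ultimately have "0 < (1 - s) * position G p v $ i + s * position G q v $ i"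
            using s' by (simp add: add_nonneg_pos)
          then show ?thesis unfolding pos by simp
        qed
        moreover have "position G (\<gamma> s) v $ i = 0" if "i \<notin> I v" for i
          unfolding pos using F that by (simp add: face_simplex_def)
        ultimately show ?thesis by (auto simp: supp_def)
      qed
      moreover have "snd (\<gamma> s) e = 0" if "e \<notin> edges G" for e
        unfolding len using P Q that by simp
      ultimately show ?thesis unfolding polyhedron_of_iff placement_params_iff by (simp add: less_imp_le)
    qed
    then have im: "\<gamma> ` {0<..1} \<subseteq> closure (polyhedron_of D c \<alpha>)" using closure_subset by blast
    have "continuous_on UNIV \<gamma>"
      unfolding \<gamma>_def by (intro continuous_intros continuous_on_coordinatewise_then_product)
    then have "\<gamma> ` closure {0<..1} \<subseteq> closure (polyhedron_of D c \<alpha>)"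
      using continuous_on_subset by (intro image_closure_subset im) auto
    moreover have "(0::real) \<in> closure {0<..1}" by simp
    moreover have "\<gamma> 0 = p" by (simp add: \<gamma>_def)
    ultimately show "p \<in> closure (polyhedron_of D c \<alpha>)" by blast
  qed
qed

lemma affine_space_iff:
  "p \<in> affine_space_of c \<alpha> \<longleftrightarrow> (\<forall>e. e \<notin> edges G \<longrightarrow> snd p e = 0) \<and> realizes G p (position G p) \<and>
     (\<forall>v\<in>verts G. (\<Sum>i\<in>UNIV. position G p v $ i) = c \<and> supp (position G p v) \<subseteq> I v)"
proof -
  have hull: "affine hull (face_simplex c (I v) :: (real^'i) set) = {x. (\<Sum>i\<in>UNIV. x $ i) = c \<and> supp x \<subseteq> I v}" if "v \<in> verts G" for v
    using strict_placement_face[OF c s0 that] by (intro affine_hull_face_simplex[OF c]) (auto simp: face_sets_def)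
  show ?thesis
  proof
    assume "p \<in> affine_space_of c \<alpha>"
    then obtain h where h: "\<forall>e. e \<notin> edges G \<longrightarrow> snd p e = 0" "realizes G p h"
      "\<forall>v\<in>verts G. h v \<in> affine hull face_simplex c (I v)"
      by (auto simp: affine_space_of_def)
    have "position G p v \<in> affine hull face_simplex c (I v)" if "v \<in> verts G" for v
      using h(3) that unfolding position[OF type_wf h(2) that, symmetric] by blast
    then show "(\<forall>e. e \<notin> edges G \<longrightarrow> snd p e = 0) \<and> realizes G p (position G p) \<and>
     (\<forall>v\<in>verts G. (\<Sum>i\<in>UNIV. position G p v $ i) = c \<and> supp (position G p v) \<subseteq> I v)"
      using h(1) realizes_position[OF type_wf h(2)] hull by simp
  next
    assume "(\<forall>e. e \<notin> edges G \<longrightarrow> snd p e = 0) \<and> realizes G p (position G p) \<and>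
     (\<forall>v\<in>verts G. (\<Sum>i\<in>UNIV. position G p v $ i) = c \<and> supp (position G p v) \<subseteq> I v)"
    then show "p \<in> affine_space_of c \<alpha>"
      unfolding affine_space_of_def using hull by (intro CollectI conjI exI[of _ "position G p"]) simp_all
  qed
qed

text \<open>The conditions on the positions are linear because the positions are affine in the parameters. That
  the edges lie in faces imposes no condition beyond the carriers, since for a good type the union
  of the carriers of the ends of an edge is the index set of a face.\<close>

lemma open_convex_polyhedron:
  "open_convex_polyhedron_in (edges G) (affine_space_of c \<alpha>) (polyhedron_of D c \<alpha>)"
proof -
  let ?E = "edges G" and ?\<kappa> = "displacement G"
  have fin: "finite (verts G)" "finite ?E" using wf_finite[OF type_wf] by auto
  have lf: "linear_form ?E (axis i 1) (\<lambda>e. ?\<kappa> v e $ i) p = position G p v $ i" for p v i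
    by (simp add: linear_form_def position_def inner_axis' mult.commute)
  have lf_sum: "linear_form ?E (\<chi> i. 1) (\<lambda>e. \<Sum>i\<in>UNIV. ?\<kappa> v e $ i) p = (\<Sum>i\<in>UNIV. position G p v $ i)" for p v
    by (simp add: linear_form_def position_def inner_vec_def sum.distrib sum_distrib_right mult.commute)
       (simp add: sum_distrib_left, rule sum.swap)
  have lf_edge: "linear_form ?E 0 (\<lambda>f. ?\<kappa> v f $ i - ?\<kappa> u f $ i - (if f = e then r else 0)) p
     = position G p v $ i - position G p u $ i - r * snd p e" if "e \<in> ?E" for p u v e r i
  proof -
    have "(\<Sum>f\<in>?E. (?\<kappa> v f $ i - ?\<kappa> u f $ i - (if f = e then r else 0)) * snd p f)
      = (\<Sum>f\<in>?E. ?\<kappa> v f $ i * snd p f) - (\<Sum>f\<in>?E. ?\<kappa> u f $ i * snd p f) - (\<Sum>f\<in>?E. if f = e then r * snd p f else 0)"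
      unfolding sum_subtractf[symmetric] by (intro sum.cong) (auto simp: algebra_simps)
    also have "(\<Sum>f\<in>?E. if f = e then r * snd p f else 0) = r * snd p e" using fin that by simp
    finally show ?thesis by (simp add: linear_form_def position_def mult.commute)
  qed
  have lf_root: "linear_form ?E 0 (\<lambda>e. ?\<kappa> v e $ i) p = position G p v $ i - fst p $ i" for p v i
    by (simp add: linear_form_def position_def mult.commute)
  have lf_len: "linear_form ?E 0 (\<lambda>f. if f = e then - 1 else 0) p = - snd p e" if "e \<in> ?E" for e and p :: "'i param"
  proof -
    have "(\<Sum>f\<in>?E. (if f = e then - 1 else 0) * snd p f) = (\<Sum>f\<in>?E. if f = e then - snd p f else 0)"
      by (intro sum.cong) auto
    then show ?thesis using fin that by (simp add: linear_form_def)
  qed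
  have lf_neg: "linear_form ?E (- axis i 1) (\<lambda>e. - ?\<kappa> v e $ i) p = - position G p v $ i" for p v i
    using lf[of i v p] by (simp add: linear_form_def sum_negf)
  define Q :: "((real^'i) \<times> (nat \<Rightarrow> real) \<times> real) set" where "Q =
    (\<lambda>(v, i). (axis i 1, \<lambda>e. ?\<kappa> v e $ i, 0)) ` {(v, i). v \<in> verts G \<and> i \<notin> I v} \<union>
    (\<lambda>v. (\<chi> i. 1, \<lambda>e. \<Sum>i\<in>UNIV. ?\<kappa> v e $ i, c)) ` verts G \<union>
    (\<lambda>(e, u, v, i). (0, \<lambda>f. ?\<kappa> v f $ i - ?\<kappa> u f $ i - (if f = e then real_vec (wt G u e) $ i / norm (real_vec (wt G u e)) else 0), 0))
      ` {(e, u, v, i). e \<in> ?E \<and> ends G e = {u, v}} \<union>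
    (\<lambda>i. (0, \<lambda>e. ?\<kappa> (root G) e $ i, 0)) ` UNIV"
  define N :: "((real^'i) \<times> (nat \<Rightarrow> real) \<times> real) set" where "N =
    (\<lambda>e. (0, \<lambda>f. if f = e then - 1 else 0, 0)) ` ?E \<union>
    (\<lambda>(v, i). (- axis i 1, \<lambda>e. - ?\<kappa> v e $ i, 0)) ` {(v, i). v \<in> verts G \<and> i \<in> I v}"
  have fVI: "finite {(v, i :: 'i). v \<in> verts G \<and> R v i}" for R
    by (rule finite_subset[of _ "verts G \<times> UNIV"]) (use fin in auto)
  have fE: "finite {(e, u, v, i :: 'i). e \<in> ?E \<and> ends G e = {u, v}}"
    by (rule finite_subset[of _ "?E \<times> verts G \<times> verts G \<times> UNIV"]) (use fin wf_ends_verts[OF type_wf] in auto)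
  have "finite Q" "finite N" unfolding Q_def N_def using fVI fE fin by auto
  have Qp: "(\<forall>(a, b, d)\<in>Q. linear_form ?E a b p = d) \<longleftrightarrow> realizes G p (position G p) \<and>
     (\<forall>v\<in>verts G. (\<Sum>i\<in>UNIV. position G p v $ i) = c \<and> supp (position G p v) \<subseteq> I v)" for p
  proof -
    have "(\<forall>(a, b, d)\<in>Q. linear_form ?E a b p = d) \<longleftrightarrow>
      (\<forall>v i. v \<in> verts G \<and> i \<notin> I v \<longrightarrow> position G p v $ i = 0) \<and>
      (\<forall>v\<in>verts G. (\<Sum>i\<in>UNIV. position G p v $ i) = c) \<and>
      (\<forall>e u v i. e \<in> ?E \<and> ends G e = {u, v} \<longrightarrow> position G p v $ i - position G p u $ i
         - real_vec (wt G u e) $ i / norm (real_vec (wt G u e)) * snd p e = 0) \<and>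
      (\<forall>i. position G p (root G) $ i - fst p $ i = 0)"
      unfolding Q_def ball_Un ball_simps split_paired_all split_paired_All case_prod_conv mem_Collect_eq
      using lf lf_sum lf_edge lf_root by (auto simp: split_beta)
    also have "\<dots> \<longleftrightarrow> realizes G p (position G p) \<and>
     (\<forall>v\<in>verts G. (\<Sum>i\<in>UNIV. position G p v $ i) = c \<and> supp (position G p v) \<subseteq> I v)"
      by (auto simp: realizes_def vec_eq_iff supp_subset_iff mult.commute)
    finally show ?thesis .
  qed
  have Np: "(\<forall>(a, b, d)\<in>N. linear_form ?E a b p < d) \<longleftrightarrow> (\<forall>e\<in>?E. 0 < snd p e) \<and>
     (\<forall>v\<in>verts G. \<forall>i\<in>I v. 0 < position G p v $ i)" for p
    unfolding N_def by (auto simp: ball_Un lf_len lf_neg)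
  have L: "affine_space_of c \<alpha> = {p. (\<forall>e. e \<notin> ?E \<longrightarrow> snd p e = 0) \<and> (\<forall>(a, b, d)\<in>Q. linear_form ?E a b p = d)}"
    unfolding Qp using affine_space_iff by auto
  have "polyhedron_of D c \<alpha> = {p \<in> affine_space_of c \<alpha>. \<forall>(a, b, d)\<in>N. linear_form ?E a b p < d}"
    unfolding Np
  proof (rule set_eqI)
    fix p
    have "(position G p v \<in> face_simplex c (I v) \<and> supp (position G p v) = I v) \<longleftrightarrow>
       (\<Sum>i\<in>UNIV. position G p v $ i) = c \<and> supp (position G p v) \<subseteq> I v \<and> (\<forall>i\<in>I v. 0 < position G p v $ i)" for v
    proof
      assume "position G p v \<in> face_simplex c (I v) \<and> supp (position G p v) = I v"
      then show "(\<Sum>i\<in>UNIV. position G p v $ i) = c \<and> supp (position G p v) \<subseteq> I v \<and> (\<forall>i\<in>I v. 0 < position G p v $ i)"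
        by (auto simp: face_simplex_iff supp_def less_le)
    next
      assume *: "(\<Sum>i\<in>UNIV. position G p v $ i) = c \<and> supp (position G p v) \<subseteq> I v \<and> (\<forall>i\<in>I v. 0 < position G p v $ i)"
      then have "0 \<le> position G p v $ i" for i
        by (cases "i \<in> I v") (auto simp: supp_subset_iff less_imp_le)
      moreover have "I v \<subseteq> supp (position G p v)" using * by (force simp: supp_def)
      ultimately show "position G p v \<in> face_simplex c (I v) \<and> supp (position G p v) = I v"
        using * by (auto simp: face_simplex_iff)
    qed
    then have "(\<forall>v\<in>verts G. position G p v \<in> face_simplex c (I v)) \<and> (\<forall>v\<in>verts G. supp (position G p v) = I v) \<longleftrightarrow>
      (\<forall>v\<in>verts G. (\<Sum>i\<in>UNIV. position G p v $ i) = c \<and> supp (position G p v) \<subseteq> I v) \<and>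
      (\<forall>v\<in>verts G. \<forall>i\<in>I v. 0 < position G p v $ i)" by blast
    then show "p \<in> polyhedron_of D c \<alpha> \<longleftrightarrow> p \<in> {p \<in> affine_space_of c \<alpha>. (\<forall>e\<in>?E. 0 < snd p e) \<and>
     (\<forall>v\<in>verts G. \<forall>i\<in>I v. 0 < position G p v $ i)}"
      unfolding polyhedron_of_iff placement_params_iff mem_Collect_eq affine_space_iff
      by (blast intro: less_imp_le)
  qed
  then show ?thesis
    unfolding open_convex_polyhedron_in_def using L \<open>finite Q\<close> \<open>finite N\<close> by blast
qed

end

section \<open>Strata and boundaries\<close>

lemma contraction_card_edges:
  assumes wf: "wgraph_wf G" and con: "contraction \<phi> \<psi> G Z H"
  shows "card (edges H) + card Z = card (edges G)"
proof -
  have "finite Z" using contraction_subset[OF wf con] wf_finite(2)[OF wf] finite_subset by blast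
  then show ?thesis
    using bij_betw_same_card[OF contraction_bij[OF wf con]] contraction_subset[OF wf con]
      card_Diff_subset[of Z "edges G"] card_mono[OF wf_finite(2)[OF wf], of Z] by simp
qed

context
  fixes D :: "'i::finite \<Rightarrow> 'p set" and c :: real
  assumes c: "0 < c"
begin

lemma param_weak: "param_curve D c (G, h) \<Longrightarrow> weak_curve D c G h \<and> zero_edges G h = {}"
  using param_curve_iff[OF c] by blast

lemma smooth_steps_card_edges:
  assumes "smooth_step\<^sup>*\<^sup>* G H" "param_curve D c (G, h)"
  shows "card (edges H) \<le> card (edges G)"
  using assms
proof (induction rule: rtranclp_induct)
  case (step H K)
  then have p: "param_curve D c (H, h)" using smooth_steps_invariants[OF c] by blast
  obtain v where v: "smooths H v K" by (rule param_smooth_step[OF c p step.hyps(2)])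
  obtain e where e: "e \<in> incident H v"
    using v by (fastforce simp: smooths_def removable_def card_2_iff)
  obtain \<phi> \<psi> where con: "contraction \<phi> \<psi> H {e} K" "\<forall>w\<in>verts H - {v}. \<phi> w = w"
    "\<forall>h :: nat \<Rightarrow> real^'i. curve_contraction \<phi> \<psi> H h {e} {v} K h"
    by (rule smoothsE[OF v e])
  show ?case using contraction_card_edges[OF param_curve_wf[OF c p] con(1)] step.IH[OF step.prems] by simp
qed simp

text \<open>Limits of simplifications: the normal form of a degeneration of \<open>G\<close> does not change if
  vertices that are removable before the degeneration are removed first.\<close>

lemma normal_form_smooth_steps:
  assumes "smooth_step\<^sup>*\<^sup>* G H" "param_curve D c (G, h)" and w: "weak_curve D c G k"
  shows "weak_curve D c H k \<and> (\<forall>X x. normal_form H k X x \<longrightarrow>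
    (\<exists>Y y. normal_form G k Y y \<and> curve_iso (X, x) (Y, y)))"
  using assms(1,2)
proof (induction rule: rtranclp_induct)
  case base
  then show ?case using w curve_iso_refl by blast
next
  case (step H K)
  have p: "param_curve D c (H, h)" using smooth_steps_invariants[OF c step.hyps(1) step.prems] by blast
  obtain v where v: "smooths H v K" by (rule param_smooth_step[OF c p step.hyps(2)])
  have wH: "weak_curve D c H k" using step by blast
  have wK: "weak_curve D c K k" by (rule weak_smooths(1)[OF c wH v])
  have "\<exists>Y y. normal_form G k Y y \<and> curve_iso (X, x) (Y, y)" if n: "normal_form K k X x" for X x
  proof -
    obtain X' x' where X': "normal_form H k X' x'" "curve_iso (X, x) (X', x')"
      by (rule normal_form_smooths[OF c wH v n])
    obtain Y y where Y: "normal_form G k Y y" "curve_iso (X', x') (Y, y)"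
      using step.IH[OF step.prems] X'(1) by blast
    have "wgraph_wf (fst (X, x))"
      using normal_form_invariants(1)[OF c wK n] param_curve_wf[OF c] by simp
    then show ?thesis using curve_iso_trans[OF _ X'(2) Y(2)] Y(1) by blast
  qed
  then show ?case using wK by blast
qed

lemma normal_form_self:
  assumes p: "param_curve D c (G, h)" and s: "simple_wgraph G"
  shows "normal_form G h G h"
proof -
  have "curve_contraction (\<lambda>v. v) (\<lambda>e. e) G h (zero_edges G h) {} G h"
    using contraction_id[OF param_curve_wf[OF c p]] param_weak[OF p] by (simp add: curve_contraction_def)
  then show ?thesis using s unfolding normal_form_def simplification_def by blast
qed

lemma type_of_simple_curve:
  assumes "(G, h) \<in> simple_curves D c \<omega> g n A"
  shows "type_of_curve D c (G, h) \<in> good_types D c \<omega> g n A" "strict_placement D c (type_of_curve D c (G, h)) h"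
proof -
  have p: "param_curve D c (G, h)" using assms by (simp add: simple_curves_def)
  show s: "strict_placement D c (type_of_curve D c (G, h)) h"
    using p carrier_supp[OF c p] by (simp add: strict_placement_def type_of_curve_def)
  then show "type_of_curve D c (G, h) \<in> good_types D c \<omega> g n A"
    unfolding good_types_iff[OF c] using assms by (auto simp: simple_curves_def type_of_curve_def)
qed

text \<open>A removed vertex can be put back at the midpoint of its edge, with the same carrier as before:
  all interior points of an edge have the union of the carriers of its ends as carrier.\<close>

lemma unsmooth:
  assumes s: "smooths G v H" and p0: "param_curve D c (G, h0)" and p1: "param_curve D c (H, h1)"
    and eq: "\<And>x. x \<in> verts H \<Longrightarrow> supp (h1 x) = supp (h0 x)"
  obtains h2 where "param_curve D c (G, h2)" "\<And>x. x \<in> verts G \<Longrightarrow> supp (h2 x) = supp (h0 x)"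
    "\<And>x. x \<in> verts H \<Longrightarrow> h2 x = h1 x"
proof -
  note wf = param_curve_wf[OF c p0]
  have w0: "weak_curve D c G h0" and z0: "zero_edges G h0 = {}" using param_weak[OF p0] by auto
  have w1: "weak_curve D c H h1" and z1: "zero_edges H h1 = {}" using param_weak[OF p1] by auto
  have rem: "removable G v" and vH: "verts H = verts G - {v}" using s by (auto simp: smooths_def)
  obtain e1 where e1: "e1 \<in> incident G v"
    using rem by (fastforce simp: removable_def card_2_iff)
  obtain \<phi> \<psi> where con: "contraction \<phi> \<psi> G {e1} H" "\<forall>w\<in>verts G - {v}. \<phi> w = w"
    "\<forall>h :: nat \<Rightarrow> real^'i. curve_contraction \<phi> \<psi> G h {e1} {v} H h"
    by (rule smoothsE[OF s e1])
  obtain e2 u1 u2 where *: "incident G v = {e1, e2}" "e1 \<noteq> e2" "ends G e1 = {v, u1}" "ends G e2 = {v, u2}"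
    "u1 \<noteq> v" "u2 \<noteq> v" "wt G v e1 = wt G u2 e2"
    "ends H (\<psi> e2) = {u1, u2}" "wt H u2 (\<psi> e2) = wt G u2 e2" "\<psi> e2 \<in> edges H"
    and oth: "\<forall>f\<in>edges G. f \<noteq> e1 \<and> f \<noteq> e2 \<longrightarrow> v \<notin> ends G f \<and> ends H (\<psi> f) = ends G f \<and> \<psi> f \<in> edges H \<and>
       (\<forall>x\<in>ends G f. wt H x (\<psi> f) = wt G x f)"
    by (rule smooths_edges[OF wf s con(1,2) e1])
  have E: "e1 \<in> edges G" "e2 \<in> edges G" using *(1) by (auto simp: incident_def)
  have V: "u1 \<in> verts G" "u2 \<in> verts G" "v \<in> verts G" using wf_ends_verts[OF wf] E * by blast+
  have VH: "u1 \<in> verts H" "u2 \<in> verts H" using V * vH by auto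
  have nn: "0 \<le> h0 x $ i" if "x \<in> verts G" for x i
    using weak_curveD(2)[OF w0 that] clemens_polytope_iff[OF c] by blast
  have nn1: "0 \<le> h1 x $ i" "(\<Sum>i\<in>UNIV. h1 x $ i) = c" if "x \<in> verts H" for x i
    using weak_curveD(2)[OF w1 that] clemens_polytope_iff[OF c] by blast+
  have supp0: "supp (h0 v) = supp (h0 u1) \<union> supp (h0 u2)"
  proof -
    obtain t1 where t1: "t1 \<ge> 0" "h0 u1 - h0 v = t1 *\<^sub>R real_vec (wt G u2 e2)"
      using weak_curveD(4)[OF w0 E(1) *(3)] *(7) by auto
    have "ends G e2 = {u2, v}" using *(4) by auto
    then obtain t2 where t2: "t2 \<ge> 0" "h0 v - h0 u2 = t2 *\<^sub>R real_vec (wt G u2 e2)"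
      using weak_curveD(4)[OF w0 E(2)] by blast
    have "h0 v \<noteq> h0 u1" "h0 v \<noteq> h0 u2"
      using zero_edges_iff[OF E(1) *(3)] zero_edges_iff[OF E(2) *(4)] z0 by blast+
    then have t: "t1 > 0" "t2 > 0" using t1 t2 by (auto simp: less_le)
    have "t2 *\<^sub>R (h0 u1 - h0 v) = t1 *\<^sub>R (h0 v - h0 u2)" unfolding t1 t2 by simp
    then have comb: "t2 * h0 u1 $ i + t1 * h0 u2 $ i = (t1 + t2) * h0 v $ i" for i
      by (auto simp: vec_eq_iff algebra_simps dest: spec[of _ i])
    have "h0 v $ i = 0 \<longleftrightarrow> h0 u1 $ i = 0 \<and> h0 u2 $ i = 0" for i
    proof
      assume "h0 v $ i = 0"
      then have "t2 * h0 u1 $ i + t1 * h0 u2 $ i = 0" using comb[of i] by simp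
      moreover have "0 \<le> t2 * h0 u1 $ i" "0 \<le> t1 * h0 u2 $ i" using t nn[OF V(1)] nn[OF V(2)] by auto
      ultimately have "t2 * h0 u1 $ i = 0" "t1 * h0 u2 $ i = 0" by linarith+
      then show "h0 u1 $ i = 0 \<and> h0 u2 $ i = 0" using t by simp
    next
      assume "h0 u1 $ i = 0 \<and> h0 u2 $ i = 0"
      then have "(t1 + t2) * h0 v $ i = 0" using comb[of i] by simp
      then show "h0 v $ i = 0" using t by simp
    qed
    then show ?thesis by (auto simp: supp_def)
  qed
  define m where "m = (1 / 2) *\<^sub>R h1 u1 + (1 / 2) *\<^sub>R h1 u2"
  define h2 where "h2 = h1(v := m)"
  have m_supp: "supp m = supp (h1 u1) \<union> supp (h1 u2)"
  proof -
    have "m $ i = 0 \<longleftrightarrow> h1 u1 $ i = 0 \<and> h1 u2 $ i = 0" for i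
      using nn1(1)[OF VH(1), of i] nn1(1)[OF VH(2), of i] by (auto simp: m_def)
    then show ?thesis by (auto simp: supp_def)
  qed
  have F: "supp (h1 u1) \<union> supp (h1 u2) \<in> face_sets D" by (rule weak_curveD(3)[OF w1 *(10,8)])
  have h2: "h2 x = h1 x" if "x \<in> verts H" for x using that vH by (auto simp: h2_def)
  have supp2: "supp (h2 x) = supp (h0 x)" if "x \<in> verts G" for x
    using that h2 eq vH supp0 m_supp eq[OF VH(1)] eq[OF VH(2)] by (cases "x = v") (auto simp: h2_def)
  obtain t where t: "t \<ge> 0" "h1 u1 - h1 u2 = t *\<^sub>R real_vec (wt G u2 e2)"
    using weak_curveD(4)[OF w1 *(10), of u2 u1] *(8,9) by (auto simp: insert_commute)
  have d: "h2 u1 - h2 v = (t / 2) *\<^sub>R real_vec (wt G v e1)" "h2 v - h2 u2 = (t / 2) *\<^sub>R real_vec (wt G u2 e2)"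
  proof -
    have "h2 u1 - h2 v = (1 / 2) *\<^sub>R (h1 u1 - h1 u2)" "h2 v - h2 u2 = (1 / 2) *\<^sub>R (h1 u1 - h1 u2)"
      using *(5,6) by (simp_all add: h2_def m_def vec_eq_iff field_simps)
    then show "h2 u1 - h2 v = (t / 2) *\<^sub>R real_vec (wt G v e1)" "h2 v - h2 u2 = (t / 2) *\<^sub>R real_vec (wt G u2 e2)"
      using t *(7) by simp_all
  qed
  have w2: "weak_curve D c G h2"
  proof (rule weak_curveI[OF wf])
    fix x assume x: "x \<in> verts G"
    show "h2 x \<in> clemens_polytope D c"
    proof (cases "x = v")
      case True
      have "(\<Sum>i\<in>UNIV. m $ i) = c"
        using nn1(2)[OF VH(1)] nn1(2)[OF VH(2)] by (simp add: m_def sum.distrib sum_divide_distrib[symmetric])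
      moreover have "0 \<le> m $ i" for i using nn1(1)[OF VH(1)] nn1(1)[OF VH(2)] by (simp add: m_def)
      ultimately show ?thesis using True m_supp F by (simp add: h2_def clemens_polytope_iff[OF c])
    next
      case False
      then show ?thesis using x vH h2 weak_curveD(2)[OF w1] by simp
    qed
  next
    fix f assume f: "f \<in> edges G"
    consider "f = e1" | "f = e2" | "f \<noteq> e1" "f \<noteq> e2" by blast
    then show "\<exists>x y. ends G f = {x, y} \<and> supp (h2 x) \<union> supp (h2 y) \<in> face_sets D \<and>
        (\<exists>t\<ge>0. h2 y - h2 x = t *\<^sub>R real_vec (wt G x f))"
    proof cases
      case 1
      have "supp (h2 v) \<union> supp (h2 u1) \<in> face_sets D"
        using supp2 V weak_curveD(3)[OF w0 E(1) *(3)] by simp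
      moreover have "0 \<le> t / 2" using t by simp
      ultimately show ?thesis using 1 *(3) d(1) by blast
    next
      case 2
      have "supp (h2 u2) \<union> supp (h2 v) \<in> face_sets D"
        using supp2 V weak_curveD(3)[OF w0 E(2) *(4)] by (simp add: Un_commute)
      moreover have "0 \<le> t / 2" using t by simp
      moreover have "ends G f = {u2, v}" using 2 *(4) by auto
      ultimately show ?thesis using 2 d(2) by blast
    next
      case 3
      obtain a b where ab: "ends G f = {a, b}" "a \<in> verts G" "b \<in> verts G" using wf_edgeE[OF wf f] by metis
      have o: "v \<notin> ends G f" "ends H (\<psi> f) = {a, b}" "\<psi> f \<in> edges H" "wt H a (\<psi> f) = wt G a f"
        using oth f 3 ab by auto
      have "h2 a = h1 a" "h2 b = h1 b" using o(1) ab by (auto simp: h2_def)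
      then have "supp (h2 a) \<union> supp (h2 b) \<in> face_sets D" "\<exists>t\<ge>0. h2 b - h2 a = t *\<^sub>R real_vec (wt G a f)"
        using weak_curveD(3,4)[OF w1 o(3,2)] o(4) by auto
      then show ?thesis using ab(1) by blast
    qed
  qed
  have "f \<notin> zero_edges G h2" for f
  proof
    assume z: "f \<in> zero_edges G h2"
    then have f: "f \<in> edges G" using zero_edges_subset by blast
    have "h1 u1 \<noteq> h1 u2" using zero_edges_iff[OF *(10,8)] z1 by blast
    then have t0: "t \<noteq> 0" using t(2) by auto
    have W: "wt G u2 e2 \<noteq> 0" using wf_wt[OF wf E(2)] *(4) by auto
    consider "f = e1" | "f = e2" | "f \<noteq> e1" "f \<noteq> e2" by blast
    then show False
    proof cases
      case 1
      then show False using zero_edges_iff[OF E(1) *(3)] z d(1) t0 W *(7) by auto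
    next
      case 2
      then show False using zero_edges_iff[OF E(2) *(4)] z d(2) t0 W by auto
    next
      case 3
      obtain a b where ab: "ends G f = {a, b}" using wf_edgeE[OF wf f] by metis
      have o: "v \<notin> ends G f" "ends H (\<psi> f) = {a, b}" "\<psi> f \<in> edges H"
        using oth f 3 ab by auto
      have "h2 a = h1 a" "h2 b = h1 b" using o(1) ab by (auto simp: h2_def)
      then show False using zero_edges_iff[OF f ab] zero_edges_iff[OF o(3,2)] z z1 by auto
    qed
  qed
  then have "param_curve D c (G, h2)" using w2 param_curve_iff[OF c] by blast
  then show thesis using that supp2 h2 by blast
qed

lemma unsmooth_steps:
  assumes "smooth_step\<^sup>*\<^sup>* G H" "param_curve D c (G, h0)"
  shows "param_curve D c (H, h1) \<Longrightarrow> (\<And>x. x \<in> verts H \<Longrightarrow> supp (h1 x) = supp (h0 x)) \<Longrightarrow>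
    \<exists>h2. param_curve D c (G, h2) \<and> (\<forall>x\<in>verts G. supp (h2 x) = supp (h0 x)) \<and> (\<forall>x\<in>verts H. h2 x = h1 x)"
  using assms
proof (induction arbitrary: h1 rule: rtranclp_induct)
  case base
  then show ?case by blast
next
  case (step H K)
  have p: "param_curve D c (H, h0)" using smooth_steps_invariants[OF c step.hyps(1) step.prems(3)] by blast
  obtain v where v: "smooths H v K" by (rule param_smooth_step[OF c p step.hyps(2)])
  obtain k where k: "param_curve D c (H, k)" "\<And>x. x \<in> verts H \<Longrightarrow> supp (k x) = supp (h0 x)"
    "\<And>x. x \<in> verts K \<Longrightarrow> k x = h1 x"
    using unsmooth[OF v p step.prems(1,2)] by metis
  obtain h2 where h2: "param_curve D c (G, h2)" "\<forall>x\<in>verts G. supp (h2 x) = supp (h0 x)" "\<forall>x\<in>verts H. h2 x = k x"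
    using step.IH[OF k(1,2) step.prems(3)] by blast
  have "verts K \<subseteq> verts H" using v by (auto simp: smooths_def)
  then have "\<forall>x\<in>verts K. h2 x = h1 x" using h2(3) k(3) by (metis subsetD)
  then show ?case using h2(1,2) by blast
qed

text \<open>All vertices of a contracted component are placed at the position of the vertex that replaces it.\<close>

lemma uncontract:
  assumes w0: "weak_curve D c G h0" and con: "contraction \<phi> \<psi> G Z H" and p: "param_curve D c (H, k)"
    and eq: "\<And>v. v \<in> verts G \<Longrightarrow> supp (k (\<phi> v)) = supp (h0 v)"
  shows "weak_curve D c G (k \<circ> \<phi>)" "zero_edges G (k \<circ> \<phi>) = Z"
    "curve_contraction \<phi> \<psi> G (k \<circ> \<phi>) (zero_edges G (k \<circ> \<phi>)) {} H k"
proof -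
  note wf = weak_curveD(1)[OF w0]
  have w1: "weak_curve D c H k" and z1: "zero_edges H k = {}" using param_weak[OF p] by auto
  have edge: "ends H (\<psi> e) = {\<phi> u, \<phi> v} \<and> \<psi> e \<in> edges H \<and> wt H (\<phi> u) (\<psi> e) = wt G u e"
    if "e \<in> edges G" "e \<notin> Z" "ends G e = {u, v}" for e u v
    using that contraction_ends[OF wf con, of e] contraction_edge_in[OF wf con, of e]
      contraction_wt[OF wf con, of e u] by auto
  have Zc: "\<phi> u = \<phi> v" if "e \<in> Z" "ends G e = {u, v}" for e u v
    using contraction_zero_edge[OF wf con that(1), of u] that(2) by auto
  show "weak_curve D c G (k \<circ> \<phi>)"
  proof (rule weak_curveI[OF wf])
    show "(k \<circ> \<phi>) v \<in> clemens_polytope D c" if "v \<in> verts G" for v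
      using weak_curveD(2)[OF w1, of "\<phi> v"] that contraction_verts[OF wf con] by simp
    fix e assume e: "e \<in> edges G"
    obtain u v where uv: "ends G e = {u, v}" "u \<in> verts G" "v \<in> verts G" using wf_edgeE[OF wf e] by metis
    have "supp ((k \<circ> \<phi>) u) \<union> supp ((k \<circ> \<phi>) v) \<in> face_sets D"
      using weak_curveD(3)[OF w0 e uv(1)] eq uv by simp
    moreover have "\<exists>t\<ge>0. (k \<circ> \<phi>) v - (k \<circ> \<phi>) u = t *\<^sub>R real_vec (wt G u e)"
    proof (cases "e \<in> Z")
      case True
      then show ?thesis using Zc[OF True uv(1)] by (intro exI[of _ 0]) simp
    next
      case False
      then show ?thesis using edge[OF e False uv(1)] weak_curveD(4)[OF w1, of "\<psi> e" "\<phi> u" "\<phi> v"] by auto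
    qed
    ultimately show "\<exists>u v. ends G e = {u, v} \<and> supp ((k \<circ> \<phi>) u) \<union> supp ((k \<circ> \<phi>) v) \<in> face_sets D \<and>
        (\<exists>t\<ge>0. (k \<circ> \<phi>) v - (k \<circ> \<phi>) u = t *\<^sub>R real_vec (wt G u e))"
      using uv(1) by blast
  qed
  have "e \<in> zero_edges G (k \<circ> \<phi>) \<longleftrightarrow> e \<in> Z" if e: "e \<in> edges G" for e
  proof -
    obtain u v where uv: "ends G e = {u, v}" using wf_edgeE[OF wf e] by metis
    show ?thesis
    proof (cases "e \<in> Z")
      case True
      then show ?thesis using Zc[OF True uv] zero_edges_iff[OF e uv] by simp
    next
      case False
      then show ?thesis
        using edge[OF e False uv] zero_edges_iff[of "\<psi> e" H "\<phi> u" "\<phi> v" k] zero_edges_iff[OF e uv] z1 by auto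
    qed
  qed
  then show Z: "zero_edges G (k \<circ> \<phi>) = Z"
    using zero_edges_subset[of G "k \<circ> \<phi>"] contraction_subset[OF wf con] by blast
  show "curve_contraction \<phi> \<psi> G (k \<circ> \<phi>) (zero_edges G (k \<circ> \<phi>)) {} H k"
    unfolding Z curve_contraction_def using con contraction_verts[OF wf con] by simp
qed

lemma attaching_map_placement:
  assumes "placement D c \<alpha> h" "normal_form (fst \<alpha>) h K k"
  shows "attaching_map D c \<alpha> (params (fst \<alpha>, h)) = curve_iso_rel D c `` {(K, k)}"
proof -
  have w: "weak_curve D c (fst \<alpha>) h" using assms(1) by (simp add: placement_def)
  show ?thesis by (rule attaching_map_eq[OF c w realizes_params[OF w] assms(2)])
qed

lemma attaching_map_strict:
  assumes s: "strict_placement D c \<alpha> h" and "simple_wgraph (fst \<alpha>)"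
  shows "attaching_map D c \<alpha> (params (fst \<alpha>, h)) = curve_iso_rel D c `` {(fst \<alpha>, h)}"
  using attaching_map_placement[OF strict_placement[OF c s]] normal_form_self assms
  by (auto simp: strict_placement_def)

lemma class_eq_iff:
  assumes "param_curve D c C" "param_curve D c C'"
  shows "curve_iso_rel D c `` {C} = curve_iso_rel D c `` {C'} \<longleftrightarrow> curve_iso C C'"
proof -
  have "curve_iso_rel D c `` {C} = curve_iso_rel D c `` {C'} \<longleftrightarrow> (C, C') \<in> curve_iso_rel D c"
    using eq_equiv_class_iff[OF equiv_curve_iso_rel[of D c], of C C'] assms by simp
  then show ?thesis using assms by (auto simp: curve_iso_rel_def)
qed

lemma transport_curve:
  assumes p: "param_curve D c (H', h')" and i: "wgraph_iso \<phi> \<psi> G H'" and wf: "wgraph_wf G"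
  shows "param_curve D c (G, h' \<circ> \<phi>)" "curve_iso (G, h' \<circ> \<phi>) (H', h')"
proof -
  obtain \<phi>' \<psi>' where j: "wgraph_iso \<phi>' \<psi>' H' G" "\<And>v. v \<in> verts G \<Longrightarrow> \<phi>' (\<phi> v) = v"
    using wgraph_iso_sym[OF wf i] by metis
  have V: "verts H' = \<phi> ` verts G" using i by (auto simp: wgraph_iso_def bij_betw_def)
  have wfH: "wgraph_wf H'" by (rule wgraph_iso_wf[OF wf i])
  have "(h' \<circ> \<phi>) (\<phi>' x) = h' x" if "x \<in> verts H'" for x using that V j(2) by auto
  then have "curve_contraction \<phi>' \<psi>' H' h' {} {} G (h' \<circ> \<phi>)"
    using curve_contraction_iso[OF wfH j(1), of "h' \<circ> \<phi>" h'] by blast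
  then show "param_curve D c (G, h' \<circ> \<phi>)"
    using zero_contraction_param[OF c] param_weak[OF p] by metis
  show "curve_iso (G, h' \<circ> \<phi>) (H', h')" using i by (auto simp: curve_iso_def)
qed

context
  fixes \<omega> :: "'i set \<Rightarrow> 'i \<Rightarrow> ennreal" and g n :: nat and A :: real
  assumes \<omega>: "simple_density D \<omega>" and A: "0 < A"
begin

private abbreviation (input) "M \<equiv> moduli D c \<omega> g n A"
private abbreviation (input) "T \<equiv> good_types D c \<omega> g n A"
private abbreviation (input) "R \<equiv> curve_iso_rel D c"
private abbreviation (input) "S \<equiv> stratum D c \<omega> g n A"
private abbreviation (input) "\<iota> \<equiv> attaching_map D c"
private abbreviation (input) "P \<equiv> polyhedron_of D c"
private abbreviation (input) "cP \<alpha> \<equiv> closure (polyhedron_of D c \<alpha>)"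
private abbreviation (input) "\<M> \<equiv> natural_topology D c \<omega> g n A"
private abbreviation (input) "cls \<alpha> \<equiv> ctype_iso_rel `` {\<alpha>}"

lemma closure_polyhedronE:
  assumes "\<alpha> \<in> T" "p \<in> cP \<alpha>"
  obtains h where "placement D c \<alpha> h" "p = params (fst \<alpha>, h)"
proof -
  obtain h0 where "strict_placement D c \<alpha> h0" using assms(1) good_types_iff[OF c] by blast
  then show thesis using assms(2) that unfolding closure_polyhedron[OF c \<open>strict_placement D c \<alpha> h0\<close>] by blast
qed

lemma closure_polyhedronI:
  assumes "\<alpha> \<in> T" "placement D c \<alpha> h"
  shows "params (fst \<alpha>, h) \<in> cP \<alpha>"
proof -
  obtain h0 where "strict_placement D c \<alpha> h0" using assms(1) good_types_iff[OF c] by blast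
  then show ?thesis using assms(2) unfolding closure_polyhedron[OF c \<open>strict_placement D c \<alpha> h0\<close>] by blast
qed

lemma attaching_map_moduli:
  assumes \<alpha>: "\<alpha> \<in> T" and p: "p \<in> cP \<alpha>"
  shows "\<iota> \<alpha> p \<in> M"
proof -
  obtain h where h: "placement D c \<alpha> h" "p = params (fst \<alpha>, h)" by (rule closure_polyhedronE[OF \<alpha> p])
  then have w: "weak_curve D c (fst \<alpha>) h" by (simp add: placement_def)
  obtain K where K: "normal_form (fst \<alpha>) h K h" using normal_form_exists[OF c w] by metis
  have "(K, h) \<in> simple_curves D c \<omega> g n A" by (rule normal_form_simple_curve[OF c \<alpha> \<omega> h(1) K])
  then show ?thesis unfolding h(2) attaching_map_placement[OF h(1) K] by (rule moduli_class[OF c])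
qed

lemma moduliE:
  assumes "X \<in> M"
  obtains G h where "X = R `` {(G, h)}" "(G, h) \<in> simple_curves D c \<omega> g n A" "param_curve D c (G, h)"
proof -
  obtain C where C: "X = R `` {C}" "C \<in> simple_curves D c \<omega> g n A" using assms by (auto simp: moduli_def quotient_def)
  then show thesis using that[of "fst C" "snd C"] by (simp add: simple_curves_def)
qed

lemma good_comb_type: "\<alpha> \<in> T \<Longrightarrow> comb_type \<alpha>" "\<alpha> \<in> T \<Longrightarrow> wgraph_wf (fst \<alpha>)"
  by (auto simp: good_types_def comb_type_def)

lemma mem_stratum_iff:
  assumes \<alpha>: "\<alpha> \<in> T" and p: "param_curve D c (G, h)"
  shows "R `` {(G, h)} \<in> S (cls \<alpha>) \<longleftrightarrow> R `` {(G, h)} \<in> M \<and> ctype_iso \<alpha> (type_of_curve D c (G, h))"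
proof -
  have ct: "comb_type (type_of_curve D c C)" if "param_curve D c C" for C
  proof -
    obtain G h where C: "C = (G, h)" by (cases C)
    have pG: "param_curve D c (G, h)" using that C by simp
    have "supp (h v) \<noteq> {}" if "v \<in> verts G" for v
      using supp_face[OF c param_curve_verts[OF c pG that]] by (auto simp: face_sets_def)
    then show ?thesis
      using param_curve_wf[OF c pG] carrier_supp[OF c pG] by (simp add: C comb_type_def type_of_curve_def)
  qed
  have "(\<exists>C\<in>R `` {(G, h)}. type_of_curve D c C \<in> cls \<alpha>) \<longleftrightarrow> ctype_iso \<alpha> (type_of_curve D c (G, h))"
  proof
    assume "\<exists>C\<in>R `` {(G, h)}. type_of_curve D c C \<in> cls \<alpha>"
    then obtain C where C: "param_curve D c C" "curve_iso (G, h) C" "ctype_iso \<alpha> (type_of_curve D c C)"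
      by (auto simp: curve_iso_rel_def ctype_iso_rel_def)
    have "curve_iso C (G, h)" using curve_iso_sym[OF _ C(2)] param_curve_wf[OF c p] by simp
    then show "ctype_iso \<alpha> (type_of_curve D c (G, h))"
      using ctype_iso_trans[OF good_comb_type(2)[OF \<alpha>] C(3) curve_iso_type[OF c]] by blast
  next
    assume "ctype_iso \<alpha> (type_of_curve D c (G, h))"
    then have "type_of_curve D c (G, h) \<in> cls \<alpha>"
      using good_comb_type(1)[OF \<alpha>] ct[OF p] by (simp add: ctype_iso_rel_def)
    moreover have "(G, h) \<in> R `` {(G, h)}" using p by (simp add: curve_iso_rel_def curve_iso_refl)
    ultimately show "\<exists>C\<in>R `` {(G, h)}. type_of_curve D c C \<in> cls \<alpha>" by blast
  qed
  then show ?thesis by (simp add: stratum_def)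
qed

lemma stratum_subset: "S a \<subseteq> M"
  by (auto simp: stratum_def)

lemma stratum_eq:
  assumes \<alpha>: "\<alpha> \<in> T"
  shows "S (cls \<alpha>) = \<iota> \<alpha> ` P \<alpha>"
proof -
  obtain h0 where h0: "strict_placement D c \<alpha> h0" and sim: "simple_wgraph (fst \<alpha>)"
    using \<alpha> by (auto simp: good_types_iff[OF c])
  note wf = good_comb_type(2)[OF \<alpha>]
  show ?thesis
  proof (intro set_eqI iffI)
    fix X assume X: "X \<in> S (cls \<alpha>)"
    then obtain H' h' where C: "X = R `` {(H', h')}" "param_curve D c (H', h')"
      using stratum_subset by (meson moduliE subsetD)
    have "ctype_iso \<alpha> (type_of_curve D c (H', h'))" using X mem_stratum_iff[OF \<alpha> C(2)] C(1) by simp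
    then obtain \<phi> \<psi> where i: "wgraph_iso \<phi> \<psi> (fst \<alpha>) H'"
      and I: "\<And>v. v \<in> verts (fst \<alpha>) \<Longrightarrow> carrier_face D c (h' (\<phi> v)) = snd \<alpha> v"
      by (auto simp: ctype_iso_def ctype_iso_via_def type_of_curve_def)
    note t = transport_curve[OF C(2) i wf]
    have s: "strict_placement D c \<alpha> (h' \<circ> \<phi>)"
      unfolding strict_placement_def using t(1) I carrier_supp[OF c t(1)] by simp
    have "\<iota> \<alpha> (params (fst \<alpha>, h' \<circ> \<phi>)) = X"
      unfolding attaching_map_strict[OF s sim] C(1) class_eq_iff[OF t(1) C(2)] by (rule t(2))
    then show "X \<in> \<iota> \<alpha> ` P \<alpha>" using s unfolding polyhedron_of_eq[OF c h0] by blast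
  next
    fix X assume "X \<in> \<iota> \<alpha> ` P \<alpha>"
    then obtain h where s: "strict_placement D c \<alpha> h" and X: "X = \<iota> \<alpha> (params (fst \<alpha>, h))"
      unfolding polyhedron_of_eq[OF c h0] by blast
    have p: "param_curve D c (fst \<alpha>, h)" using s by (simp add: strict_placement_def)
    have X': "X = R `` {(fst \<alpha>, h)}" unfolding X by (rule attaching_map_strict[OF s sim])
    have "ctype_iso_via (\<lambda>v. v) (\<lambda>e. e) \<alpha> (type_of_curve D c (fst \<alpha>, h))"
      using s carrier_supp[OF c p]
      by (auto simp: ctype_iso_via_def type_of_curve_def strict_placement_def wgraph_iso_def bij_betw_def)
    then have "ctype_iso \<alpha> (type_of_curve D c (fst \<alpha>, h))" unfolding ctype_iso_def by blast
    moreover have "X \<in> M"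
      using attaching_map_moduli[OF \<alpha> closure_polyhedronI[OF \<alpha> strict_placement[OF c s]]] X by simp
    ultimately show "X \<in> S (cls \<alpha>)" unfolding X' mem_stratum_iff[OF \<alpha> p] by simp
  qed
qed

text \<open>The contracted edges and the carriers at one point that is mapped to the stratum serve as a pattern:
  any other curve in the stratum is expanded following the same pattern.\<close>

lemma stratum_subset_image:
  assumes \<alpha>: "\<alpha> \<in> T" and \<beta>: "\<beta> \<in> T" and p: "p \<in> cP \<alpha>" "\<iota> \<alpha> p \<in> S (cls \<beta>)"
  shows "S (cls \<beta>) \<subseteq> \<iota> \<alpha> ` cP \<alpha>"
proof
  let ?G = "fst \<alpha>"
  obtain h0 where h0: "placement D c \<alpha> h0" "p = params (?G, h0)" by (rule closure_polyhedronE[OF \<alpha> p(1)])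
  then have w0: "weak_curve D c ?G h0" and sub: "\<And>v. v \<in> verts ?G \<Longrightarrow> supp (h0 v) \<subseteq> snd \<alpha> v"
    by (auto simp: placement_def)
  let ?Z = "zero_edges ?G h0" and ?r = "\<lambda>v. Min (component ?G (zero_edges ?G h0) v)"
  let ?G1 = "contract ?G ?Z"
  obtain H where H: "simplification ?G1 H" "normal_form ?G h0 H h0" using normal_form_exists[OF c w0] by metis
  note cc = zero_contract[OF c w0]
  have con: "contraction ?r (\<lambda>e. e) ?G ?Z ?G1" and r: "\<And>v. v \<in> verts ?G \<Longrightarrow> h0 (?r v) = h0 v"
    using cc by (auto simp: curve_contraction_def)
  have p1: "param_curve D c (?G1, h0)" by (rule zero_contraction_param[OF c w0 cc])
  have pH: "param_curve D c (H, h0)" by (rule normal_form_invariants(1)[OF c w0 H(2)])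
  have steps: "smooth_step\<^sup>*\<^sup>* ?G1 H" using H(1) by (simp add: simplification_def)
  have \<iota>p: "\<iota> \<alpha> p = R `` {(H, h0)}" unfolding h0(2) by (rule attaching_map_placement[OF h0(1) H(2)])
  then have \<beta>H: "ctype_iso \<beta> (type_of_curve D c (H, h0))" using p(2) mem_stratum_iff[OF \<beta> pH] by simp
  fix X assume X: "X \<in> S (cls \<beta>)"
  then obtain H' h' where C: "X = R `` {(H', h')}" "param_curve D c (H', h')"
    using stratum_subset by (meson moduliE subsetD)
  have "ctype_iso \<beta> (type_of_curve D c (H', h'))" using X mem_stratum_iff[OF \<beta> C(2)] C(1) by simp
  then have "ctype_iso (type_of_curve D c (H, h0)) (type_of_curve D c (H', h'))"
    using ctype_iso_trans[OF _ ctype_iso_sym[OF good_comb_type(2)[OF \<beta>] \<beta>H]] param_curve_wf[OF c pH]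
    by (simp add: type_of_curve_def)
  then obtain \<phi> \<psi> where i: "wgraph_iso \<phi> \<psi> H H'"
    and I: "\<And>v. v \<in> verts H \<Longrightarrow> carrier_face D c (h' (\<phi> v)) = carrier_face D c (h0 v)"
    by (auto simp: ctype_iso_def ctype_iso_via_def type_of_curve_def)
  note t = transport_curve[OF C(2) i param_curve_wf[OF c pH]]
  have "supp ((h' \<circ> \<phi>) x) = supp (h0 x)" if "x \<in> verts H" for x
    using I[OF that] carrier_supp[OF c t(1) that] carrier_supp[OF c pH that] by simp
  then obtain h2 where h2: "param_curve D c (?G1, h2)" "\<forall>x\<in>verts ?G1. supp (h2 x) = supp (h0 x)"
    "\<forall>x\<in>verts H. h2 x = (h' \<circ> \<phi>) x"
    using unsmooth_steps[OF steps p1 t(1)] by blast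
  have "supp (h2 (?r v)) = supp (h0 v)" if "v \<in> verts ?G" for v
    using h2(2) r[OF that] contraction_verts[OF weak_curveD(1)[OF w0] con] that by simp
  note u = uncontract[OF w0 con h2(1) this]
  have pl: "placement D c \<alpha> (h2 \<circ> ?r)"
    using u(1) sub \<open>\<And>v. v \<in> verts ?G \<Longrightarrow> supp (h2 (?r v)) = supp (h0 v)\<close> by (auto simp: placement_def)
  have nf: "normal_form ?G (h2 \<circ> ?r) H h2" using u(3) H(1) unfolding normal_form_def by blast
  have pH2: "param_curve D c (H, h2)" by (rule normal_form_invariants(1)[OF c u(1) nf])
  have "curve_iso (H, h2) (H', h')" using i h2(3) by (auto simp: curve_iso_def)
  then have "\<iota> \<alpha> (params (?G, h2 \<circ> ?r)) = X"
    unfolding attaching_map_placement[OF pl nf] C(1) class_eq_iff[OF pH2 C(2)] .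
  then show "X \<in> \<iota> \<alpha> ` cP \<alpha>" using closure_polyhedronI[OF \<alpha> pl] by blast
qed

text \<open>On the boundary of the polyhedron an edge is lost or a carrier shrinks.\<close>

lemma boundary_not_in_stratum:
  assumes \<alpha>: "\<alpha> \<in> T" and p: "p \<in> cP \<alpha>" "\<iota> \<alpha> p \<in> S (cls \<alpha>)"
  shows "p \<in> P \<alpha>"
proof -
  let ?G = "fst \<alpha>"
  obtain h where h: "placement D c \<alpha> h" "p = params (?G, h)" by (rule closure_polyhedronE[OF \<alpha> p(1)])
  then have w: "weak_curve D c ?G h" and sub: "\<And>v. v \<in> verts ?G \<Longrightarrow> supp (h v) \<subseteq> snd \<alpha> v"
    by (auto simp: placement_def)
  note wf = weak_curveD(1)[OF w]
  obtain h0 where h0: "strict_placement D c \<alpha> h0" and sim: "simple_wgraph ?G"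
    using \<alpha> by (auto simp: good_types_iff[OF c])
  obtain K where K: "simplification (contract ?G (zero_edges ?G h)) K" "normal_form ?G h K h"
    using normal_form_exists[OF c w] by metis
  have pK: "param_curve D c (K, h)" by (rule normal_form_invariants(1)[OF c w K(2)])
  have iso: "ctype_iso \<alpha> (type_of_curve D c (K, h))"
    using p(2) mem_stratum_iff[OF \<alpha> pK] unfolding h(2) attaching_map_placement[OF h(1) K(2)] by simp
  then have "card (edges ?G) = card (edges K)"
    by (auto simp: ctype_iso_def ctype_iso_via_def type_of_curve_def wgraph_iso_def intro: bij_betw_same_card)
  moreover have "card (edges K) \<le> card (edges (contract ?G (zero_edges ?G h)))"
    using smooth_steps_card_edges[OF _ zero_contraction_param[OF c w zero_contract[OF c w]]] K(1)
    by (simp add: simplification_def)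
  moreover have "card (edges (contract ?G (zero_edges ?G h))) + card (zero_edges ?G h) = card (edges ?G)"
  proof (rule contraction_card_edges[OF wf])
    show "contraction (\<lambda>v. Min (component ?G (zero_edges ?G h) v)) (\<lambda>e. e) ?G (zero_edges ?G h)
        (contract ?G (zero_edges ?G h))"
      using zero_contract[OF c w] by (simp add: curve_contraction_def)
  qed
  ultimately have "card (zero_edges ?G h) = 0" by linarith
  then have z: "zero_edges ?G h = {}"
    using finite_subset[OF zero_edges_subset wf_finite(2)[OF wf]] by simp
  then have pG: "param_curve D c (?G, h)" using w param_curve_iff[OF c] by blast
  have "\<iota> \<alpha> p = R `` {(?G, h)}" unfolding h(2) by (rule attaching_map_placement[OF h(1) normal_form_self[OF pG sim]])
  then have "ctype_iso \<alpha> (type_of_curve D c (?G, h))" using p(2) mem_stratum_iff[OF \<alpha> pG] by simp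
  then obtain \<phi> \<psi> where i: "wgraph_iso \<phi> \<psi> ?G ?G"
    and I: "\<And>v. v \<in> verts ?G \<Longrightarrow> carrier_face D c (h (\<phi> v)) = snd \<alpha> v"
    by (auto simp: ctype_iso_def ctype_iso_via_def type_of_curve_def)
  have bij: "bij_betw \<phi> (verts ?G) (verts ?G)" using i by (simp add: wgraph_iso_def)
  have "(\<Sum>v\<in>verts ?G. card (supp (h v))) = (\<Sum>v\<in>verts ?G. card (supp (h (\<phi> v))))"
    using sum.reindex_bij_betw[OF bij, of "\<lambda>v. card (supp (h v))"] by simp
  also have "\<dots> = (\<Sum>v\<in>verts ?G. card (snd \<alpha> v))"
  proof (rule sum.cong[OF refl])
    fix v assume v: "v \<in> verts ?G"
    then have "\<phi> v \<in> verts ?G" using bij by (auto dest: bij_betwE)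
    from carrier_supp[OF c pG this] show "card (supp (h (\<phi> v))) = card (snd \<alpha> v)" using I[OF v] by simp
  qed
  finally have eq: "(\<Sum>v\<in>verts ?G. card (supp (h v))) = (\<Sum>v\<in>verts ?G. card (snd \<alpha> v))" .
  have le: "card (supp (h v)) \<le> card (snd \<alpha> v)" if "v \<in> verts ?G" for v
    using sub[OF that] by (intro card_mono) auto
  have "supp (h v) = snd \<alpha> v" if v: "v \<in> verts ?G" for v
  proof (rule card_subset_eq[OF _ sub[OF v]])
    show "card (supp (h v)) = card (snd \<alpha> v)"
      by (rule sum_mono_inv[OF eq le v wf_finite(1)[OF wf]])
  qed simp
  then have "strict_placement D c \<alpha> h" using pG by (simp add: strict_placement_def)
  then show ?thesis unfolding polyhedron_of_eq[OF c h0] h(2) by blast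
qed

section \<open>Closedness of the gluing relation\<close>

text \<open>A fixed simplification for each set of contracted edges, so that only finitely many graphs, and hence
  only finitely many isomorphisms between them, occur as the positions vary.\<close>

definition reduced :: "'i wgraph \<Rightarrow> nat set \<Rightarrow> 'i wgraph" where
  "reduced G Z = (SOME H. simplification (contract G Z) H)"


lemma reduced:
  assumes w: "weak_curve D c G h"
  shows "simplification (contract G (zero_edges G h)) (reduced G (zero_edges G h))"
    "normal_form G h (reduced G (zero_edges G h)) h"
    "verts (reduced G (zero_edges G h)) \<subseteq> verts G"
proof -
  have "\<exists>K. simplification (contract G (zero_edges G h)) K"
    using normal_form_exists[OF c w] by metis
  then show s: "simplification (contract G (zero_edges G h)) (reduced G (zero_edges G h))"
    unfolding reduced_def by (rule someI_ex)
  then show "normal_form G h (reduced G (zero_edges G h)) h" by (rule normal_form_contract[OF c w])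
  have "smooth_step\<^sup>*\<^sup>* (contract G (zero_edges G h)) (reduced G (zero_edges G h))"
    using s by (simp add: simplification_def)
  then have "verts (reduced G (zero_edges G h)) \<subseteq> verts (contract G (zero_edges G h))"
    using smooth_steps_invariants[OF c _ zero_contraction_param[OF c w zero_contract[OF c w]]] by blast
  also have "\<dots> \<subseteq> verts G" by (rule contract_verts_subset[OF c weak_curveD(1)[OF w] zero_edges_subset])
  finally show "verts (reduced G (zero_edges G h)) \<subseteq> verts G" .
qed

lemma normal_form_limit:
  assumes w: "weak_curve D c G h" and w': "weak_curve D c G h'" and Z: "zero_edges G h \<subseteq> zero_edges G h'"
    and H: "simplification (contract G (zero_edges G h)) H"
  shows "weak_curve D c H h'"
    "normal_form H h' X x \<Longrightarrow> \<exists>Y y. normal_form G h' Y y \<and> curve_iso (X, x) (Y, y)"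
proof -
  let ?G1 = "contract G (zero_edges G h)"
  have con: "contraction (\<lambda>v. Min (component G (zero_edges G h) v)) (\<lambda>e. e) G (zero_edges G h) ?G1"
    using zero_contract[OF c w] by (simp add: curve_contraction_def)
  have cc: "curve_contraction (\<lambda>v. Min (component G (zero_edges G h) v)) (\<lambda>e. e) G h' (zero_edges G h) {} ?G1 h'"
    by (rule contract_curve_contraction[OF c weak_curveD(1)[OF w] Z con])
  have p1: "param_curve D c (?G1, h)" by (rule zero_contraction_param[OF c w zero_contract[OF c w]])
  have w1: "weak_curve D c ?G1 h'" by (rule weak_curve_contraction[OF w' cc])
  have "smooth_step\<^sup>*\<^sup>* ?G1 H" using H by (simp add: simplification_def)
  note n = normal_form_smooth_steps[OF this p1 w1]
  then show "weak_curve D c H h'" by blast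
  assume "normal_form H h' X x"
  then obtain Y y where Y: "normal_form ?G1 h' Y y" "curve_iso (X, x) (Y, y)" using n by blast
  have "normal_form G h' Y y" by (rule normal_form_contraction[OF c w' cc Z Y(1)])
  then show "\<exists>Y y. normal_form G h' Y y \<and> curve_iso (X, x) (Y, y)" using Y(2) by blast
qed

text \<open>Suppose that the curves at \<open>h\<close> and \<open>k\<close> have isomorphic simplifications, and that \<open>h'\<close> and \<open>k'\<close> are
  degenerations whose positions still match under that isomorphism. The simplified graphs with the
  degenerate positions are then isomorphic, and their normal forms are those of \<open>h'\<close> and \<open>k'\<close>.\<close>

lemma attaching_maps_agree_in_limit:
  assumes h: "placement D c \<alpha> h" "placement D c \<alpha> h'" "zero_edges (fst \<alpha>) h \<subseteq> zero_edges (fst \<alpha>) h'"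
    and k: "placement D c \<beta> k" "placement D c \<beta> k'" "zero_edges (fst \<beta>) k \<subseteq> zero_edges (fst \<beta>) k'"
    and i: "wgraph_iso \<phi> \<psi> (reduced (fst \<alpha>) (zero_edges (fst \<alpha>) h)) (reduced (fst \<beta>) (zero_edges (fst \<beta>) k))"
    and eq: "\<And>x. x \<in> verts (reduced (fst \<alpha>) (zero_edges (fst \<alpha>) h)) \<Longrightarrow> k' (\<phi> x) = h' x"
  shows "\<iota> \<alpha> (params (fst \<alpha>, h')) = \<iota> \<beta> (params (fst \<beta>, k'))"
proof -
  let ?H = "reduced (fst \<alpha>) (zero_edges (fst \<alpha>) h)" and ?K = "reduced (fst \<beta>) (zero_edges (fst \<beta>) k)"
  have w: "weak_curve D c (fst \<alpha>) h" "weak_curve D c (fst \<alpha>) h'" "weak_curve D c (fst \<beta>) k" "weak_curve D c (fst \<beta>) k'"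
    using h k by (auto simp: placement_def)
  note H = normal_form_limit[OF w(1,2) h(3) reduced(1)[OF w(1)]]
  note K = normal_form_limit[OF w(3,4) k(3) reduced(1)[OF w(3)]]
  have cc: "curve_contraction \<phi> \<psi> ?H h' {} {} ?K k'"
    using curve_contraction_iso[OF weak_curveD(1)[OF H(1)] i, of k' h'] eq by blast
  obtain X where X: "normal_form ?K k' X k'" using normal_form_exists[OF c K(1)] by metis
  have XH: "normal_form ?H h' X k'" by (rule normal_form_contraction[OF c H(1) cc _ X]) simp
  have pX: "param_curve D c (X, k')" by (rule normal_form_invariants(1)[OF c K(1) X])
  obtain Y y where Y: "normal_form (fst \<alpha>) h' Y y" "curve_iso (X, k') (Y, y)" using H(2)[OF XH] by blast
  obtain Y' y' where Y': "normal_form (fst \<beta>) k' Y' y'" "curve_iso (X, k') (Y', y')" using K(2)[OF X] by blast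
  have "R `` {(Y, y)} = R `` {(X, k')}" "R `` {(Y', y')} = R `` {(X, k')}"
    using class_eq_iff[OF pX normal_form_invariants(1)[OF c w(2) Y(1)]] Y(2)
      class_eq_iff[OF pX normal_form_invariants(1)[OF c w(4) Y'(1)]] Y'(2) by auto
  then show ?thesis
    unfolding attaching_map_placement[OF h(2) Y(1)] attaching_map_placement[OF k(2) Y'(1)] by simp
qed

lemma placement_position:
  assumes "placement D c \<alpha> h" "v \<in> verts (fst \<alpha>)"
  shows "position (fst \<alpha>) (params (fst \<alpha>, h)) v = h v"
  using position[OF _ realizes_params] assms weak_curveD(1) unfolding placement_def by metis

lemma placement_zero_edges:
  assumes "placement D c \<alpha> h"
  shows "zero_edges (fst \<alpha>) h = {e \<in> edges (fst \<alpha>). snd (params (fst \<alpha>, h)) e = 0}"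
  using realizes_zero_edges[OF c _ realizes_params] assms weak_curveD(1) unfolding placement_def by metis

lemma closure_compact: "\<alpha> \<in> T \<Longrightarrow> compact (cP \<alpha>)"
  using compact_placement_params[OF c] closure_polyhedron[OF c] good_types_iff[OF c] by metis

text \<open>The preimage is the projection of the set of pairs \<open>(p, q)\<close> with the same image. That set is covered by
  finitely many compact sets, one for each choice of contracted edges on both sides and of a
  matching of the vertices that is realized by some pair of points; by the previous lemma
  these sets contain only pairs with the same image.\<close>

lemma closed_preimage_of_compact:
  assumes \<alpha>: "\<alpha> \<in> T" and \<beta>: "\<beta> \<in> T" and C: "compact C" "C \<subseteq> cP \<alpha>"
  shows "closed {q \<in> cP \<beta>. \<iota> \<beta> q \<in> \<iota> \<alpha> ` C}"
proof -
  let ?G = "fst \<alpha>" and ?G' = "fst \<beta>"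
  note wf = good_comb_type(2)[OF \<alpha>] and wf' = good_comb_type(2)[OF \<beta>]
  define \<D> where "\<D> = Pow (edges ?G) \<times> Pow (edges ?G') \<times> (verts ?G \<rightarrow>\<^sub>E verts ?G')"
  define valid where "valid = (\<lambda>(Z, Z', \<phi>). \<exists>h k \<psi>. placement D c \<alpha> h \<and> placement D c \<beta> k \<and>
    zero_edges ?G h = Z \<and> zero_edges ?G' k = Z' \<and> wgraph_iso \<phi> \<psi> (reduced ?G Z) (reduced ?G' Z'))"
  define W where "W = (\<lambda>(Z, Z', \<phi>). {(p, q) \<in> C \<times> cP \<beta>. (\<forall>e\<in>Z. snd p e = 0) \<and> (\<forall>e\<in>Z'. snd q e = 0) \<and>
    (\<forall>x\<in>verts (reduced ?G Z). position ?G' q (\<phi> x) = position ?G p x)})"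
  have "finite \<D>"
    unfolding \<D>_def using wf_finite[OF wf] wf_finite[OF wf'] by (intro finite_cartesian_product finite_PiE) auto
  then have fin: "finite {d \<in> \<D>. valid d}" by simp
  have cW: "compact (snd ` W d)" for d
  proof -
    obtain Z Z' \<phi> where d: "d = (Z, Z', \<phi>)" by (cases d) auto
    have len: "continuous_on UNIV (\<lambda>pq :: 'i param \<times> 'i param. snd (fst pq) e)" for e
      by (rule continuous_on_compose2[OF continuous_on_length[of UNIV] continuous_on_fst[OF continuous_on_id]]) simp
    have len': "continuous_on UNIV (\<lambda>pq :: 'i param \<times> 'i param. snd (snd pq) e)" for e
      by (rule continuous_on_compose2[OF continuous_on_length[of UNIV] continuous_on_snd[OF continuous_on_id]]) simp
    have pos: "continuous_on UNIV (\<lambda>pq :: 'i param \<times> 'i param. position ?G (fst pq) x)" for x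
      by (rule continuous_on_compose2[OF continuous_on_position[of UNIV] continuous_on_fst[OF continuous_on_id]]) simp
    have pos': "continuous_on UNIV (\<lambda>pq :: 'i param \<times> 'i param. position ?G' (snd pq) x)" for x
      by (rule continuous_on_compose2[OF continuous_on_position[of UNIV] continuous_on_snd[OF continuous_on_id]]) simp
    have "W d = (C \<times> cP \<beta>) \<inter> {pq. (\<forall>e. e \<in> Z \<longrightarrow> snd (fst pq) e = 0) \<and> (\<forall>e. e \<in> Z' \<longrightarrow> snd (snd pq) e = 0) \<and>
      (\<forall>x. x \<in> verts (reduced ?G Z) \<longrightarrow> position ?G' (snd pq) (\<phi> x) = position ?G (fst pq) x)}"
      unfolding d W_def by auto
    moreover have "closed {pq :: 'i param \<times> 'i param. (\<forall>e. e \<in> Z \<longrightarrow> snd (fst pq) e = 0) \<and> (\<forall>e. e \<in> Z' \<longrightarrow> snd (snd pq) e = 0) \<and>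
      (\<forall>x. x \<in> verts (reduced ?G Z) \<longrightarrow> position ?G' (snd pq) (\<phi> x) = position ?G (fst pq) x)}"
      by (intro closed_Collect_conj closed_Collect_all closed_Collect_imp open_Collect_const
          closed_Collect_eq len len' pos pos' continuous_on_const)
    ultimately have "compact (W d)"
      using compact_Times[OF C(1) closure_compact[OF \<beta>]] by (simp add: compact_Int_closed)
    then show ?thesis by (intro compact_continuous_image continuous_intros)
  qed
  have "{q \<in> cP \<beta>. \<iota> \<beta> q \<in> \<iota> \<alpha> ` C} = (\<Union>d\<in>{d \<in> \<D>. valid d}. snd ` W d)"
  proof (intro set_eqI iffI)
    fix q assume "q \<in> {q \<in> cP \<beta>. \<iota> \<beta> q \<in> \<iota> \<alpha> ` C}"
    then obtain p where q: "q \<in> cP \<beta>" and p: "p \<in> C" and eq: "\<iota> \<alpha> p = \<iota> \<beta> q" by auto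
    have "p \<in> cP \<alpha>" using p C by blast
    then obtain h where h: "placement D c \<alpha> h" "p = params (?G, h)" by (rule closure_polyhedronE[OF \<alpha>])
    obtain k where k: "placement D c \<beta> k" "q = params (?G', k)" by (rule closure_polyhedronE[OF \<beta> q])
    have w: "weak_curve D c ?G h" "weak_curve D c ?G' k" using h k by (auto simp: placement_def)
    let ?Z = "zero_edges ?G h" and ?Z' = "zero_edges ?G' k"
    let ?H = "reduced ?G ?Z" and ?K = "reduced ?G' ?Z'"
    have "R `` {(?H, h)} = R `` {(?K, k)}"
      using eq unfolding h(2) k(2) attaching_map_placement[OF h(1) reduced(2)[OF w(1)]]
        attaching_map_placement[OF k(1) reduced(2)[OF w(2)]] .
    then have "curve_iso (?H, h) (?K, k)"
      using class_eq_iff[OF normal_form_invariants(1)[OF c w(1) reduced(2)[OF w(1)]]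
        normal_form_invariants(1)[OF c w(2) reduced(2)[OF w(2)]]] by simp
    then obtain \<phi> \<psi> where i: "wgraph_iso \<phi> \<psi> ?H ?K" and hk: "\<And>x. x \<in> verts ?H \<Longrightarrow> k (\<phi> x) = h x"
      by (auto simp: curve_iso_def)
    have wfH: "wgraph_wf ?H" using normal_form_invariants(1)[OF c w(1) reduced(2)[OF w(1)]] param_curve_wf[OF c] by blast
    have \<phi>K: "\<phi> x \<in> verts ?K" if "x \<in> verts ?H" for x
      using i that by (auto simp: wgraph_iso_def dest: bij_betwE)
    \<comment> \<open>Outside the simplified graph the values are normalized, so that \<open>\<phi>'\<close> ranges over a finite set.\<close>
    define \<phi>' where "\<phi>' x = (if x \<in> verts ?H then \<phi> x else if x \<in> verts ?G then root ?G' else undefined)" for x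
    have "\<phi>' \<in> verts ?G \<rightarrow>\<^sub>E verts ?G'"
      using \<phi>K reduced(3)[OF w(1)] reduced(3)[OF w(2)] root_in_verts[OF wf'] by (auto simp: \<phi>'_def PiE_iff extensional_def)
    then have dD: "(?Z, ?Z', \<phi>') \<in> \<D>" using zero_edges_subset by (auto simp: \<D>_def)
    have same: "\<phi>' x = \<phi> x" if "x \<in> verts ?H" for x using that by (simp add: \<phi>'_def)
    have "wgraph_iso \<phi>' \<psi> ?H ?K"
    proof -
      have im: "\<phi>' ` ends ?H e = \<phi> ` ends ?H e" if "e \<in> edges ?H" for e
        using wf_ends(1)[OF wfH that] same by (intro image_cong) auto
      have bij: "bij_betw \<phi>' (verts ?H) (verts ?K)"
        using i bij_betw_cong[of "verts ?H" \<phi>' \<phi> "verts ?K"] same by (simp add: wgraph_iso_def)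
      have mk: "map \<phi>' (marks ?H) = map \<phi> (marks ?H)"
        using wf_marks[OF wfH] same by (intro map_cong) auto
      have wt: "wt ?K (\<phi>' v) (\<psi> e) = wt ?H v e" if "e \<in> edges ?H" "v \<in> ends ?H e" for e v
      proof -
        have "v \<in> verts ?H" using wf_ends(1)[OF wfH that(1)] that(2) by blast
        then show ?thesis using i that same by (simp add: wgraph_iso_def)
      qed
      show ?thesis unfolding wgraph_iso_def
        using bij im mk wt same i by (simp add: wgraph_iso_def)
    qed
    then have "valid (?Z, ?Z', \<phi>')" unfolding valid_def using h(1) k(1) by blast
    moreover have "(p, q) \<in> W (?Z, ?Z', \<phi>')"
    proof -
      have "position ?G' q (\<phi>' x) = position ?G p x" if x: "x \<in> verts ?H" for x
      proof -
        have "x \<in> verts ?G" "\<phi> x \<in> verts ?G'" using x \<phi>K reduced(3)[OF w(1)] reduced(3)[OF w(2)] by blast+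
        then show ?thesis
          using same[OF x] hk[OF x] placement_position[OF h(1)] placement_position[OF k(1)] by (simp add: h(2) k(2))
      qed
      then show ?thesis
        using p q placement_zero_edges[OF h(1)] placement_zero_edges[OF k(1)] by (auto simp: W_def h(2) k(2))
    qed
    ultimately show "q \<in> (\<Union>d\<in>{d \<in> \<D>. valid d}. snd ` W d)" using dD by force
  next
    fix q assume "q \<in> (\<Union>d\<in>{d \<in> \<D>. valid d}. snd ` W d)"
    then obtain Z Z' \<phi> p where v: "valid (Z, Z', \<phi>)" and pq: "(p, q) \<in> W (Z, Z', \<phi>)" by force
    obtain h k \<psi> where h: "placement D c \<alpha> h" and k: "placement D c \<beta> k" and Z: "zero_edges ?G h = Z"
      "zero_edges ?G' k = Z'" and i: "wgraph_iso \<phi> \<psi> (reduced ?G Z) (reduced ?G' Z')"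
      using v by (auto simp: valid_def)
    have p: "p \<in> C" and q: "q \<in> cP \<beta>" and z: "\<forall>e\<in>Z. snd p e = 0" "\<forall>e\<in>Z'. snd q e = 0"
      and eq: "\<And>x. x \<in> verts (reduced ?G Z) \<Longrightarrow> position ?G' q (\<phi> x) = position ?G p x"
      using pq by (auto simp: W_def)
    have "p \<in> cP \<alpha>" using p C by blast
    then obtain h' where h': "placement D c \<alpha> h'" "p = params (?G, h')" by (rule closure_polyhedronE[OF \<alpha>])
    obtain k' where k': "placement D c \<beta> k'" "q = params (?G', k')" by (rule closure_polyhedronE[OF \<beta> q])
    have w: "weak_curve D c ?G h" "weak_curve D c ?G' k" using h k by (auto simp: placement_def)
    have "Z \<subseteq> zero_edges ?G h'" "Z' \<subseteq> zero_edges ?G' k'"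
      using z Z zero_edges_subset[of ?G h] zero_edges_subset[of ?G' k]
      unfolding placement_zero_edges[OF h'(1)] placement_zero_edges[OF k'(1)] h'(2) k'(2) by blast+
    moreover have "k' (\<phi> x) = h' x" if x: "x \<in> verts (reduced ?G Z)" for x
    proof -
      have "\<phi> x \<in> verts (reduced ?G' Z')" using i x by (auto simp: wgraph_iso_def dest: bij_betwE)
      then have "x \<in> verts ?G" "\<phi> x \<in> verts ?G'" using x reduced(3)[OF w(1)] reduced(3)[OF w(2)] Z by blast+
      then show ?thesis
        using eq[OF x] placement_position[OF h'(1)] placement_position[OF k'(1)] by (simp add: h'(2) k'(2))
    qed
    ultimately have "\<iota> \<alpha> p = \<iota> \<beta> q"
      unfolding h'(2) k'(2) using i Z
      by (intro attaching_maps_agree_in_limit[OF h h'(1) _ k k'(1)]) auto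
    then show "q \<in> {q \<in> cP \<beta>. \<iota> \<beta> q \<in> \<iota> \<alpha> ` C}" using p q by force
  qed
  then have "compact {q \<in> cP \<beta>. \<iota> \<beta> q \<in> \<iota> \<alpha> ` C}"
    using fin cW by (simp add: compact_UN)
  then show ?thesis by (rule compact_imp_closed)
qed

section \<open>The stratified moduli space\<close>

lemma moduli_covered:
  assumes "X \<in> M"
  obtains \<alpha> where "\<alpha> \<in> T" "X \<in> S (cls \<alpha>)"
proof -
  obtain G h where C: "X = R `` {(G, h)}" "(G, h) \<in> simple_curves D c \<omega> g n A" "param_curve D c (G, h)"
    by (rule moduliE[OF assms])
  note t = type_of_simple_curve[OF C(2)]
  have "X \<in> S (cls (type_of_curve D c (G, h)))"
    using mem_stratum_iff[OF t(1) C(3)] assms ctype_iso_refl by (simp add: C(1))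
  then show thesis using that t(1) by blast
qed

lemma topspace_natural: "topspace \<M> = M"
proof -
  have "topspace \<M> = (\<lambda>(\<alpha>, p). \<iota> \<alpha> p) ` (SIGMA \<alpha>:T. cP \<alpha>)"
    by (simp add: natural_topology_def o_def)
  also have "\<dots> = (\<Union>\<alpha>\<in>T. \<iota> \<alpha> ` cP \<alpha>)" by auto
  also have "\<dots> = M"
  proof (rule antisym)
    show "(\<Union>\<alpha>\<in>T. \<iota> \<alpha> ` cP \<alpha>) \<subseteq> M" using attaching_map_moduli by auto
    show "M \<subseteq> (\<Union>\<alpha>\<in>T. \<iota> \<alpha> ` cP \<alpha>)"
    proof
      fix X assume "X \<in> M"
      then obtain \<alpha> where \<alpha>: "\<alpha> \<in> T" "X \<in> S (cls \<alpha>)" by (rule moduli_covered)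
      then have "X \<in> \<iota> \<alpha> ` P \<alpha>" using stratum_eq[OF \<alpha>(1)] by simp
      then have "X \<in> \<iota> \<alpha> ` cP \<alpha>" using image_mono[OF closure_subset] by (rule subsetD[rotated])
      with \<alpha>(1) show "X \<in> (\<Union>\<alpha>\<in>T. \<iota> \<alpha> ` cP \<alpha>)" by (rule UN_I)
    qed
  qed
  finally show ?thesis .
qed

lemma closedin_natural:
  assumes K: "K \<subseteq> M"
  shows "closedin \<M> K \<longleftrightarrow> (\<forall>\<beta>\<in>T. closed {q \<in> cP \<beta>. \<iota> \<beta> q \<in> K})"
proof -
  let ?X = "sum_topology (\<lambda>\<alpha>. top_of_set (cP \<alpha>)) T" and ?f = "\<lambda>(\<alpha>, p). \<iota> \<alpha> p"
  have q: "quotient_map ?X \<M> ?f"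
    unfolding natural_topology_def by (rule quotient_map_quotient_topology)
  then have "closedin \<M> K \<longleftrightarrow> closedin ?X {x. x \<in> topspace ?X \<and> ?f x \<in> K}"
    using K topspace_natural unfolding quotient_map_closedin by blast
  also have "\<dots> \<longleftrightarrow> (\<forall>\<beta>\<in>T. closedin (top_of_set (cP \<beta>)) {q. (\<beta>, q) \<in> {x. x \<in> topspace ?X \<and> ?f x \<in> K}})"
    unfolding closedin_sum_topology by (auto simp: o_def)
  also have "\<dots> \<longleftrightarrow> (\<forall>\<beta>\<in>T. closed {q \<in> cP \<beta>. \<iota> \<beta> q \<in> K})"
  proof (rule ball_cong[OF refl])
    fix \<beta> assume "\<beta> \<in> T"
    then have "{q. (\<beta>, q) \<in> {x. x \<in> topspace ?X \<and> ?f x \<in> K}} = {q \<in> cP \<beta>. \<iota> \<beta> q \<in> K}" by auto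
    then show "closedin (top_of_set (cP \<beta>)) {q. (\<beta>, q) \<in> {x. x \<in> topspace ?X \<and> ?f x \<in> K}} \<longleftrightarrow>
        closed {q \<in> cP \<beta>. \<iota> \<beta> q \<in> K}"
      by (simp add: closedin_closed_eq)
  qed
  finally show ?thesis .
qed

lemma continuous_attaching_map:
  assumes \<alpha>: "\<alpha> \<in> T"
  shows "continuous_map (top_of_set (cP \<alpha>)) \<M> (\<iota> \<alpha>)"
  unfolding continuous_map_closedin
proof (intro conjI allI impI)
  show "\<iota> \<alpha> \<in> topspace (top_of_set (cP \<alpha>)) \<rightarrow> topspace \<M>"
    using attaching_map_moduli[OF \<alpha>] by (simp add: topspace_natural)
  fix K assume "closedin \<M> K"
  then have "K \<subseteq> M" and "closed {q \<in> cP \<alpha>. \<iota> \<alpha> q \<in> K}"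
    using closedin_subset[of \<M> K] closedin_natural \<alpha> by (auto simp: topspace_natural)
  then show "closedin (top_of_set (cP \<alpha>)) {x \<in> topspace (top_of_set (cP \<alpha>)). \<iota> \<alpha> x \<in> K}"
    by (simp add: closedin_closed_eq)
qed

lemma closedin_image_compact:
  assumes \<alpha>: "\<alpha> \<in> T" and C: "compact C" "C \<subseteq> cP \<alpha>"
  shows "closedin \<M> (\<iota> \<alpha> ` C)"
proof -
  have "\<iota> \<alpha> ` C \<subseteq> M" using attaching_map_moduli[OF \<alpha>] C by auto
  then show ?thesis using closedin_natural closed_preimage_of_compact[OF \<alpha> _ C] by blast
qed

lemma polyhedron_subset_closure: "P \<alpha> \<subseteq> cP \<alpha>"
  by (rule closure_subset)

lemma closure_stratum:
  assumes \<alpha>: "\<alpha> \<in> T"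
  shows "\<M> closure_of S (cls \<alpha>) = \<iota> \<alpha> ` cP \<alpha>"
proof (rule antisym)
  show "\<M> closure_of S (cls \<alpha>) \<subseteq> \<iota> \<alpha> ` cP \<alpha>"
    unfolding stratum_eq[OF \<alpha>]
    by (intro closure_of_minimal closedin_image_compact[OF \<alpha>] image_mono polyhedron_subset_closure
        closure_compact[OF \<alpha>] order_refl)
  have "top_of_set (cP \<alpha>) closure_of P \<alpha> = cP \<alpha>"
    using polyhedron_subset_closure[of \<alpha>] by (simp add: closure_of_subtopology Int_absorb1)
  then show "\<iota> \<alpha> ` cP \<alpha> \<subseteq> \<M> closure_of S (cls \<alpha>)"
    using continuous_map_image_closure_subset[OF continuous_attaching_map[OF \<alpha>], of "P \<alpha>"]
    by (simp add: stratum_eq[OF \<alpha>])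
qed

lemma compact_boundary:
  assumes \<alpha>: "\<alpha> \<in> T"
  shows "compact (cP \<alpha> - P \<alpha>)"
proof -
  let ?G = "fst \<alpha>"
  obtain h0 where h0: "strict_placement D c \<alpha> h0" using \<alpha> good_types_iff[OF c] by blast
  have fin: "finite (edges ?G)" "finite (verts ?G)" using wf_finite[OF good_comb_type(2)[OF \<alpha>]] by auto
  let ?B = "(\<Union>e\<in>edges ?G. {p. snd p e = 0}) \<union> (\<Union>v\<in>verts ?G. \<Union>i\<in>snd \<alpha> v. {p. position ?G p v $ i = 0})"
  have "cP \<alpha> - P \<alpha> = cP \<alpha> \<inter> ?B"
  proof -
    have "p \<in> P \<alpha> \<longleftrightarrow> p \<notin> ?B" if p: "p \<in> cP \<alpha>" for p
    proof -
      have p': "p \<in> params ` Pair ?G ` {h. placement D c \<alpha> h}" using p closure_polyhedron[OF c h0] by simp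
      then have "\<forall>e\<in>edges ?G. 0 \<le> snd p e" "\<And>v. v \<in> verts ?G \<Longrightarrow> position ?G p v \<in> face_simplex c (snd \<alpha> v)"
        unfolding placement_params_iff[OF c h0] by blast+
      then have "(\<forall>e\<in>edges ?G. 0 < snd p e) \<longleftrightarrow> (\<forall>e\<in>edges ?G. snd p e \<noteq> 0)"
        "\<And>v. v \<in> verts ?G \<Longrightarrow> supp (position ?G p v) = snd \<alpha> v \<longleftrightarrow> (\<forall>i\<in>snd \<alpha> v. position ?G p v $ i \<noteq> 0)"
        by (auto simp: less_le face_simplex_iff supp_def)
      then show ?thesis unfolding polyhedron_of_iff[OF c h0] using p' by auto
    qed
    then show ?thesis by blast
  qed
  moreover have "closed ?B"
    using fin by (intro closed_Un closed_UN closed_Collect_eq continuous_intros ballI) auto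
  ultimately show ?thesis using closure_compact[OF \<alpha>] by (simp add: compact_Int_closed)
qed

text \<open>The boundary of the polyhedron is compact, and its image is closed and avoids the stratum.\<close>

lemma stratum_locally_closed:
  assumes \<alpha>: "\<alpha> \<in> T"
  shows "\<exists>U K. openin \<M> U \<and> closedin \<M> K \<and> S (cls \<alpha>) = U \<inter> K"
proof (intro exI conjI)
  show "openin \<M> (topspace \<M> - \<iota> \<alpha> ` (cP \<alpha> - P \<alpha>))"
    by (intro openin_diff openin_topspace closedin_image_compact[OF \<alpha> compact_boundary[OF \<alpha>]]) auto
  show "closedin \<M> (\<iota> \<alpha> ` cP \<alpha>)"
    by (rule closedin_image_compact[OF \<alpha> closure_compact[OF \<alpha>] order_refl])
  have "X \<notin> \<iota> \<alpha> ` (cP \<alpha> - P \<alpha>)" if "X \<in> S (cls \<alpha>)" for X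
    using boundary_not_in_stratum[OF \<alpha>] that by blast
  moreover have "S (cls \<alpha>) \<subseteq> topspace \<M>" unfolding topspace_natural using stratum_subset by blast
  ultimately show "S (cls \<alpha>) = (topspace \<M> - \<iota> \<alpha> ` (cP \<alpha> - P \<alpha>)) \<inter> \<iota> \<alpha> ` cP \<alpha>"
    using polyhedron_subset_closure[of \<alpha>] unfolding stratum_eq[OF \<alpha>] by blast
qed

lemma strata_disjoint:
  assumes \<alpha>: "\<alpha> \<in> T" and \<beta>: "\<beta> \<in> T" and X: "X \<in> S (cls \<alpha>)" "X \<in> S (cls \<beta>)"
  shows "cls \<alpha> = cls \<beta>"
proof -
  have "X \<in> M" using X stratum_subset by blast
  then obtain G h where C: "X = R `` {(G, h)}" "param_curve D c (G, h)"
    by (rule moduliE)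
  note wf = good_comb_type(2)
  have "ctype_iso \<alpha> (type_of_curve D c (G, h))" "ctype_iso \<beta> (type_of_curve D c (G, h))"
    using X mem_stratum_iff[OF _ C(2)] \<alpha> \<beta> by (auto simp: C(1))
  moreover have "wgraph_wf (fst (type_of_curve D c (G, h)))"
    using param_curve_wf[OF c C(2)] by (simp add: type_of_curve_def)
  ultimately have "ctype_iso \<alpha> \<beta>" using ctype_iso_sym[OF wf[OF \<beta>]] ctype_iso_trans[OF wf[OF \<alpha>]] by blast
  then have "(\<alpha>, \<beta>) \<in> ctype_iso_rel"
    using good_comb_type(1) \<alpha> \<beta> by (simp add: ctype_iso_rel_def)
  then show ?thesis by (rule equiv_class_eq[OF equiv_ctype_iso_rel])
qed

lemma stratum_nonempty:
  assumes \<alpha>: "\<alpha> \<in> T"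
  shows "S (cls \<alpha>) \<noteq> {}"
proof -
  obtain h0 where h0: "strict_placement D c \<alpha> h0" using \<alpha> good_types_iff[OF c] by blast
  then have "params (fst \<alpha>, h0) \<in> P \<alpha>" unfolding polyhedron_of_eq[OF c h0] by blast
  then show ?thesis unfolding stratum_eq[OF \<alpha>] by blast
qed

lemma finite_types: "finite (T // ctype_iso_rel)"
  by (rule finite_good_types[OF c \<omega> A])

lemma classE:
  assumes "a \<in> T // ctype_iso_rel"
  obtains \<alpha> where "\<alpha> \<in> T" "a = cls \<alpha>"
  using assms by (auto simp: quotient_def)

lemma stratum_inj: "inj_on S (T // ctype_iso_rel)"
proof (rule inj_onI)
  fix a b assume "a \<in> T // ctype_iso_rel" "b \<in> T // ctype_iso_rel" and eq: "S a = S b"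
  then obtain \<alpha> \<beta> where ab: "\<alpha> \<in> T" "a = cls \<alpha>" "\<beta> \<in> T" "b = cls \<beta>" by (metis classE)
  obtain X where "X \<in> S a" using stratum_nonempty[OF ab(1)] ab(2) by blast
  then show "a = b" using strata_disjoint[OF ab(1,3)] eq ab by blast
qed

lemma stratification_natural: "stratification \<M> (S ` (T // ctype_iso_rel))"
  unfolding stratification_def
proof (intro conjI ballI impI)
  show "finite (S ` (T // ctype_iso_rel))" using finite_types by simp
  show "partition_on (topspace \<M>) (S ` (T // ctype_iso_rel))"
  proof (rule partition_onI)
    show "\<Union> (S ` (T // ctype_iso_rel)) = topspace \<M>"
      unfolding topspace_natural
    proof (rule antisym)
      show "\<Union> (S ` (T // ctype_iso_rel)) \<subseteq> M"
        by (auto intro: subsetD[OF stratum_subset])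
      show "M \<subseteq> \<Union> (S ` (T // ctype_iso_rel))"
      proof
        fix X assume "X \<in> M"
        then obtain \<alpha> where "\<alpha> \<in> T" "X \<in> S (cls \<alpha>)" by (rule moduli_covered)
        then show "X \<in> \<Union> (S ` (T // ctype_iso_rel))" by (blast intro: quotientI)
      qed
    qed
    show "disjnt p q" if pq: "p \<in> S ` (T // ctype_iso_rel)" "q \<in> S ` (T // ctype_iso_rel)" "p \<noteq> q" for p q
    proof -
      obtain \<alpha> \<beta> where ab: "\<alpha> \<in> T" "p = S (cls \<alpha>)" "\<beta> \<in> T" "q = S (cls \<beta>)"
        using pq(1,2) by (auto elim!: classE)
      then have "cls \<alpha> \<noteq> cls \<beta>" using pq(3) by metis
      then show ?thesis unfolding disjnt_def ab(2,4) using strata_disjoint[OF ab(1,3)] by blast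
    qed
    show "{} \<notin> S ` (T // ctype_iso_rel)"
    proof
      assume "{} \<in> S ` (T // ctype_iso_rel)"
      then obtain a where a: "{} = S a" "a \<in> T // ctype_iso_rel" by (rule imageE)
      obtain \<alpha> where \<alpha>: "\<alpha> \<in> T" "a = cls \<alpha>" by (rule classE[OF a(2)])
      show False using stratum_nonempty[OF \<alpha>(1)] unfolding \<alpha>(2)[symmetric] a(1)[symmetric] by (rule notE) (rule refl)
    qed
  qed
  fix s assume "s \<in> S ` (T // ctype_iso_rel)"
  then obtain \<alpha> where \<alpha>: "\<alpha> \<in> T" "s = S (cls \<alpha>)" by (auto elim!: classE)
  show "\<exists>U K. openin \<M> U \<and> closedin \<M> K \<and> s = U \<inter> K"
    unfolding \<alpha>(2) by (rule stratum_locally_closed[OF \<alpha>(1)])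
  fix t assume "t \<in> S ` (T // ctype_iso_rel)" and ne: "t \<inter> \<M> closure_of s \<noteq> {}"
  then obtain \<beta> where \<beta>: "\<beta> \<in> T" "t = S (cls \<beta>)" by (auto elim!: classE)
  obtain p where "p \<in> cP \<alpha>" "\<iota> \<alpha> p \<in> S (cls \<beta>)"
    using ne unfolding \<alpha>(2) \<beta>(2) closure_stratum[OF \<alpha>(1)] by blast
  then show "t \<subseteq> \<M> closure_of s"
    unfolding \<alpha>(2) \<beta>(2) closure_stratum[OF \<alpha>(1)] by (rule stratum_subset_image[OF \<alpha>(1) \<beta>(1)])
qed

text \<open>Finitely many types represent all isomorphism classes, and their closed polyhedra cover the space.\<close>

lemma compact_natural: "compact_space \<M>"
proof -
  define rep where "rep a = (SOME \<alpha>. \<alpha> \<in> T \<and> a = cls \<alpha>)" for a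
  have rep: "rep a \<in> T" "a = cls (rep a)" if "a \<in> T // ctype_iso_rel" for a
  proof -
    have "\<exists>\<alpha>. \<alpha> \<in> T \<and> a = cls \<alpha>" using classE[OF that] by metis
    then have "rep a \<in> T \<and> a = cls (rep a)" unfolding rep_def by (rule someI_ex)
    then show "rep a \<in> T" "a = cls (rep a)" by blast+
  qed
  have cpt: "compactin \<M> (\<iota> (rep a) ` cP (rep a))" if "a \<in> T // ctype_iso_rel" for a
  proof (rule image_compactin)
    show "compactin (top_of_set (cP (rep a))) (cP (rep a))"
      using closure_compact[OF rep(1)[OF that]] by (simp add: compactin_subtopology)
  qed (rule continuous_attaching_map[OF rep(1)[OF that]])
  have "compactin \<M> (\<Union> ((\<lambda>a. \<iota> (rep a) ` cP (rep a)) ` (T // ctype_iso_rel)))"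
    using finite_types cpt by (intro compactin_Union) auto
  moreover have "\<Union> ((\<lambda>a. \<iota> (rep a) ` cP (rep a)) ` (T // ctype_iso_rel)) = topspace \<M>"
  proof (rule antisym)
    show "\<Union> ((\<lambda>a. \<iota> (rep a) ` cP (rep a)) ` (T // ctype_iso_rel)) \<subseteq> topspace \<M>"
      using cpt compactin_subset_topspace by blast
    show "topspace \<M> \<subseteq> \<Union> ((\<lambda>a. \<iota> (rep a) ` cP (rep a)) ` (T // ctype_iso_rel))"
    proof
      fix X assume "X \<in> topspace \<M>"
      then have "X \<in> M" by (simp add: topspace_natural)
      then obtain \<alpha> where \<alpha>: "\<alpha> \<in> T" "X \<in> S (cls \<alpha>)" by (rule moduli_covered)
      have a: "cls \<alpha> \<in> T // ctype_iso_rel" using \<alpha>(1) by (rule quotientI)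
      have "X \<in> S (cls (rep (cls \<alpha>)))" using \<alpha>(2) rep(2)[OF a] by simp
      then have "X \<in> \<iota> (rep (cls \<alpha>)) ` P (rep (cls \<alpha>))" using stratum_eq[OF rep(1)[OF a]] by simp
      then show "X \<in> \<Union> ((\<lambda>a. \<iota> (rep a) ` cP (rep a)) ` (T // ctype_iso_rel))"
        using a polyhedron_subset_closure by blast
    qed
  qed
  ultimately show ?thesis by (simp add: compact_space_def)
qed

text \<open>A closed subset of the open polyhedron extends to a compact subset of the closed one, whose image is
  closed; the points added lie on the boundary and are not mapped into the stratum.\<close>

lemma quotient_map_stratum:
  assumes \<alpha>: "\<alpha> \<in> T"
  shows "quotient_map (top_of_set (P \<alpha>)) (subtopology \<M> (S (cls \<alpha>))) (\<iota> \<alpha>)"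
proof -
  note eq = stratum_eq[OF \<alpha>]
  have sub: "S (cls \<alpha>) \<subseteq> M" by (rule stratum_subset)
  have top: "topspace (subtopology \<M> (S (cls \<alpha>))) = S (cls \<alpha>)"
    using sub by (simp add: topspace_natural Int_absorb1)
  have cont: "continuous_map (top_of_set (P \<alpha>)) (subtopology \<M> (S (cls \<alpha>))) (\<iota> \<alpha>)"
    unfolding continuous_map_in_subtopology
  proof
    have "top_of_set (P \<alpha>) = subtopology (top_of_set (cP \<alpha>)) (P \<alpha>)"
      using polyhedron_subset_closure[of \<alpha>] by (simp add: subtopology_subtopology Int_absorb1)
    then show "continuous_map (top_of_set (P \<alpha>)) \<M> (\<iota> \<alpha>)"
      using continuous_map_from_subtopology[OF continuous_attaching_map[OF \<alpha>]] by simp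
    show "\<iota> \<alpha> \<in> topspace (top_of_set (P \<alpha>)) \<rightarrow> S (cls \<alpha>)" using eq by auto
  qed
  show ?thesis
    unfolding quotient_map_closedin
  proof (intro conjI allI impI)
    show "\<iota> \<alpha> ` topspace (top_of_set (P \<alpha>)) = topspace (subtopology \<M> (S (cls \<alpha>)))"
      unfolding top by (simp add: eq)
    fix U assume "U \<subseteq> topspace (subtopology \<M> (S (cls \<alpha>)))"
    then have U: "U \<subseteq> S (cls \<alpha>)" using top by simp
    let ?B = "{p. p \<in> topspace (top_of_set (P \<alpha>)) \<and> \<iota> \<alpha> p \<in> U}"
    show "closedin (top_of_set (P \<alpha>)) ?B \<longleftrightarrow> closedin (subtopology \<M> (S (cls \<alpha>))) U"
    proof
      assume "closedin (subtopology \<M> (S (cls \<alpha>))) U"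
      then show "closedin (top_of_set (P \<alpha>)) ?B" using cont unfolding continuous_map_closedin by blast
    next
      assume "closedin (top_of_set (P \<alpha>)) ?B"
      then obtain F where F: "closed F" "?B = P \<alpha> \<inter> F" by (auto simp: closedin_closed)
      have "compact (cP \<alpha> \<inter> F)" using closure_compact[OF \<alpha>] F(1) by (rule compact_Int_closed)
      then have K: "closedin \<M> (\<iota> \<alpha> ` (cP \<alpha> \<inter> F))" by (rule closedin_image_compact[OF \<alpha>]) simp
      have "U = \<iota> \<alpha> ` (cP \<alpha> \<inter> F) \<inter> S (cls \<alpha>)"
      proof (intro set_eqI iffI)
        fix X assume X: "X \<in> U"
        then obtain p where p: "p \<in> P \<alpha>" "X = \<iota> \<alpha> p" using U eq by blast
        then have "p \<in> ?B" using X by simp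
        then have "p \<in> F" using F(2) by blast
        then show "X \<in> \<iota> \<alpha> ` (cP \<alpha> \<inter> F) \<inter> S (cls \<alpha>)"
          using p X U polyhedron_subset_closure[of \<alpha>] by blast
      next
        fix X assume X: "X \<in> \<iota> \<alpha> ` (cP \<alpha> \<inter> F) \<inter> S (cls \<alpha>)"
        then obtain p where p: "p \<in> cP \<alpha>" "p \<in> F" "X = \<iota> \<alpha> p" by blast
        then have "p \<in> P \<alpha>" using boundary_not_in_stratum[OF \<alpha>] X by blast
        then have "p \<in> ?B" using p(2) F(2) by blast
        then show "X \<in> U" using p(3) by simp
      qed
      then show "closedin (subtopology \<M> (S (cls \<alpha>))) U"
        using K closedin_subtopology by blast
    qed
  qed
qed

text \<open>An isomorphism between two curves of the same labelled type is an automorphism of the type, since the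
  carriers are determined by the positions.\<close>

lemma same_orbit_iff:
  assumes \<alpha>: "\<alpha> \<in> T" and p: "p \<in> P \<alpha>" and q: "q \<in> P \<alpha>"
  shows "\<iota> \<alpha> p = \<iota> \<alpha> q \<longleftrightarrow> same_orbit \<alpha> p q"
proof -
  let ?G = "fst \<alpha>"
  note wf = good_comb_type(2)[OF \<alpha>]
  obtain h0 where h0: "strict_placement D c \<alpha> h0" and sim: "simple_wgraph ?G"
    using \<alpha> good_types_iff[OF c] by blast
  obtain h where h: "strict_placement D c \<alpha> h" "p = params (?G, h)"
    using p unfolding polyhedron_of_eq[OF c h0] by blast
  obtain k where k: "strict_placement D c \<alpha> k" "q = params (?G, k)"
    using q unfolding polyhedron_of_eq[OF c h0] by blast
  have ph: "param_curve D c (?G, h)" and pk: "param_curve D c (?G, k)"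
    and I: "\<And>v. v \<in> verts ?G \<Longrightarrow> supp (h v) = snd \<alpha> v" "\<And>v. v \<in> verts ?G \<Longrightarrow> supp (k v) = snd \<alpha> v"
    using h k by (auto simp: strict_placement_def)
  have r: "realizes ?G p h" "realizes ?G q k"
    unfolding h(2) k(2) using param_weak[OF ph] param_weak[OF pk] realizes_params by blast+
  have "\<iota> \<alpha> p = \<iota> \<alpha> q \<longleftrightarrow> curve_iso (?G, k) (?G, h)"
    unfolding h(2) k(2) attaching_map_strict[OF h(1) sim] attaching_map_strict[OF k(1) sim]
    using class_eq_iff[OF pk ph] by auto
  also have "\<dots> \<longleftrightarrow> same_orbit \<alpha> p q"
  proof
    assume "curve_iso (?G, k) (?G, h)"
    then obtain \<phi> \<psi> where i: "wgraph_iso \<phi> \<psi> ?G ?G" and hk: "\<And>v. v \<in> verts ?G \<Longrightarrow> h (\<phi> v) = k v"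
      by (auto simp: curve_iso_def)
    have \<phi>V: "\<phi> v \<in> verts ?G" if "v \<in> verts ?G" for v using i that by (auto simp: wgraph_iso_def dest: bij_betwE)
    have "snd \<alpha> (\<phi> v) = snd \<alpha> v" if "v \<in> verts ?G" for v
      using I(1)[OF \<phi>V[OF that]] I(2)[OF that] hk[OF that] by simp
    then have aut: "(\<phi>, \<psi>) \<in> automorphisms \<alpha>" using i by (simp add: automorphisms_def ctype_iso_via_def)
    have "q = (h (\<phi> (root ?G)), \<lambda>e. if e \<in> edges ?G then snd p (\<psi> e) else 0)"
    proof (rule prod_eqI)
      show "fst q = fst (h (\<phi> (root ?G)), \<lambda>e. if e \<in> edges ?G then snd p (\<psi> e) else 0)"
        using hk[OF root_in_verts[OF wf]] by (simp add: k(2) params_def)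
      show "snd q = snd (h (\<phi> (root ?G)), \<lambda>e. if e \<in> edges ?G then snd p (\<psi> e) else 0)"
      proof
        fix e
        have "k ` ends ?G e = h ` ends ?G (\<psi> e)" "\<psi> e \<in> edges ?G" if e: "e \<in> edges ?G"
        proof -
          have "ends ?G (\<psi> e) = \<phi> ` ends ?G e" using i e by (simp add: wgraph_iso_def)
          then show "k ` ends ?G e = h ` ends ?G (\<psi> e)"
            using hk wf_ends(1)[OF wf e] by (force simp: image_image)
          show "\<psi> e \<in> edges ?G" using i e by (auto simp: wgraph_iso_def dest: bij_betwE)
        qed
        then show "snd q e = snd (h (\<phi> (root ?G)), \<lambda>e. if e \<in> edges ?G then snd p (\<psi> e) else 0) e"
          by (simp add: k(2) h(2) params_def)
      qed
    qed
    then show "same_orbit \<alpha> p q" unfolding same_orbit_def using aut r(1) by blast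
  next
    assume "same_orbit \<alpha> p q"
    then obtain \<phi> \<psi> h' where i: "wgraph_iso \<phi> \<psi> ?G ?G" and r': "realizes ?G p h'"
      and q': "q = (h' (\<phi> (root ?G)), \<lambda>e. if e \<in> edges ?G then snd p (\<psi> e) else 0)"
      by (auto simp: same_orbit_def automorphisms_def ctype_iso_via_def)
    have hh: "h' v = h v" if "v \<in> verts ?G" for v using realizes_unique[OF c wf r(1) r' that] .
    have \<phi>V: "\<phi> v \<in> verts ?G" if "v \<in> verts ?G" for v using i that by (auto simp: wgraph_iso_def dest: bij_betwE)
    have "realizes ?G q (h' \<circ> \<phi>)"
      unfolding realizes_def
    proof (intro conjI ballI allI impI)
      show "(h' \<circ> \<phi>) (root ?G) = fst q" by (simp add: q')
      fix e u v assume e: "e \<in> edges ?G" "ends ?G e = {u, v}"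
      have "\<psi> e \<in> edges ?G" "ends ?G (\<psi> e) = {\<phi> u, \<phi> v}" "wt ?G (\<phi> u) (\<psi> e) = wt ?G u e"
        using i e by (auto simp: wgraph_iso_def dest: bij_betwE)
      then have "h' (\<phi> v) - h' (\<phi> u) = (snd p (\<psi> e) / norm (real_vec (wt ?G u e))) *\<^sub>R real_vec (wt ?G u e)"
        using r' unfolding realizes_def by metis
      then show "(h' \<circ> \<phi>) v - (h' \<circ> \<phi>) u = (snd q e / norm (real_vec (wt ?G u e))) *\<^sub>R real_vec (wt ?G u e)"
        using e by (simp add: q')
    qed
    then have "h (\<phi> v) = k v" if "v \<in> verts ?G" for v
      using realizes_unique[OF c wf r(2) _ that] hh[OF \<phi>V[OF that]] by simp
    then show "curve_iso (?G, k) (?G, h)" using i by (auto simp: curve_iso_def)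
  qed
  finally show ?thesis .
qed

lemma homeomorphic_stratum:
  assumes \<alpha>: "\<alpha> \<in> T" and triv: "\<forall>(\<phi>, \<psi>)\<in>automorphisms \<alpha>.
      (\<forall>v\<in>verts (fst \<alpha>). \<phi> v = v) \<and> (\<forall>e\<in>edges (fst \<alpha>). \<psi> e = e)"
  shows "homeomorphic_map (top_of_set (P \<alpha>)) (subtopology \<M> (S (cls \<alpha>))) (\<iota> \<alpha>)"
  unfolding homeomorphic_map_def
proof (intro conjI quotient_map_stratum[OF \<alpha>] inj_onI)
  let ?G = "fst \<alpha>"
  note wf = good_comb_type(2)[OF \<alpha>]
  obtain h0 where h0: "strict_placement D c \<alpha> h0" using \<alpha> good_types_iff[OF c] by blast
  fix p q assume "p \<in> topspace (top_of_set (P \<alpha>))" "q \<in> topspace (top_of_set (P \<alpha>))" "\<iota> \<alpha> p = \<iota> \<alpha> q"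
  then have p: "p \<in> P \<alpha>" and "same_orbit \<alpha> p q" using same_orbit_iff[OF \<alpha>] by auto
  then obtain \<phi> \<psi> h where aut: "(\<phi>, \<psi>) \<in> automorphisms \<alpha>" and r: "realizes ?G p h"
    and q: "q = (h (\<phi> (root ?G)), \<lambda>e. if e \<in> edges ?G then snd p (\<psi> e) else 0)"
    by (auto simp: same_orbit_def)
  have "\<phi> (root ?G) = root ?G" "\<And>e. e \<in> edges ?G \<Longrightarrow> \<psi> e = e"
    using triv aut root_in_verts[OF wf] by auto
  moreover have "\<forall>e. e \<notin> edges ?G \<longrightarrow> snd p e = 0"
    using p unfolding polyhedron_of_iff[OF c h0] placement_params_iff[OF c h0] by blast
  ultimately show "p = q" using r by (auto simp: q realizes_def prod_eq_iff)
qed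

end

end

theorem theorem6p1:
  fixes Xs :: "'p topology" and D :: "'i::finite \<Rightarrow> 'p set" and c A :: real
    and \<omega> :: "'i set \<Rightarrow> 'i \<Rightarrow> ennreal" and g n :: nat
  assumes "special_fiber_components Xs D"
    and "0 < c"
    and "simple_density D \<omega>"
    and "0 < A"
  shows "let \<M> = natural_topology D c \<omega> g n A;
             \<T> = good_types D c \<omega> g n A;
             \<S> = stratum D c \<omega> g n A
    in topspace \<M> = moduli D c \<omega> g n A \<and>
       compact_space \<M> \<and>
       stratification \<M> (\<S> ` (\<T> // ctype_iso_rel)) \<and>
       inj_on \<S> (\<T> // ctype_iso_rel) \<and>
       (\<forall>\<alpha>\<in>\<T>.
         let M = polyhedron_of D c \<alpha>;
             S = \<S> (ctype_iso_rel `` {\<alpha>});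
             \<iota> = attaching_map D c \<alpha>
         in open_convex_polyhedron_in (edges (fst \<alpha>)) (affine_space_of c \<alpha>) M \<and>
            quotient_map (top_of_set M) (subtopology \<M> S) \<iota> \<and>
            (\<forall>p\<in>M. \<forall>q\<in>M. \<iota> p = \<iota> q \<longleftrightarrow> same_orbit \<alpha> p q) \<and>
            ((\<forall>(\<phi>, \<psi>)\<in>automorphisms \<alpha>.
                 (\<forall>v\<in>verts (fst \<alpha>). \<phi> v = v) \<and> (\<forall>e\<in>edges (fst \<alpha>). \<psi> e = e)) \<longrightarrow>
               homeomorphic_map (top_of_set M) (subtopology \<M> S) \<iota>))"
proof -
  note c = assms(2) and \<omega> = assms(3) and A = assms(4)
  have poly: "open_convex_polyhedron_in (edges (fst \<alpha>)) (affine_space_of c \<alpha>) (polyhedron_of D c \<alpha>)"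
    if "\<alpha> \<in> good_types D c \<omega> g n A" for \<alpha>
    using that good_types_iff[OF c] open_convex_polyhedron[OF c] by blast
  have hom: "(\<forall>(\<phi>, \<psi>)\<in>automorphisms \<alpha>.
      (\<forall>v\<in>verts (fst \<alpha>). \<phi> v = v) \<and> (\<forall>e\<in>edges (fst \<alpha>). \<psi> e = e)) \<longrightarrow>
      homeomorphic_map (top_of_set (polyhedron_of D c \<alpha>))
        (subtopology (natural_topology D c \<omega> g n A) (stratum D c \<omega> g n A (ctype_iso_rel `` {\<alpha>})))
        (attaching_map D c \<alpha>)"
    if "\<alpha> \<in> good_types D c \<omega> g n A" for \<alpha>
    using homeomorphic_stratum[OF c \<omega> A that] by (rule impI)
  show ?thesis
    unfolding Let_def
    by (intro conjI ballI topspace_natural[OF c \<omega> A] compact_natural[OF c \<omega> A]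
        stratification_natural[OF c \<omega> A] stratum_inj[OF c \<omega> A] quotient_map_stratum[OF c \<omega> A]
        same_orbit_iff[OF c \<omega> A] poly hom)
qed

end
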